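(* Let $0\le l<k<n$ be integers, $\alpha\ge 0$, let $\Omega\subset\mathbb{R}^n$ be a bounded domain and let $f\in C^2(\overline\Omega\times\mathbb{R}\times\mathbb{R}^n)$ with $f>0$. Suppose that $u\in C^4(\Omega)\cap C^2(\overline\Omega)$ is a $(k-1)$-admissible solution of the Dirichlet problem $$\frac{\sigma_k(\eta)+\alpha\sigma_{k-1}(\eta)}{\sigma_l(\eta)+\alpha\sigma_{l-1}(\eta)}=f(x,u,Du)\ \text{ in }\Omega,\qquad u=0\ \text{ on }\partial\Omega,$$ where $\eta=\eta(x)$ is the vector of eigenvalues of $(\Delta u)I-D^2u$ at $x$. Then $$(-u)|D^2u|\le C\quad\text{in }\Omega,$$ where $C$ depends only on $n$, $k$, $l$, $m$, $|f|_{C^2}$ and $|u|_{C^1}$. Here $m>0$ is a lower bound for $f(x,u(x),Du(x))$, $x\in\overline\Omega$.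
   Context: For $\lambda\in\mathbb{R}^n$, $\sigma_j(\lambda)=\sum_{1\le i_1<\cdots<i_j\le n}\lambda_{i_1}\cdots\lambda_{i_j}$ for $1\le j\le n$, with $\sigma_0=1$ and $\sigma_j=0$ for $j<0$ or $j>n$. If $\lambda=(\lambda_1,\dots,\lambda_n)$ are the eigenvalues of $D^2u(x)$, then $\eta=(\eta_1,\dots,\eta_n)$ with $\eta_i=\sum_{j\ne i}\lambda_j$; these are the eigenvalues of $(\Delta u)I-D^2u$. A function $u\in C^2(\Omega)$ is called $j$-admissible if for every $x\in\Omega$ the vector $\eta(x)$ satisfies $\sigma_i(\eta(x))>0$ for all $i=1,\dots,j$ (no condition if $j=0$). $|u|_{C^1}$ is the $C^1$ norm of $u$ on $\overline\Omega$, and $|f|_{C^2}$ is the $C^2$ norm of $f$ over the compact set of $(x,z,p)$ with $x\in\overline\Omega$, $|z|\le |u|_{C^1}$, $|p|\le|u|_{C^1}$. *)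

theory Defs
  imports "HOL-Analysis.Analysis"
begin

definition bounded_domain :: "'a::euclidean_space set \<Rightarrow> bool" where
  "bounded_domain \<Omega> \<longleftrightarrow> open \<Omega> \<and> connected \<Omega> \<and> \<Omega> \<noteq> {} \<and> bounded \<Omega>"

definition pd :: "'a::euclidean_space \<Rightarrow> ('a \<Rightarrow> real) \<Rightarrow> 'a \<Rightarrow> real" where
  "pd b g x = frechet_derivative g (at x) b"

(* In C_open and C_closed the set U is meant to be open. *)
primrec C_open :: "nat \<Rightarrow> 'a::euclidean_space set \<Rightarrow> ('a \<Rightarrow> real) \<Rightarrow> bool" where
  "C_open 0 U g \<longleftrightarrow> continuous_on U g"
| "C_open (Suc k) U g \<longleftrightarrow>
     continuous_on U g \<and> g differentiable_on U \<and> (\<forall>b\<in>Basis. C_open k U (pd b g))"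

(* The partial derivative of g on the open set U, extended by its limits to the closure of U. *)
definition pd_cl :: "'a::euclidean_space set \<Rightarrow> 'a \<Rightarrow> ('a \<Rightarrow> real) \<Rightarrow> 'a \<Rightarrow> real" where
  "pd_cl U b g x = (if x \<in> U then pd b g x else Lim (at x within U) (pd b g))"

(* C^k(closure U): g is C^k in U, and g and all its derivatives of order at most k
   extend continuously to the closure; g itself is required to agree with its extension. *)
primrec C_closed :: "nat \<Rightarrow> 'a::euclidean_space set \<Rightarrow> ('a \<Rightarrow> real) \<Rightarrow> bool" where
  "C_closed 0 U g \<longleftrightarrow> continuous_on (closure U) g"
| "C_closed (Suc k) U g \<longleftrightarrow>
     continuous_on (closure U) g \<and> g differentiable_on U \<and> (\<forall>b\<in>Basis. C_closed k U (pd_cl U b g))"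

(* The C^k norm over K, for K contained in the closure of U: the sum, over all iterated partial
   derivatives of order at most k (mixed ones once for each order of differentiation), of the
   supremum of the absolute value over K.  Summing the first derivatives, rather than taking
   their maximum, makes the C^1 norm dominate the Euclidean norm of the gradient. *)
primrec C_norm :: "nat \<Rightarrow> 'a::euclidean_space set \<Rightarrow> 'a set \<Rightarrow> ('a \<Rightarrow> real) \<Rightarrow> real" where
  "C_norm 0 U K g = (SUP x\<in>K. \<bar>g x\<bar>)"
| "C_norm (Suc k) U K g = (SUP x\<in>K. \<bar>g x\<bar>) + (\<Sum>b\<in>Basis. C_norm k U K (pd_cl U b g))"

definition grad_cl :: "(real^'n) set \<Rightarrow> (real^'n \<Rightarrow> real) \<Rightarrow> real^'n \<Rightarrow> real^'n" where
  "grad_cl \<Omega> u x = (\<chi> i. pd_cl \<Omega> (axis i 1) u x)"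

definition hess :: "(real^'n \<Rightarrow> real) \<Rightarrow> real^'n \<Rightarrow> real^'n^'n" where
  "hess u x = (\<chi> i j. pd (axis j 1) (pd (axis i 1) u) x)"

definition norm_u :: "(real^'n) set \<Rightarrow> (real^'n \<Rightarrow> real) \<Rightarrow> real" where
  "norm_u \<Omega> u = C_norm 1 \<Omega> (closure \<Omega>) u"

definition norm_f ::
  "(real^'n) set \<Rightarrow> (real^'n \<Rightarrow> real) \<Rightarrow> ((real^'n) \<times> real \<times> (real^'n) \<Rightarrow> real) \<Rightarrow> real" where
  "norm_f \<Omega> u f =
     C_norm 2 (\<Omega> \<times> UNIV \<times> UNIV)
       {(x, z, p). x \<in> closure \<Omega> \<and> \<bar>z\<bar> \<le> norm_u \<Omega> u \<and> norm p \<le> norm_u \<Omega> u} f"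

definition esym :: "int \<Rightarrow> real^'n \<Rightarrow> real" where
  "esym j v = (if j < 0 then 0 else \<Sum>S | card S = nat j. \<Prod>i\<in>S. v $ i)"

(* The entries of v are the eigenvalues of A, counted with algebraic multiplicity. *)
definition is_eigenvalues :: "real^'n^'n \<Rightarrow> real^'n \<Rightarrow> bool" where
  "is_eigenvalues A v \<longleftrightarrow> (\<forall>t. det (mat t - A) = (\<Prod>i\<in>UNIV. t - v $ i))"

(* Determined up to a permutation of the entries, to which esym is insensitive; exists
   whenever A has only real eigenvalues, in particular for symmetric A. *)
definition eigenvalues :: "real^'n^'n \<Rightarrow> real^'n" where
  "eigenvalues A = (SOME v. is_eigenvalues A v)"

definition eta_of :: "real^'n \<Rightarrow> real^'n" where
  "eta_of v = (\<chi> i. \<Sum>j\<in>UNIV - {i}. v $ j)"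

definition eta :: "(real^'n \<Rightarrow> real) \<Rightarrow> real^'n \<Rightarrow> real^'n" where
  "eta u x = eta_of (eigenvalues (hess u x))"

lemma det_scaleR_matrix:
  fixes A :: "real^'n^'n"
  shows "det (s *\<^sub>R A) = s ^ CARD('n) * det A"
  by (simp add: det_def prod.distrib sum_distrib_left mult_ac)

lemma trace_eq_sum_eigenvalues:
  fixes A :: "real^'n^'n"
  assumes "is_eigenvalues A v"
  shows "trace A = (\<Sum>i\<in>UNIV. v $ i)"
proof -
  let ?D = "\<lambda>s::real. det (mat 1 - s *\<^sub>R A)"
  have eq: "?D s = (\<Prod>i\<in>UNIV. 1 - s * v $ i)" for s
  proof (cases "s = 0")
    case False
    then have "mat 1 - s *\<^sub>R A = s *\<^sub>R (mat (1/s) - A)"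
      by (simp add: vec_eq_iff mat_def field_simps)
    then have "?D s = s ^ CARD('n) * (\<Prod>i\<in>UNIV. 1/s - v $ i)"
      using assms by (simp add: det_scaleR_matrix is_eigenvalues_def)
    also have "\<dots> = (\<Prod>i\<in>UNIV. s * (1/s - v $ i))"
      by (simp add: prod.distrib)
    also have "\<dots> = (\<Prod>i\<in>UNIV. 1 - s * v $ i)"
      using False by (simp add: right_diff_distrib)
    finally show ?thesis .
  qed (simp add: det_I)
  let ?P = "{p :: 'n \<Rightarrow> 'n. p permutes UNIV}"
  let ?d = "\<lambda>p. \<Sum>i\<in>UNIV. - A $ i $ p i * (\<Prod>j\<in>UNIV - {i}. mat 1 $ j $ p j)"
  have "((\<lambda>s. \<Prod>i\<in>UNIV. (mat 1 - s *\<^sub>R A) $ i $ p i) has_field_derivative ?d p) (at 0)" for p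
  proof -
    have "((\<lambda>s. (mat 1 - s *\<^sub>R A) $ i $ p i) has_field_derivative - A $ i $ p i) (at 0)" for i
      by (auto intro!: derivative_eq_intros)
    from has_field_derivative_prod[where A = UNIV, OF this] show ?thesis by simp
  qed
  then have "(?D has_field_derivative (\<Sum>p\<in>?P. of_int (sign p) * ?d p)) (at 0)"
    unfolding det_def by (intro DERIV_sum DERIV_cmult)
  also have "(\<Sum>p\<in>?P. of_int (sign p) * ?d p) = (\<Sum>p\<in>?P. if p = id then - trace A else 0)"
  proof (intro sum.cong refl)
    fix p assume "p \<in> ?P"
    then have inj: "inj p" by (simp add: permutes_inj)
    show "of_int (sign p) * ?d p = (if p = id then - trace A else 0)"
    proof (cases "p = id")
      case True
      then show ?thesis by (simp add: mat_def trace_def sum_negf)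
    next
      case False
      then obtain a where a: "p a \<noteq> a" by (auto simp: fun_eq_iff)
      have "(\<Prod>j\<in>UNIV - {i}. (mat 1 :: real^'n^'n) $ j $ p j) = 0" for i
      proof -
        have "p (p a) \<noteq> p a" using inj a by (auto dest: injD)
        then obtain j where "j \<noteq> i" "p j \<noteq> j" using a by metis
        then show ?thesis by (intro prod_zero bexI[of _ j]) (auto simp: mat_def)
      qed
      with False show ?thesis by (simp del: prod_zero_iff)
    qed
  qed
  also have "\<dots> = - trace A"
    by (simp add: finite_permutations permutes_id)
  finally have L: "(?D has_field_derivative - trace A) (at 0)" .
  have R: "((\<lambda>s. \<Prod>i\<in>UNIV. 1 - s * v $ i) has_field_derivative - (\<Sum>i\<in>UNIV. v $ i)) (at 0)"
  proof -
    have "((\<lambda>s. 1 - s * v $ i) has_field_derivative - v $ i) (at 0)" for i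
      by (auto intro!: derivative_eq_intros)
    from has_field_derivative_prod[where A = UNIV, OF this] show ?thesis by (simp add: sum_negf)
  qed
  from DERIV_unique[OF L[unfolded eq] R] show ?thesis by simp
qed

(* Hence eta u x consists of the eigenvalues of (Laplacian u) I - D^2 u at x. *)
lemma is_eigenvalues_eta_of:
  fixes A :: "real^'n^'n"
  assumes "is_eigenvalues A v"
  shows "is_eigenvalues (mat (trace A) - A) (eta_of v)"
  unfolding is_eigenvalues_def
proof
  fix t
  have "mat t - (mat (trace A) - A) = (-1) *\<^sub>R (mat (trace A - t) - A)"
    by (simp add: vec_eq_iff mat_def)
  then have "det (mat t - (mat (trace A) - A)) =
      (-1) ^ CARD('n) * (\<Prod>i\<in>UNIV. trace A - t - v $ i)"
    using assms by (simp only: det_scaleR_matrix is_eigenvalues_def)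
  also have "\<dots> = (\<Prod>i\<in>UNIV. (-1) * (trace A - t - v $ i))"
    by (simp only: prod.distrib prod_constant)
  also have "\<dots> = (\<Prod>i\<in>UNIV. t - eta_of v $ i)"
    by (intro prod.cong refl)
       (simp add: eta_of_def trace_eq_sum_eigenvalues[OF assms] sum_diff1)
  finally show "det (mat t - (mat (trace A) - A)) = (\<Prod>i\<in>UNIV. t - eta_of v $ i)" .
qed

definition admissible :: "int \<Rightarrow> (real^'n) set \<Rightarrow> (real^'n \<Rightarrow> real) \<Rightarrow> bool" where
  "admissible j \<Omega> u \<longleftrightarrow> C_open 2 \<Omega> u \<and> (\<forall>x\<in>\<Omega>. \<forall>i\<in>{1..j}. esym i (eta u x) > 0)"

end

(* Appending alpha to eta gives a vector of R^(n+1) with sigma_k(eta) + alpha sigma_(k-1)(eta)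
   = sigma_k(eta, alpha), so a (k-1)-admissible solution has (eta, alpha) in the Garding cone of
   order k, uniformly in alpha.  There ln (sigma_k / sigma_l) is the sum of the ln q_j,
   q_j = sigma_j / sigma_(j-1), l < j <= k.  Each q_j is concave, homogeneous of degree one and has
   bounded gradient; since q_j lies below its tangent functional, evaluating that functional at the
   indicator of {j. j ~= i} bounds the derivative in lambda_i from below.  As k < n, the linearised
   operator is therefore uniformly elliptic up to a scalar factor.

   Concavity passes to matrices by the spectral theorem and a rearrangement argument, in the form:
   at every point x0 of the domain, x |-> SUM i. a_i u_ii(x) - tau ln f(x, u, Du), taken in an
   eigenbasis of the Hessian at x0, is minimal at x0.  Its first and second order conditions replace
   the differentiated equation.  They are combined with those for a maximum of
   -u u_xixi + A/2 |Du|^2 over {u <= 0}: for A large the term A SUM a_i lambda_i^2 absorbs the others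
   and (-u)|D^2 u| is bounded at that point.  This bounds -u u_xixi from above for all directions xi;
   a lower bound for the Laplacian then bounds the whole Hessian. *)

theory Submission
  imports Defs "HOL-Computational_Algebra.Fundamental_Theorem_Algebra"
begin

section \<open>Elementary symmetric functions and their cones\<close>

text \<open>Nothing is differentiated through the eigenvalues, which need not depend smoothly on a
  matrix where they coincide. Concavity is used only as an upper bound by a linear functional on the
  whole cone, so any supporting slopes serve as coefficients, and all calculus takes place along
  lines for \<open>u\<close> and \<open>f\<close>. The slopes come from an induction that deletes
  variables: (j+1) q_(j+1) is the sum of the terms x_i - x_i^2 / (x_i + q_j), with q_j taken without
  x_i, and y^2 / z is jointly convex and decreasing in z. Hence symmetric functions over arbitrary
  finite index sets, and hence Newton's inequalities: they keep a vector with one entry deleted in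
  the cone of one order less. The slopes of ln q_j are of size 1 / q_j, which has no uniform upper
  bound. Dividing by the sum of all 1 / q_j leaves coefficients a_i between two constants; the price
  is the factor \<tau>, harmless because it is bounded above and nothing is ever divided by it. The
  test function is linear in u_\<xi>\<xi> rather than logarithmic, so the sign of u_\<xi>\<xi> does
  not matter, and its critical point equation turns (-u) D u_\<xi>\<xi> into terms of the size of
  |D^2 u|.\<close>

definition real_rooted :: "real poly \<Rightarrow> bool" where
  "real_rooted p \<longleftrightarrow> (\<exists>c A. p = smult c (\<Prod>a\<in>#A. [:-a, 1:]))"

lemma real_rooted_mult: "real_rooted p \<Longrightarrow> real_rooted q \<Longrightarrow> real_rooted (p * q)"
  unfolding real_rooted_def
  by (elim exE, rule exI, rule exI) (auto simp flip: prod_mset.union image_mset_union simp: mult_ac)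

lemma real_rooted_linear: "real_rooted [:a, b:]"
proof (cases "b = 0")
  case True
  then show ?thesis
    unfolding real_rooted_def by (intro exI[of _ a] exI[of _ "{#}"]) (simp add: one_pCons)
next
  case False
  then show ?thesis
    unfolding real_rooted_def by (intro exI[of _ b] exI[of _ "{#-a/b#}"]) simp
qed

lemma real_rooted_prod: "finite S \<Longrightarrow> (\<And>i. i \<in> S \<Longrightarrow> real_rooted (f i)) \<Longrightarrow> real_rooted (prod f S)"
proof (induction S rule: finite_induct)
  case empty
  show ?case using real_rooted_linear[of 1 0] by (simp add: one_pCons)
qed (auto intro: real_rooted_mult)

lemma map_poly_of_real_mult:
  "map_poly complex_of_real (p * q) = map_poly of_real p * map_poly of_real q"
  by (rule poly_eqI) (simp add: coeff_map_poly coeff_mult)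

lemma map_poly_of_real_pderiv:
  "map_poly complex_of_real (pderiv p) = pderiv (map_poly of_real p)"
  by (rule poly_eqI) (simp add: coeff_map_poly coeff_pderiv)

lemma map_poly_of_real_smult:
  "map_poly complex_of_real (smult c p) = smult (of_real c) (map_poly of_real p)"
  by (rule poly_eqI) (simp add: coeff_map_poly)

lemma map_poly_of_real_linear_factors:
  "map_poly complex_of_real (\<Prod>a\<in>#A. [:-a, 1:]) = (\<Prod>a\<in>#A. [:-of_real a, 1:])"
proof (induction A)
  case (add a A)
  have "map_poly complex_of_real [:-a, 1:] = [:-of_real a, 1:]"
    by (simp add: map_poly_pCons)
  with add show ?case by (simp only: image_mset_add_mset prod_mset.add_mset map_poly_of_real_mult)
qed simp

lemma poly_pderiv_linear_mult:
  fixes q :: "'a::idom poly"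
  shows "poly (pderiv ([:-a, 1:] * q)) z = poly q z + (z - a) * poly (pderiv q) z"
    and "poly (pderiv (pderiv ([:-a, 1:] * q))) z
      = 2 * poly (pderiv q) z + (z - a) * poly (pderiv (pderiv q)) z"
proof -
  have d: "pderiv ([:-a, 1:] * q) = q + [:-a, 1:] * pderiv q" for q
    unfolding pderiv_mult by (simp add: pderiv_pCons del: mult_pCons_left mult_pCons_right)
  show "poly (pderiv ([:-a, 1:] * q)) z = poly q z + (z - a) * poly (pderiv q) z"
    unfolding d by (simp add: algebra_simps)
  show "poly (pderiv (pderiv ([:-a, 1:] * q))) z
      = 2 * poly (pderiv q) z + (z - a) * poly (pderiv (pderiv q)) z"
    unfolding d pderiv_add by (simp add: algebra_simps)
qed

text \<open>The Gauss-Lucas argument: at a non-real z the logarithmic derivative is a sum of terms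
  1/(z - a), each with imaginary part of sign opposite to that of Im z, so the sum cannot
  vanish.\<close>

lemma nonreal_root_pderiv:
  fixes A :: "real multiset"
  assumes "Im z \<noteq> 0" "A \<noteq> {#}"
  shows "poly (pderiv (\<Prod>a\<in>#A. [:-complex_of_real a, 1:])) z \<noteq> 0"
proof -
  let ?Q = "\<lambda>A. \<Prod>a\<in>#A. [:-complex_of_real a, 1:]"
  have ne: "z - of_real a \<noteq> 0" for a :: real
    using assms(1) by (metis Im_complex_of_real eq_iff_diff_eq_0)
  have nz: "poly (?Q A) z \<noteq> 0" for A
    by (induction A) (use ne in \<open>simp_all add: algebra_simps\<close>)
  have eq: "poly (pderiv (?Q A)) z = poly (?Q A) z * (\<Sum>a\<in>#A. 1 / (z - of_real a))" for A
  proof (induction A)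
    case (add a A)
    have "poly (?Q (add_mset a A)) z = (z - of_real a) * poly (?Q A) z" by (simp add: algebra_simps)
    moreover have "poly (pderiv (?Q (add_mset a A))) z
        = poly (?Q A) z + (z - of_real a) * poly (pderiv (?Q A)) z"
      using poly_pderiv_linear_mult(1) by (simp only: image_mset_add_mset prod_mset.add_mset)
    ultimately have "poly (pderiv (?Q (add_mset a A))) z = poly (?Q (add_mset a A)) z * 
        (1 / (z - of_real a) + (\<Sum>a\<in>#A. 1 / (z - of_real a)))"
      using ne[of a] add by (simp only:) (simp add: field_simps)
    then show ?case by (simp only: image_mset_add_mset sum_mset.add_mset)
  qed simp
  have im: "Im (1 / (z - of_real a)) * Im z < 0" for a :: real
  proof -
    have "(Re z - a)\<^sup>2 + (Im z)\<^sup>2 > 0" using assms(1) by (simp add: sum_power2_gt_zero_iff)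
    moreover have "Im (1 / (z - of_real a)) * Im z = - ((Im z)\<^sup>2 / ((Re z - a)\<^sup>2 + (Im z)\<^sup>2))"
      by (simp add: Im_divide power2_eq_square)
    ultimately show ?thesis using assms(1) by simp
  qed
  have "Im (\<Sum>a\<in>#A. 1 / (z - of_real a)) * Im z < 0" using assms(2)
  proof (induction A)
    case (add a A)
    show ?case
      using im[of a] add by (cases "A = {#}") (simp_all add: algebra_simps)
  qed simp
  then have "(\<Sum>a\<in>#A. 1 / (z - of_real a)) \<noteq> 0" by auto
  then show ?thesis using nz eq by simp
qed

text \<open>Over the complex numbers the derivative splits by the fundamental theorem of algebra,
  and its roots are real by the preceding lemma; multiple roots need no separate count. The scalar
  in \<open>real_rooted\<close> may be 0, which covers the derivative of a constant.\<close>

lemma real_rooted_pderiv: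
  assumes "real_rooted p"
  shows "real_rooted (pderiv p)"
proof -
  obtain c A where p: "p = smult c (\<Prod>a\<in>#A. [:-a, 1:])"
    using assms by (auto simp: real_rooted_def)
  let ?Q = "\<Prod>a\<in>#A. [:-complex_of_real a, 1:]"
  show ?thesis
  proof (cases "A = {#}")
    case True
    then show ?thesis using p real_rooted_linear[of 0 0] by (simp add: pderiv_smult)
  next
    case False
    define B where "B = image_mset Re (proots (pderiv ?Q))"
    have nz: "pderiv ?Q \<noteq> 0" using nonreal_root_pderiv[OF _ False, of \<i>] by force
    have "\<forall>z\<in>#proots (pderiv ?Q). complex_of_real (Re z) = z"
      using nonreal_root_pderiv[OF _ False] nz by (auto simp: complex_eq_iff)
    then have "image_mset complex_of_real B = proots (pderiv ?Q)"
      unfolding B_def by (simp add: multiset.map_comp o_def cong: image_mset_cong)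
    then have Q: "pderiv ?Q = smult (lead_coeff (pderiv ?Q)) (map_poly of_real (\<Prod>b\<in>#B. [:-b, 1:]))"
      using complex_poly_decompose_multiset[of "pderiv ?Q"]
      by (simp add: map_poly_of_real_linear_factors multiset.map_comp o_def flip: \<open>image_mset complex_of_real B = _\<close>)
    have "?Q = map_poly of_real (\<Prod>a\<in>#A. [:-a, 1:])" by (simp add: map_poly_of_real_linear_factors)
    then have r: "Im (lead_coeff (pderiv ?Q)) = 0"
      by (simp add: map_poly_of_real_pderiv[symmetric] coeff_map_poly)
    have "map_poly complex_of_real (pderiv p) = smult (of_real c) (pderiv ?Q)"
      unfolding p by (simp add: map_poly_of_real_pderiv map_poly_of_real_smult map_poly_of_real_linear_factors pderiv_smult)
    also have "\<dots> = map_poly of_real (smult (c * Re (lead_coeff (pderiv ?Q))) (\<Prod>b\<in>#B. [:-b, 1:]))"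
    proof -
      have "complex_of_real (Re (lead_coeff (pderiv ?Q))) = lead_coeff (pderiv ?Q)"
        using r by (simp add: complex_eq_iff)
      then show ?thesis by (subst Q) (simp add: map_poly_of_real_smult)
    qed
    finally have "pderiv p = smult (c * Re (lead_coeff (pderiv ?Q))) (\<Prod>b\<in>#B. [:-b, 1:])"
      by (simp add: poly_eq_iff coeff_map_poly flip: of_real_mult)
    then show ?thesis unfolding real_rooted_def by blast
  qed
qed

text \<open>For p = (t - a) q the expression p'^2 - p p'' equals (t - a)^2 (q'^2 - q q'') + q^2, so
  nonnegativity passes from q to p. Induction on the roots avoids the division by p that the second
  derivative of ln p would require.\<close>

lemma laguerre:
  assumes "real_rooted p"
  shows "poly p t * poly (pderiv (pderiv p)) t \<le> (poly (pderiv p) t)\<^sup>2"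
proof -
  obtain c A where p: "p = smult c (\<Prod>a\<in>#A. [:-a, 1:])"
    using assms by (auto simp: real_rooted_def)
  let ?R = "\<lambda>A. \<Prod>a\<in>#A. [:-a, 1::real:]"
  have "0 \<le> (poly (pderiv (?R A)) t)\<^sup>2 - poly (?R A) t * poly (pderiv (pderiv (?R A))) t" for A
  proof (induction A)
    case (add a A)
    have "poly (?R (add_mset a A)) t = (t - a) * poly (?R A) t" by (simp add: algebra_simps)
    moreover have "poly (pderiv (?R (add_mset a A))) t = poly (?R A) t + (t - a) * poly (pderiv (?R A)) t"
      "poly (pderiv (pderiv (?R (add_mset a A)))) t
        = 2 * poly (pderiv (?R A)) t + (t - a) * poly (pderiv (pderiv (?R A))) t"
      using poly_pderiv_linear_mult by (simp_all only: image_mset_add_mset prod_mset.add_mset)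
    ultimately have "(poly (pderiv (?R (add_mset a A))) t)\<^sup>2
        - poly (?R (add_mset a A)) t * poly (pderiv (pderiv (?R (add_mset a A)))) t
      = (t - a)\<^sup>2 * ((poly (pderiv (?R A)) t)\<^sup>2 - poly (?R A) t * poly (pderiv (pderiv (?R A))) t)
        + (poly (?R A) t)\<^sup>2"
 by (simp only:) (simp add: power2_eq_square algebra_simps)
    also have "\<dots> \<ge> 0" using add by simp
    finally show ?case .
  qed simp
  from mult_left_mono[OF this[of A], of "c\<^sup>2"] show ?thesis
    unfolding p by (simp add: pderiv_smult algebra_simps power2_eq_square)
qed

text \<open>Laguerre's inequality for the m-th derivative at 0, whose value and first two
  derivatives there are factorial multiples of the three coefficients. The factorials give an extra
  factor (m+2)/(m+1) on the left, which is discarded when the left side is positive.\<close>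

lemma newton_real_rooted:
  assumes "real_rooted p"
  shows "coeff p m * coeff p (m + 2) \<le> (coeff p (m + 1))\<^sup>2"
proof (cases "coeff p m * coeff p (m + 2) \<le> 0")
  case True
  then show ?thesis by (meson order_trans zero_le_power2)
next
  case False
  have rr: "real_rooted ((pderiv ^^ m) p)"
    by (induction m) (auto simp: assms real_rooted_pderiv)
  have c: "poly q 0 = coeff q 0" for q :: "real poly" by (simp add: poly_0_coeff_0)
  have "coeff ((pderiv ^^ m) p) 0 = fact m * coeff p m"
    by (simp add: coeff_higher_pderiv pochhammer_fact)
  moreover have "coeff (pderiv ((pderiv ^^ m) p)) 0 = fact (m + 1) * coeff p (m + 1)"
    using coeff_higher_pderiv[of "Suc m" p 0] by (simp add: pochhammer_fact[symmetric])
  moreover have "coeff (pderiv (pderiv ((pderiv ^^ m) p))) 0 = fact (m + 2) * coeff p (m + 2)"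
    using coeff_higher_pderiv[of "Suc (Suc m)" p 0] by (simp add: pochhammer_fact[symmetric])
  ultimately have "(fact m * coeff p m) * (fact (m + 2) * coeff p (m + 2)) \<le> (fact (m + 1) * coeff p (m + 1))\<^sup>2"
    using laguerre[OF rr, of 0] unfolding c by (simp only:)
  then have "(fact m)\<^sup>2 * (real (m + 1) * (real (m + 2) * (coeff p m * coeff p (m + 2))))
      \<le> (fact m)\<^sup>2 * (real (m + 1) * (real (m + 1) * (coeff p (m + 1))\<^sup>2))"
    by (simp add: power2_eq_square algebra_simps)
  then have "real (m + 2) * (coeff p m * coeff p (m + 2)) \<le> real (m + 1) * (coeff p (m + 1))\<^sup>2"
    by (rule mult_left_le_imp_le[THEN mult_left_le_imp_le]) simp_all
  moreover have "real (m + 1) * (coeff p m * coeff p (m + 2)) \<le> real (m + 2) * (coeff p m * coeff p (m + 2))"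
    using False by (intro mult_right_mono) auto
  ultimately have "real (m + 1) * (coeff p m * coeff p (m + 2)) \<le> real (m + 1) * (coeff p (m + 1))\<^sup>2"
    by linarith
  then show ?thesis by (rule mult_left_le_imp_le) simp
qed

section \<open>Elementary symmetric functions through their generating polynomial\<close>

text \<open>In terms of the product of the factors 1 + x_i t, deleting an index is removing a linear
  factor, and Newton's inequality is real-rootedness. The sum over subsets appears later, to meet
  \<open>esym\<close>.\<close>

definition es :: "nat \<Rightarrow> 'a set \<Rightarrow> ('a \<Rightarrow> real) \<Rightarrow> real" where
  "es j S x = coeff (\<Prod>i\<in>S. [:1, x i:]) j"

lemma es_0 [simp]: "finite S \<Longrightarrow> es 0 S x = 1"
  by (simp add: es_def poly_0_coeff_0[symmetric] poly_prod)

lemma es_split: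
  assumes "finite S" "i \<in> S"
  shows "es (Suc j) S x = es (Suc j) (S - {i}) x + x i * es j (S - {i}) x"
  unfolding es_def by (subst prod.remove[OF assms]) (simp add: add.commute)

text \<open>Euler's identity, read off from the coefficient of t^j in the t-derivative of the
  generating polynomial.\<close>

lemma sum_mult_es:
  assumes "finite S"
  shows "(\<Sum>i\<in>S. x i * es j (S - {i}) x) = real (Suc j) * es (Suc j) S x"
proof -
  have "pderiv (\<Prod>i\<in>S. [:1, x i:]) = (\<Sum>i\<in>S. smult (x i) (\<Prod>i\<in>S - {i}. [:1, x i:]))"
    by (simp add: pderiv_prod pderiv_pCons)
  from arg_cong[OF this, of "\<lambda>p. coeff p j"] show ?thesis
    by (simp add: coeff_pderiv es_def coeff_sum)
qed

text \<open>Sum \<open>es_split\<close> over i and insert Euler's identity. It later shows that the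
  quotients of the m-th functions of S - {i} and of S add up to card S - m, which bounds the
  supporting slopes.\<close>

lemma sum_es_remove:
  assumes "finite S"
  shows "(\<Sum>i\<in>S. es j (S - {i}) x) = (real (card S) - real j) * es j S x"
proof (cases j)
  case 0
  then show ?thesis using assms by simp
next
  case (Suc j')
  have "(\<Sum>i\<in>S. es j (S - {i}) x) = (\<Sum>i\<in>S. es j S x - x i * es j' (S - {i}) x)"
    using assms by (intro sum.cong refl) (simp add: Suc es_split)
  then show ?thesis
    using sum_mult_es[OF assms, where x = x and j = j'] by (simp add: sum_subtractf Suc algebra_simps)
qed

lemma es_newton:
  assumes "finite S"
  shows "es m S x * es (m + 2) S x \<le> (es (m + 1) S x)\<^sup>2"
  unfolding es_def by (intro newton_real_rooted real_rooted_prod real_rooted_linear assms)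

lemma es_indicator:
  assumes "finite S" "T \<subseteq> S"
  shows "es j S (\<lambda>i. if i \<in> T then 1 else 0) = real (card T choose j)"
proof -
  have "(\<Prod>i\<in>S. [:1, if i \<in> T then 1 else (0::real):]) = (\<Prod>i\<in>T. [:1, 1:])"
    using assms by (intro prod.mono_neutral_cong_right) (auto simp: one_pCons)
  also have "\<dots> = [:1, 1:] ^ card T" by simp
  finally show ?thesis
  proof (cases "j \<le> card T")
    case False
    then have "degree ([:1, 1::real:] ^ card T) < j"
      by (simp add: degree_power_eq)
    then show ?thesis using False
      using \<open>(\<Prod>i\<in>S. [:1, if i \<in> T then 1 else (0::real):]) = _\<close> by (simp add: es_def coeff_eq_0)
  qed (simp add: es_def coeff_linear_poly_power)
qed

definition garding :: "nat \<Rightarrow> 'a set \<Rightarrow> ('a \<Rightarrow> real) set" where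
  "garding m S = {x. \<forall>j\<le>m. es j S x > 0}"

lemma garding_es_pos: "x \<in> garding m S \<Longrightarrow> j \<le> m \<Longrightarrow> es j S x > 0"
  by (simp add: garding_def)

lemma garding_mono: "x \<in> garding m S \<Longrightarrow> m' \<le> m \<Longrightarrow> x \<in> garding m' S"
  by (simp add: garding_def)

text \<open>Write s_j for the functions without x_i. If s_j > 0 >= s_(j+1), positivity of s_(j+1) +
  x_i s_j and of s_(j+2) + x_i s_(j+1) gives s_j s_(j+2) > - x_i s_j s_(j+1) >= s_(j+1)^2, against
  Newton's inequality. Each step looks one order ahead, hence the loss of one order.\<close>

lemma garding_remove:
  assumes "finite S" "i \<in> S" "x \<in> garding (Suc m) S"
  shows "x \<in> garding m (S - {i})"
proof -
  let ?s = "\<lambda>j. es j (S - {i}) x"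
  have pos: "?s (Suc j) + x i * ?s j > 0" if "j \<le> m" for j
    using assms that by (auto simp: garding_def simp flip: es_split)
  have "?s j > 0" if "j \<le> m" for j
    using that
  proof (induction j)
    case 0
    then show ?case using assms by simp
  next
    case (Suc j)
    show ?case
    proof (rule ccontr)
      assume "\<not> ?s (Suc j) > 0"
      then have neg: "?s (Suc j) \<le> 0" by simp
      have sj: "?s j > 0" using Suc by simp
      have "?s (Suc (Suc j)) > - x i * ?s (Suc j)" using pos[of "Suc j"] Suc.prems by simp
      then have "?s j * ?s (Suc (Suc j)) > ?s j * (- x i * ?s (Suc j))"
        using sj by (rule mult_strict_left_mono)
      moreover have "(x i * ?s j) * (- ?s (Suc j)) \<ge> (- ?s (Suc j)) * (- ?s (Suc j))"
        using neg pos[of j] Suc.prems by (intro mult_right_mono) auto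
      ultimately show False
        using es_newton[of "S - {i}" j x] assms(1) by (simp add: power2_eq_square algebra_simps)
    qed
  qed
  then show ?thesis by (simp add: garding_def)
qed

section \<open>Concavity of the ratios of consecutive symmetric functions\<close>

definition es_ratio :: "nat \<Rightarrow> 'a set \<Rightarrow> ('a \<Rightarrow> real) \<Rightarrow> real" where
  "es_ratio m S x = es m S x / es (m - 1) S x"

text \<open>Splitting off x_i shows that x_i plus the ratio over S - {i} is a quotient of two
  positive symmetric functions; inserting this in Euler's identity for order m + 1 gives the
  recursion. It expresses the ratio through ratios of lower order in one variable less, in a form
  that inherits concavity.\<close>

lemma es_ratio_Suc:
  assumes "finite S" "x \<in> garding (Suc m) S" "m \<ge> 1"
  shows "real (Suc m) * es_ratio (Suc m) S x
    = (\<Sum>i\<in>S. x i - (x i)\<^sup>2 / (x i + es_ratio m (S - {i}) x))"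
    and "\<And>i. i \<in> S \<Longrightarrow> x i + es_ratio m (S - {i}) x = es m S x / es (m - 1) (S - {i}) x"
    and "\<And>i. i \<in> S \<Longrightarrow> x i + es_ratio m (S - {i}) x > 0"
proof -
  obtain m' where m: "m = Suc m'" using assms(3) by (cases m) auto
  have p: "es m' (S - {i}) x > 0" if "i \<in> S" for i
    using garding_es_pos[OF garding_remove[OF assms(1) that assms(2)]] m by simp
  show q: "x i + es_ratio m (S - {i}) x = es m S x / es (m - 1) (S - {i}) x" if "i \<in> S" for i
    using p[OF that] that assms(1) by (simp add: m es_ratio_def es_split field_simps)
  have pm: "es m S x > 0" using assms(2) by (simp add: garding_es_pos)
  show "x i + es_ratio m (S - {i}) x > 0" if "i \<in> S" for i
    using q[OF that] pm p[OF that] m by simp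
  have "real (Suc m) * es_ratio (Suc m) S x = (\<Sum>i\<in>S. x i * es m (S - {i}) x / es m S x)"
    using sum_mult_es[OF assms(1), of x m] by (simp add: es_ratio_def flip: sum_divide_distrib)
  also have "\<dots> = (\<Sum>i\<in>S. x i - (x i)\<^sup>2 / (x i + es_ratio m (S - {i}) x))"
  proof (intro sum.cong refl)
    fix i assume i: "i \<in> S"
    have "es m S x = es m (S - {i}) x + x i * es m' (S - {i}) x"
      using i assms(1) m by (simp add: es_split)
    then show "x i * es m (S - {i}) x / es m S x = x i - (x i)\<^sup>2 / (x i + es_ratio m (S - {i}) x)"
      unfolding q[OF i] using p[OF i] pm m by (simp add: field_simps power2_eq_square)
  qed
  finally show "real (Suc m) * es_ratio (Suc m) S x = (\<Sum>i\<in>S. x i - (x i)\<^sup>2 / (x i + es_ratio m (S - {i}) x))" .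
qed

text \<open>The tangent plane of the jointly convex function y^2 / z along the ray y = r z.\<close>

lemma quad_over_linear_ge:
  fixes z :: real
  assumes "z > 0"
  shows "y\<^sup>2 / z \<ge> 2 * r * y - r\<^sup>2 * z"
proof -
  have "0 \<le> (y - r * z)\<^sup>2" by simp
  then show ?thesis using assms by (simp add: field_simps power2_eq_square)
qed

text \<open>A supergradient at \<open>x\<close> that is valid on the whole cone. The ratio is
  homogeneous of degree one, so the functional has no constant term. Signs of the slopes are
  recorded because partial sums of them are estimated later.\<close>

definition supports :: "nat \<Rightarrow> 'a set \<Rightarrow> ('a \<Rightarrow> real) \<Rightarrow> ('a \<Rightarrow> real) \<Rightarrow> bool" where
  "supports m S x p \<longleftrightarrow> (\<forall>i\<in>S. 0 \<le> p i) \<and> (\<forall>y\<in>garding m S. es_ratio m S y \<le> (\<Sum>i\<in>S. p i * y i))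
     \<and> es_ratio m S x = (\<Sum>i\<in>S. p i * x i)"

text \<open>In the recursion each quotient is bounded below by its tangent plane at the value taken
  at \<open>x\<close>, and each ratio in one variable less is bounded above by the functional
  supplied for it. All these bounds are equalities at \<open>x\<close>, so the collected functional
  supports the ratio of order m + 1.\<close>

lemma ex_supports_step:
  fixes S :: "'a set"
  assumes S: "finite S" "card S = N" and m: "m \<ge> 1" and x: "x \<in> garding (Suc m) S" and B: "B \<ge> 0"
    and IH: "\<And>i. i \<in> S \<Longrightarrow> \<exists>p. supports m (S - {i}) x p \<and> (\<Sum>j\<in>S - {i}. p j) \<le> B"
  shows "\<exists>p. supports (Suc m) S x p \<and> (\<Sum>i\<in>S. p i) \<le> real N * ((real N)\<^sup>2 + (real N + 1)\<^sup>2 * B)"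
proof -
  from IH obtain p0 where p0: "\<And>i. i \<in> S \<Longrightarrow> supports m (S - {i}) x (p0 i)"
    "\<And>i. i \<in> S \<Longrightarrow> (\<Sum>j\<in>S - {i}. p0 i j) \<le> B" by metis
  \<comment> \<open>Extension by zero at the deleted index, so that all sums run over
    \<open>S\<close>.\<close>
  define p where "p i j = (if j = i then 0 else p0 i j)" for i j
  have sp: "(\<Sum>j\<in>S. p i j * y j) = (\<Sum>j\<in>S - {i}. p0 i j * y j)" for i y
    using S by (intro sum.mono_neutral_cong_right) (auto simp: p_def)
  have p_nonneg: "p i j \<ge> 0" if "i \<in> S" "j \<in> S" for i j
    using p0(1)[OF that(1)] that by (auto simp: supports_def p_def)
  have p_le: "es_ratio m (S - {i}) y \<le> (\<Sum>j\<in>S. p i j * y j)" if "i \<in> S" "y \<in> garding (Suc m) S" for i y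
    using p0(1)[OF that(1)] garding_remove[OF S(1) that] by (auto simp: supports_def sp)
  have p_eq: "es_ratio m (S - {i}) x = (\<Sum>j\<in>S. p i j * x j)" if "i \<in> S" for i
    using p0(1)[OF that(1)] by (auto simp: supports_def sp)
  have p_sum: "(\<Sum>j\<in>S. p i j) \<le> B" if "i \<in> S" for i
    using p0(2)[OF that] sp[of i "\<lambda>_. 1"] by simp
  \<comment> \<open>The value of y / z at \<open>x\<close> for the i-th quotient y^2 / z: the ray
    along which its tangent plane is taken.\<close>
  define r where "r i = x i / (x i + es_ratio m (S - {i}) x)" for i
  \<comment> \<open>The collected coefficient of y_j: the square comes from y_j - 2 r_j y_j + r_j^2
    y_j, the sum from the supports over the smaller index sets.\<close>
  define P where "P j = ((1 - r j)\<^sup>2 + (\<Sum>i\<in>S. (r i)\<^sup>2 * p i j)) / real (Suc m)" for j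
  have P_sum: "real (Suc m) * (\<Sum>j\<in>S. P j * y j) 
      = (\<Sum>i\<in>S. (1 - r i)\<^sup>2 * y i + (r i)\<^sup>2 * (\<Sum>j\<in>S. p i j * y j))" for y
  proof -
    have "real (Suc m) * (\<Sum>j\<in>S. P j * y j) = (\<Sum>j\<in>S. ((1 - r j)\<^sup>2 + (\<Sum>i\<in>S. (r i)\<^sup>2 * p i j)) * y j)"
      unfolding sum_distrib_left by (intro sum.cong refl) (simp add: P_def)
    also have "\<dots> = (\<Sum>j\<in>S. (1 - r j)\<^sup>2 * y j) + (\<Sum>j\<in>S. \<Sum>i\<in>S. (r i)\<^sup>2 * p i j * y j)"
      by (simp add: distrib_right sum.distrib sum_distrib_right)
    also have "(\<Sum>j\<in>S. \<Sum>i\<in>S. (r i)\<^sup>2 * p i j * y j) = (\<Sum>i\<in>S. (r i)\<^sup>2 * (\<Sum>j\<in>S. p i j * y j))"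
      by (subst sum.swap) (simp add: sum_distrib_left mult_ac)
    finally show ?thesis by (simp add: sum.distrib)
  qed
  have le: "es_ratio (Suc m) S y \<le> (\<Sum>j\<in>S. P j * y j)" if y: "y \<in> garding (Suc m) S" for y
  proof -
    have "real (Suc m) * es_ratio (Suc m) S y = (\<Sum>i\<in>S. y i - (y i)\<^sup>2 / (y i + es_ratio m (S - {i}) y))"
      by (rule es_ratio_Suc(1)[OF S(1) y m])
    also have "\<dots> \<le> (\<Sum>i\<in>S. (1 - r i)\<^sup>2 * y i + (r i)\<^sup>2 * (\<Sum>j\<in>S. p i j * y j))"
    proof (rule sum_mono)
      fix i assume i: "i \<in> S"
      have "y i - (y i)\<^sup>2 / (y i + es_ratio m (S - {i}) y) \<le> y i - (2 * r i * y i - (r i)\<^sup>2 * (y i + es_ratio m (S - {i}) y))"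
        using quad_over_linear_ge[OF es_ratio_Suc(3)[OF S(1) y m i], where r = "r i" and y = "y i"] by simp
      also have "\<dots> = (1 - r i)\<^sup>2 * y i + (r i)\<^sup>2 * es_ratio m (S - {i}) y"
        by (simp add: power2_eq_square algebra_simps)
      also have "\<dots> \<le> (1 - r i)\<^sup>2 * y i + (r i)\<^sup>2 * (\<Sum>j\<in>S. p i j * y j)"
        by (intro add_left_mono mult_left_mono p_le i y) simp
      finally show "y i - (y i)\<^sup>2 / (y i + es_ratio m (S - {i}) y) \<le> (1 - r i)\<^sup>2 * y i + (r i)\<^sup>2 * (\<Sum>j\<in>S. p i j * y j)" .
    qed
    also have "\<dots> = real (Suc m) * (\<Sum>j\<in>S. P j * y j)" by (rule P_sum[symmetric])
    finally show ?thesis by simp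
  qed
  have eqx: "es_ratio (Suc m) S x = (\<Sum>j\<in>S. P j * x j)"
  proof -
    have "real (Suc m) * es_ratio (Suc m) S x = (\<Sum>i\<in>S. x i - (x i)\<^sup>2 / (x i + es_ratio m (S - {i}) x))"
      by (rule es_ratio_Suc(1)[OF S(1) x m])
    also have "\<dots> = (\<Sum>i\<in>S. (1 - r i)\<^sup>2 * x i + (r i)\<^sup>2 * (\<Sum>j\<in>S. p i j * x j))"
    proof (intro sum.cong refl)
      fix i assume i: "i \<in> S"
      define e where "e = es_ratio m (S - {i}) x"
      have "x i + e > 0" using es_ratio_Suc(3)[OF S(1) x m i] by (simp add: e_def)
      then have s: "x i = r i * (x i + e)" by (simp add: r_def e_def)
      have "(1 - r i)\<^sup>2 * x i + (r i)\<^sup>2 * e = x i - 2 * r i * x i + r i * (r i * (x i + e))"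
        by (simp add: power2_eq_square algebra_simps)
      also have "\<dots> = x i - r i * x i" unfolding s[symmetric] by simp
      also have "\<dots> = x i - (x i)\<^sup>2 / (x i + e)" by (simp add: r_def e_def power2_eq_square)
      finally show "x i - (x i)\<^sup>2 / (x i + es_ratio m (S - {i}) x) = (1 - r i)\<^sup>2 * x i + (r i)\<^sup>2 * (\<Sum>j\<in>S. p i j * x j)"
        by (simp add: e_def p_eq[OF i])
    qed
    also have "\<dots> = real (Suc m) * (\<Sum>j\<in>S. P j * x j)" by (rule P_sum[symmetric])
    finally show ?thesis by simp
  qed
  have nonneg: "P j \<ge> 0" if "j \<in> S" for j
    using that p_nonneg by (auto simp: P_def intro!: divide_nonneg_nonneg add_nonneg_nonneg sum_nonneg)
  \<comment> \<open>The slopes are bounded although \<open>x\<close> is not: the numbers 1 - r_i are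
    positive and add up to N - m, so each lies between 0 and N.\<close>
  have w: "1 - r i = es m (S - {i}) x / es m S x" "0 < 1 - r i" if i: "i \<in> S" for i
  proof -
    obtain m' where m': "m = Suc m'" using m by (cases m) auto
    have pm: "es m S x > 0" using x by (simp add: garding_es_pos)
    have pr: "es m' (S - {i}) x > 0" "es m (S - {i}) x > 0"
      using garding_es_pos[OF garding_remove[OF S(1) i x]] m' by auto
    have "es m S x = es m (S - {i}) x + x i * es m' (S - {i}) x"
      using i S m' by (simp add: es_split)
    then show "1 - r i = es m (S - {i}) x / es m S x"
      unfolding r_def es_ratio_Suc(2)[OF S(1) x m i] using pr pm m' by (simp add: field_simps)
    then show "0 < 1 - r i" using pr pm by simp
  qed
  have w_sum: "(\<Sum>i\<in>S. 1 - r i) \<le> real N"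
  proof -
    have pm: "es m S x > 0" using x by (simp add: garding_es_pos)
    have "(\<Sum>i\<in>S. 1 - r i) = (\<Sum>i\<in>S. es m (S - {i}) x) / es m S x"
      by (simp add: w(1) sum_divide_distrib)
    also have "\<dots> = real N - real m" using pm by (simp add: sum_es_remove S)
    finally show ?thesis by simp
  qed
  have w_le: "1 - r i \<le> real N" if "i \<in> S" for i
    using member_le_sum[of i S "\<lambda>i. 1 - r i"] w(2) w_sum that S by fastforce
  have "(\<Sum>i\<in>S. P i) \<le> real (Suc m) * (\<Sum>i\<in>S. P i * 1)"
    using sum_nonneg[of S P] nonneg by (simp add: mult_left_le_one_le algebra_simps)
  also have "\<dots> = (\<Sum>i\<in>S. (1 - r i)\<^sup>2 * 1 + (r i)\<^sup>2 * (\<Sum>j\<in>S. p i j * 1))" by (rule P_sum)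
  also have "\<dots> \<le> (\<Sum>i\<in>S. (real N)\<^sup>2 + (real N + 1)\<^sup>2 * B)"
  proof (rule sum_mono)
    fix i assume i: "i \<in> S"
    have "\<bar>1 - r i\<bar> \<le> real N" "\<bar>r i\<bar> \<le> real N + 1" using w(2)[OF i] w_le[OF i] by auto
    then have "(1 - r i)\<^sup>2 \<le> (real N)\<^sup>2" "(r i)\<^sup>2 \<le> (real N + 1)\<^sup>2"
      by (auto simp flip: abs_le_square_iff)
    then show "(1 - r i)\<^sup>2 * 1 + (r i)\<^sup>2 * (\<Sum>j\<in>S. p i j * 1) \<le> (real N)\<^sup>2 + (real N + 1)\<^sup>2 * B"
      using p_sum[OF i] p_nonneg[OF i] B
      by (auto intro!: add_mono mult_mono sum_nonneg)
  qed
  also have "\<dots> = real N * ((real N)\<^sup>2 + (real N + 1)\<^sup>2 * B)" using S by simp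
  finally show ?thesis using le eqx nonneg by (intro exI[of _ P]) (auto simp: supports_def)
qed

text \<open>The bound depends on the order and the number of variables only, not on the point. This
  is the source of uniformity in \<alpha>, which will be just one more entry of the point. In order
  one the ratio is the sum, with all slopes 1.\<close>

lemma ex_supports:
  assumes "m \<ge> 1"
  shows "\<exists>B\<ge>0. \<forall>(S::'a set) x. finite S \<longrightarrow> card S = N \<longrightarrow> x \<in> garding m S \<longrightarrow>
    (\<exists>p. supports m S x p \<and> (\<Sum>i\<in>S. p i) \<le> B)"
  using assms
proof (induction m arbitrary: N rule: nat_induct_at_least)
  case base
  show ?case
  proof (intro exI[of _ "real N"] conjI allI impI)
    fix S :: "'a set" and x assume S: "finite S" "card S = N"
    have "es 1 S y = (\<Sum>i\<in>S. y i)" for y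
      using sum_mult_es[OF S(1), of y 0] S(1) by (simp add: One_nat_def)
    then have "supports 1 S x (\<lambda>_. 1)" using S by (simp add: supports_def es_ratio_def)
    then show "\<exists>p. supports 1 S x p \<and> sum p S \<le> real N"
      using S by (intro exI[of _ "\<lambda>_. 1"]) auto
  qed simp
next
  case (Suc m)
  from Suc.IH[of "N - 1"] obtain B where B: "B \<ge> 0" "\<And>(S::'a set) x. finite S \<Longrightarrow> card S = N - 1 \<Longrightarrow> x \<in> garding m S \<Longrightarrow>
    (\<exists>p. supports m S x p \<and> (\<Sum>i\<in>S. p i) \<le> B)" by blast
  show ?case
  proof (intro exI[of _ "real N * ((real N)\<^sup>2 + (real N + 1)\<^sup>2 * B)"] conjI allI impI)
    fix S :: "'a set" and x assume S: "finite S" "card S = N" and x: "x \<in> garding (Suc m) S"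
    show "\<exists>p. supports (Suc m) S x p \<and> sum p S \<le> real N * ((real N)\<^sup>2 + (real N + 1)\<^sup>2 * B)"
    proof (rule ex_supports_step[OF S Suc.hyps x B(1)])
      fix i assume "i \<in> S"
      then show "\<exists>p. supports m (S - {i}) x p \<and> sum p (S - {i}) \<le> B"
        using B(2)[of "S - {i}"] S garding_remove[OF S(1) _ x] by simp
    qed
  qed (use B in simp)
qed

definition es_quotient :: "nat \<Rightarrow> nat \<Rightarrow> 'a set \<Rightarrow> ('a \<Rightarrow> real) \<Rightarrow> real" where
  "es_quotient k l S x = es k S x / es l S x"

lemma es_quotient_eq_prod:
  assumes "x \<in> garding k S" "l \<le> k"
  shows "es_quotient k l S x = (\<Prod>m\<in>{l<..k}. es_ratio m S x)"
  using assms(2,1)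
proof (induction k rule: dec_induct)
  case base
  then have "es l S x > 0" by (simp add: garding_es_pos)
  then show ?case by (simp add: es_quotient_def)
next
  case (step k)
  have "es k S x > 0" using step.prems by (simp add: garding_es_pos)
  moreover have "{l<..Suc k} = insert (Suc k) {l<..k}" using step.hyps by auto
  moreover have "(\<Prod>m\<in>{l<..k}. es_ratio m S x) = es k S x / es l S x"
    using step.IH[OF garding_mono[OF step.prems]] by (simp add: es_quotient_def)
  ultimately show ?case
    by (simp add: es_ratio_def[of "Suc k"] es_quotient_def)
qed

lemma es_ratio_pos: "x \<in> garding k S \<Longrightarrow> m \<le> k \<Longrightarrow> 0 < es_ratio m S x"
  by (simp add: es_ratio_def garding_es_pos)

lemma ln_es_quotient:
  assumes "x \<in> garding k S" "l \<le> k"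
  shows "ln (es_quotient k l S x) = (\<Sum>m\<in>{l<..k}. ln (es_ratio m S x))"
  unfolding es_quotient_eq_prod[OF assms] using es_ratio_pos[OF assms(1)] by (intro ln_prod) (auto simp: less_imp_neq[symmetric])

text \<open>Since ln lies below its tangents, a support of the ratio becomes one of its logarithm,
  with slopes divided by the value at \<open>x\<close>.\<close>

lemma supports_ln:
  assumes "supports m S x p" "x \<in> garding m S" "y \<in> garding m S"
  shows "ln (es_ratio m S y) - ln (es_ratio m S x) \<le> (\<Sum>i\<in>S. p i / es_ratio m S x * (y i - x i))"
proof -
  have pos: "es_ratio m S x > 0" "es_ratio m S y > 0" using assms(2,3) by (auto intro: es_ratio_pos)
  have "ln (es_ratio m S y) - ln (es_ratio m S x) \<le> (es_ratio m S y - es_ratio m S x) / es_ratio m S x"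
    using pos ln_diff_le by blast
  also have "\<dots> \<le> ((\<Sum>i\<in>S. p i * y i) - (\<Sum>i\<in>S. p i * x i)) / es_ratio m S x"
    using assms pos by (intro divide_right_mono) (auto simp: supports_def)
  also have "\<dots> = (\<Sum>i\<in>S. p i / es_ratio m S x * (y i - x i))"
    by (simp add: sum_divide_distrib sum_subtractf[symmetric] algebra_simps diff_divide_distrib)
  finally show ?thesis .
qed

text \<open>Evaluate the supporting functional at the indicator function of \<open>T\<close>, which lies in the cone.\<close>

lemma supports_sum_lower:
  assumes "finite S" "supports m S x p" "T \<subseteq> S" "m \<le> card T" "1 \<le> m"
  shows "1 / 2 ^ card T \<le> (\<Sum>i\<in>T. p i)"
proof -
  let ?y = "\<lambda>i. if i \<in> T then 1 else 0 :: real"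
  have y: "es j S ?y = real (card T choose j)" for j by (rule es_indicator) fact+
  have "?y \<in> garding m S" using assms(4) by (auto simp: garding_def y)
  then have "es_ratio m S ?y \<le> (\<Sum>i\<in>S. p i * ?y i)" using assms(2) by (simp add: supports_def)
  also have "\<dots> = (\<Sum>i\<in>T. p i)"
    using assms(1,3) by (intro sum.mono_neutral_cong_right) auto
  finally have "real (card T choose m) / real (card T choose (m - 1)) \<le> (\<Sum>i\<in>T. p i)"
    by (simp add: es_ratio_def y)
  \<comment> \<open>The numerator is at least 1 and the denominator at most 2 to the power
    \<open>card T\<close>; the resulting constant does not depend on \<open>m\<close>.\<close>
  moreover have "1 / 2 ^ card T \<le> real (card T choose m) / real (card T choose (m - 1))"
  proof (rule frac_le)
    have "0 < card T choose m" using assms(4) by simp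
    then show "1 \<le> real (card T choose m)" by linarith
    show "real (card T choose (m - 1)) \<le> 2 ^ card T"
      using binomial_le_pow2[of "card T" "m - 1"] by (metis of_nat_le_iff of_nat_numeral of_nat_power)
    show "0 < real (card T choose (m - 1))" using assms(4) by simp
  qed simp
  ultimately show ?thesis by linarith
qed

section \<open>The appended parameter and ellipticity in the eigenvalues\<close>

text \<open>\<open>None\<close> indexes the appended entry. The argument is lambda rather than eta,
  because slopes with respect to the Hessian eigenvalues are wanted.\<close>

definition with_alpha :: "real \<Rightarrow> real^'n \<Rightarrow> 'n option \<Rightarrow> real" where
  "with_alpha \<alpha> v i = (case i of None \<Rightarrow> \<alpha> | Some i \<Rightarrow> eta_of v $ i)"

text \<open>The map from lambda to eta has a symmetric matrix, with 0 on the diagonal and 1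
  elsewhere, so slopes are pulled back by the same map.\<close>

lemma sum_eta_of:
  fixes v :: "real^'n"
  shows "(\<Sum>j\<in>UNIV. P j * eta_of v $ j) = (\<Sum>i\<in>UNIV. (\<Sum>j\<in>UNIV - {i}. P j) * v $ i)"
proof -
  have "(\<Sum>j\<in>UNIV. P j * eta_of v $ j) = (\<Sum>j\<in>UNIV. \<Sum>i\<in>UNIV. if i = j then 0 else P j * v $ i)"
    unfolding eta_of_def sum_distrib_left
    by (intro sum.cong refl) (simp add: sum_distrib_left, rule sum.mono_neutral_cong_left, auto)
  also have "\<dots> = (\<Sum>i\<in>UNIV. \<Sum>j\<in>UNIV. if i = j then 0 else P j * v $ i)" by (rule sum.swap)
  also have "\<dots> = (\<Sum>i\<in>UNIV. (\<Sum>j\<in>UNIV - {i}. P j) * v $ i)"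
    unfolding sum_distrib_right
    by (intro sum.cong refl sum.mono_neutral_cong_right) auto
  finally show ?thesis .
qed

text \<open>Adding the supports of the ln q_m gives slopes A_i comparable to the sum \<Lambda> of
  the 1 / q_m, since each A_i collects the slopes of n - 1 entries of eta, whose sum is bounded
  below. Division by \<Lambda> removes the unknown scale: the constants c and C are independent of
  \<alpha>, v and M, and M enters only through \<tau> = 1 / \<Lambda>.\<close>

lemma vector_estimate:
  assumes "l < k" "k < CARD('n::finite)"
  shows "\<exists>c>0. \<exists>C>0. \<forall>\<alpha> (v::real^'n) M. with_alpha \<alpha> v \<in> garding k UNIV \<longrightarrow>
    es_quotient k l UNIV (with_alpha \<alpha> v) \<le> M \<longrightarrow>
    (\<exists>a \<tau>. 0 < \<tau> \<and> \<tau> \<le> 1 + M \<and> (\<forall>i. c \<le> a i \<and> a i \<le> C) \<and>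
      (\<forall>w. with_alpha \<alpha> w \<in> garding k UNIV \<longrightarrow>
        \<tau> * (ln (es_quotient k l UNIV (with_alpha \<alpha> w)) - ln (es_quotient k l UNIV (with_alpha \<alpha> v)))
          \<le> (\<Sum>i\<in>UNIV. a i * (w $ i - v $ i))))"
proof -
  let ?N = "CARD('n option)"
  have "\<forall>m. \<exists>B\<ge>0. m \<in> {l<..k} \<longrightarrow> (\<forall>x\<in>garding m (UNIV :: 'n option set).
      \<exists>p. supports m UNIV x p \<and> (\<Sum>i\<in>UNIV. p i) \<le> B)"
    using ex_supports[where N = ?N and 'a = "'n option"] by (metis Suc_leI finite greaterThanAtMost_iff le_zero_eq linorder_not_less less_Suc0 nat_le_linear One_nat_def le_neq_implies_less not_less_eq_eq)
  then obtain B where B: "\<And>m. B m \<ge> 0" "\<And>m x. m \<in> {l<..k} \<Longrightarrow> x \<in> garding m (UNIV :: 'n option set) \<Longrightarrow>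
      \<exists>p. supports m UNIV x p \<and> (\<Sum>i\<in>UNIV. p i) \<le> B m" by metis
  define C where "C = 1 + (\<Sum>m\<in>{l<..k}. B m)"
  have C: "B m \<le> C" if "m \<in> {l<..k}" for m
    using member_le_sum[of m "{l<..k}" B] B(1) that by (simp add: C_def)
  have C0: "C > 0" using sum_nonneg[of "{l<..k}" B] B(1) by (simp add: C_def add_pos_nonneg)
  \<comment> \<open>The lower bound for the sum of slopes over the n - 1 indices other than a given
    one.\<close>
  define c where "c = (1 / 2 ^ (CARD('n) - 1) :: real)"
  show ?thesis
  proof (rule exI[of _ c], rule conjI, simp add: c_def, rule exI[of _ C], intro conjI allI impI C0)
    fix \<alpha> M :: real and v :: "real^'n"
    let ?y = "with_alpha \<alpha>"
    assume v: "?y v \<in> garding k UNIV" and M: "es_quotient k l UNIV (?y v) \<le> M"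
    have vm: "?y v \<in> garding m UNIV" if "m \<in> {l<..k}" for m
      using garding_mono[OF v] that by simp
    obtain p where p: "\<And>m. m \<in> {l<..k} \<Longrightarrow> supports m UNIV (?y v) (p m)"
      "\<And>m. m \<in> {l<..k} \<Longrightarrow> (\<Sum>i\<in>UNIV. p m i) \<le> B m"
    proof -
      have "\<forall>m\<in>{l<..k}. \<exists>p. supports m UNIV (?y v) p \<and> (\<Sum>i\<in>UNIV. p i) \<le> B m"
        using B(2) vm by blast
      from bchoice[OF this] that show ?thesis by blast
    qed
    define q where "q m = es_ratio m UNIV (?y v)" for m
    have q: "q m > 0" if "m \<in> {l<..k}" for m using es_ratio_pos[OF v] that by (simp add: q_def)
    define \<Lambda> where "\<Lambda> = (\<Sum>m\<in>{l<..k}. 1 / q m)"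
    have \<Lambda>: "\<Lambda> \<ge> 1 / (1 + M)" and M0: "M > 0"
    proof -
      have prod: "es_quotient k l UNIV (?y v) = (\<Prod>m\<in>{l<..k}. q m)"
        using es_quotient_eq_prod[OF v] assms(1) by (simp add: q_def)
      have "(\<Prod>m\<in>{l<..k}. q m) > 0" using q by (intro prod_pos) auto
      then show M0: "M > 0" using M prod by linarith
      \<comment> \<open>If all k - l >= 1 factors exceeded 1 + M, so would their product, which is
        at most M. One small factor already makes \<open>\<Lambda>\<close> at least 1 / (1 +
        M).\<close>
      have "\<exists>m\<in>{l<..k}. q m \<le> 1 + M"
      proof (rule ccontr)
        assume "\<not> ?thesis"
        then have "\<And>m. m \<in> {l<..k} \<Longrightarrow> 1 + M \<le> q m" by force
        then have "(\<Prod>m\<in>{l<..k}. 1 + M) \<le> (\<Prod>m\<in>{l<..k}. q m)"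
          using M0 by (intro prod_mono) auto
        moreover have "1 + M \<le> (1 + M) ^ (k - l)"
          using M0 assms(1) by (intro self_le_power) auto
        ultimately show False using M prod by simp
      qed
      then obtain m where m: "m \<in> {l<..k}" "q m \<le> 1 + M" by blast
      have "1 / (1 + M) \<le> 1 / q m" using m q by (intro divide_left_mono) (auto intro!: mult_pos_pos add_pos_pos simp: M0)
      also have "\<dots> \<le> \<Lambda>" unfolding \<Lambda>_def
        using m(1) q by (intro member_le_sum[where f = "\<lambda>m. 1 / q m"]) (auto simp: less_imp_le)
      finally show "\<Lambda> \<ge> 1 / (1 + M)" .
    qed
    have \<Lambda>0: "\<Lambda> > 0" using \<Lambda> M0 by (smt (verit) divide_pos_pos)
    define P where "P i = (\<Sum>m\<in>{l<..k}. p m (Some i) / q m)" for i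
    define A where "A i = (\<Sum>j\<in>UNIV - {i}. P j)" for i
    have A_eq: "A i = (\<Sum>m\<in>{l<..k}. (\<Sum>j\<in>UNIV - {i}. p m (Some j)) / q m)" for i
      unfolding A_def P_def by (subst sum.swap) (simp add: sum_divide_distrib)
    have low: "c * (1 / q m) \<le> (\<Sum>j\<in>UNIV - {i}. p m (Some j)) / q m"
      and up: "(\<Sum>j\<in>UNIV - {i}. p m (Some j)) / q m \<le> C * (1 / q m)" if m: "m \<in> {l<..k}" for m i
    proof -
      have s: "(\<Sum>j\<in>UNIV - {i}. p m (Some j)) = (\<Sum>j\<in>Some ` (UNIV - {i}). p m j)"
        by (subst sum.reindex) (auto simp: inj_on_def)
      have crd: "card (Some ` (UNIV - {i})) = CARD('n) - 1"
        by (subst card_image) (auto simp: inj_on_def card_Diff_singleton)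
      \<comment> \<open>The indicator of n - 1 indices lies in the cone of order m because m <= k <=
        n - 1.\<close>
      have "c \<le> (\<Sum>j\<in>Some ` (UNIV - {i}). p m j)"
        unfolding c_def crd[symmetric] using m assms(2)
        by (intro supports_sum_lower[OF _ p(1)[OF m]]) (simp_all add: crd del: card_image, linarith)
      then show "c * (1 / q m) \<le> (\<Sum>j\<in>UNIV - {i}. p m (Some j)) / q m"
        using q[OF m] by (simp add: s divide_right_mono)
      have "(\<Sum>j\<in>Some ` (UNIV - {i}). p m j) \<le> (\<Sum>j\<in>UNIV. p m j)"
        using p(1)[OF m] by (intro sum_mono2) (auto simp: supports_def)
      also have "\<dots> \<le> C" using p(2)[OF m] C[OF m] by linarith
      finally show "(\<Sum>j\<in>UNIV - {i}. p m (Some j)) / q m \<le> C * (1 / q m)"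
        using q[OF m] by (simp add: s divide_right_mono)
    qed
    have Al: "c * \<Lambda> \<le> A i" and Au: "A i \<le> C * \<Lambda>" for i
      unfolding A_eq \<Lambda>_def sum_distrib_left by (intro sum_mono low up; assumption)+
    show "\<exists>a \<tau>. 0 < \<tau> \<and> \<tau> \<le> 1 + M \<and> (\<forall>i. c \<le> a i \<and> a i \<le> C) \<and>
      (\<forall>w. ?y w \<in> garding k UNIV \<longrightarrow>
        \<tau> * (ln (es_quotient k l UNIV (?y w)) - ln (es_quotient k l UNIV (?y v))) \<le> (\<Sum>i\<in>UNIV. a i * (w $ i - v $ i)))"
    proof (rule exI[of _ "\<lambda>i. A i / \<Lambda>"], rule exI[of _ "1 / \<Lambda>"], intro conjI allI impI)
      show "0 < 1 / \<Lambda>" using \<Lambda>0 by simp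
      show "1 / \<Lambda> \<le> 1 + M" using \<Lambda> \<Lambda>0 M0 by (simp add: field_simps)
      show "c \<le> A i / \<Lambda>" "A i / \<Lambda> \<le> C" for i using Al[of i] Au[of i] \<Lambda>0 by (simp_all add: field_simps)
      fix w :: "real^'n" assume w: "?y w \<in> garding k UNIV"
      have "ln (es_quotient k l UNIV (?y w)) - ln (es_quotient k l UNIV (?y v))
          = (\<Sum>m\<in>{l<..k}. ln (es_ratio m UNIV (?y w)) - ln (es_ratio m UNIV (?y v)))"
        using assms(1) by (simp add: ln_es_quotient v w sum_subtractf)
      also have "\<dots> \<le> (\<Sum>m\<in>{l<..k}. \<Sum>i\<in>UNIV. p m i / q m * (?y w i - ?y v i))"
        unfolding q_def by (intro sum_mono supports_ln p(1) vm) (auto intro: garding_mono[OF w])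
      also have "\<dots> = (\<Sum>m\<in>{l<..k}. \<Sum>i\<in>UNIV. p m (Some i) / q m * (eta_of w $ i - eta_of v $ i))"
      proof (intro sum.cong refl)
        fix m
        \<comment> \<open>The appended entry is the same \<open>\<alpha>\<close> in both vectors, so
          its term cancels.\<close>
        show "(\<Sum>i\<in>UNIV. p m i / q m * (?y w i - ?y v i)) = (\<Sum>i\<in>UNIV. p m (Some i) / q m * (eta_of w $ i - eta_of v $ i))"
          unfolding UNIV_option_conv
          by (subst sum.insert) (auto simp: with_alpha_def sum.reindex)
      qed
      also have "\<dots> = (\<Sum>i\<in>UNIV. P i * (eta_of w $ i - eta_of v $ i))"
        unfolding P_def sum_distrib_right by (rule sum.swap)
      also have "\<dots> = (\<Sum>i\<in>UNIV. P i * eta_of w $ i) - (\<Sum>i\<in>UNIV. P i * eta_of v $ i)"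
        by (simp add: algebra_simps sum_subtractf)
      also have "\<dots> = (\<Sum>i\<in>UNIV. A i * (w $ i - v $ i))"
        unfolding sum_eta_of by (simp add: A_def algebra_simps sum_subtractf)
      finally have "(ln (es_quotient k l UNIV (?y w)) - ln (es_quotient k l UNIV (?y v))) / \<Lambda> \<le> (\<Sum>i\<in>UNIV. A i * (w $ i - v $ i)) / \<Lambda>"
        using \<Lambda>0 by (intro divide_right_mono) auto
      then show "1 / \<Lambda> * (ln (es_quotient k l UNIV (?y w)) - ln (es_quotient k l UNIV (?y v))) \<le> (\<Sum>i\<in>UNIV. A i / \<Lambda> * (w $ i - v $ i))"
        by (simp add: sum_divide_distrib)
    qed
  qed
qed

section \<open>Symmetric matrices\<close>

definition orthonormal :: "('n \<Rightarrow> real^'n) \<Rightarrow> bool" where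
  "orthonormal e \<longleftrightarrow> (\<forall>i j. e i \<bullet> e j = (if i = j then 1 else 0))"

lemma symmetric_inner_commute:
  fixes A :: "real^'n^'n"
  assumes "transpose A = A"
  shows "x \<bullet> (A *v y) = (A *v x) \<bullet> y"
  using dot_lmul_matrix[of x A y] assms by (metis transpose_matrix_vector)

text \<open>A maximum point of the quadratic form on the unit sphere of an invariant subspace is an eigenvector.\<close>

lemma ex_eigenvector_in_subspace:
  fixes A :: "real^'n^'n"
  assumes A: "transpose A = A" and V: "subspace V" "V \<noteq> {0}" and inv: "\<And>x. x \<in> V \<Longrightarrow> A *v x \<in> V"
  shows "\<exists>e\<in>V. norm e = 1 \<and> (\<exists>\<mu>. A *v e = \<mu> *\<^sub>R e)"
proof -
  let ?K = "V \<inter> sphere 0 1"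
  obtain v where v: "v \<in> V" "v \<noteq> 0" using V subspace_0 by blast
  have "v /\<^sub>R norm v \<in> ?K" using v V(1) by (auto simp: subspace_scale)
  moreover have "compact ?K" using V(1) by (simp add: closed_Int_compact closed_subspace)
  moreover have "continuous_on ?K (\<lambda>x. x \<bullet> (A *v x))"
    by (intro continuous_intros matrix_vector_mult_linear_continuous_on)
  ultimately obtain e where e: "e \<in> ?K" and max: "\<And>x. x \<in> ?K \<Longrightarrow> x \<bullet> (A *v x) \<le> e \<bullet> (A *v e)"
    using continuous_attains_sup[of ?K "\<lambda>x. x \<bullet> (A *v x)"] by blast
  define \<mu> where "\<mu> = e \<bullet> (A *v e)"
  have ee: "e \<bullet> e = 1" using e by (simp add: dot_square_norm)
  have le: "x \<bullet> (A *v x) \<le> \<mu> * (x \<bullet> x)" if x: "x \<in> V" for x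
  proof (cases "x = 0")
    case False
    have "x /\<^sub>R norm x \<in> ?K" using x False V(1) by (auto simp: subspace_scale)
    from max[OF this] have "(x \<bullet> (A *v x)) / (norm x)\<^sup>2 \<le> \<mu>"
      by (simp add: \<mu>_def matrix_vector_mult_scaleR power2_eq_square divide_inverse mult_ac)
    then show ?thesis using False by (simp add: dot_square_norm pos_divide_le_eq)
  qed simp
  \<comment> \<open>The defect of the eigenvalue equation. It lies in \<open>V\<close>, so
    \<open>e\<close> may be varied in its direction, and the first-order term of that variation is 2
    t |w|^2, which maximality of \<open>e\<close> forces to vanish.\<close>
  define w where "w = A *v e - \<mu> *\<^sub>R e"
  have w: "w \<in> V" unfolding w_def using e inv V(1) by (intro subspace_diff subspace_scale) auto
  have we: "w \<bullet> e = 0" using ee by (simp add: w_def \<mu>_def inner_diff_left inner_commute[of "A *v e"])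
  have "A *v e = w + \<mu> *\<^sub>R e" by (simp add: w_def)
  then have wA: "w \<bullet> (A *v e) = w \<bullet> w" using we by (simp add: inner_add_right)
  have quad: "2 * t * (w \<bullet> w) \<le> t\<^sup>2 * (\<mu> * (w \<bullet> w) - w \<bullet> (A *v w))" for t
  proof -
    have "(e + t *\<^sub>R w) \<bullet> (A *v (e + t *\<^sub>R w)) \<le> \<mu> * ((e + t *\<^sub>R w) \<bullet> (e + t *\<^sub>R w))"
      using e w V(1) by (intro le subspace_add subspace_scale) auto
    moreover have "e \<bullet> (A *v w) = w \<bullet> (A *v e)"
      using symmetric_inner_commute[OF A, of e w] by (simp add: inner_commute)
    moreover have "e \<bullet> w = 0" using we by (simp add: inner_commute)
    ultimately have "\<mu> + 2 * (t * (w \<bullet> w)) + t * (t * (w \<bullet> (A *v w))) \<le> \<mu> * (1 + t * (t * (w \<bullet> w)))"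
      using we wA ee
      by (simp add: inner_add_left inner_add_right matrix_vector_right_distrib matrix_vector_mult_scaleR
          \<mu>_def[symmetric] distrib_left)
    then show ?thesis by (simp add: power2_eq_square algebra_simps)
  qed
  have "w \<bullet> w = 0"
  proof (rule ccontr)
    assume "w \<bullet> w \<noteq> 0"
    then have p: "w \<bullet> w > 0" by simp
    define c where "c = \<bar>\<mu> * (w \<bullet> w) - w \<bullet> (A *v w)\<bar> + 1"
    define t where "t = (w \<bullet> w) / c"
    have c: "c > 0" by (simp add: c_def)
    have t: "t > 0" using p c by (simp add: t_def)
    have "2 * t * (w \<bullet> w) \<le> t\<^sup>2 * c"
      using quad[of t] by (rule order_trans) (auto simp: c_def intro!: mult_left_mono)
    also have "\<dots> = t * (w \<bullet> w)" using c by (simp add: t_def power2_eq_square)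
    finally show False using p t by simp
  qed
  then have "A *v e = \<mu> *\<^sub>R e" by (simp add: w_def)
  then show ?thesis using e by (intro bexI[of _ e]) auto
qed

text \<open>A largest orthonormal set of eigenvectors must span: its orthogonal complement is
  invariant under the symmetric \<open>A\<close>, so a nonzero complement would supply one more
  eigenvector.\<close>

lemma ex_eigenbasis:
  fixes A :: "real^'n^'n"
  assumes A: "transpose A = A"
  shows "\<exists>e \<mu>. orthonormal e \<and> (\<forall>i::'n. A *v e i = \<mu> i *\<^sub>R e i)"
proof -
  define P where "P B \<longleftrightarrow> pairwise orthogonal B \<and> (\<forall>b\<in>B. norm b = 1 \<and> (\<exists>\<mu>. A *v b = \<mu> *\<^sub>R b))" for B
  have ind: "independent B" if "P B" for B
    using that by (intro pairwise_orthogonal_independent) (auto simp: P_def)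
  have crd: "card B \<le> CARD('n)" if "P B" for B
    using independent_card_le_dim[of B UNIV] ind[OF that] by simp
  have "P {}" by (simp add: P_def)
  then obtain B where B: "P B" and max: "\<And>B'. P B' \<Longrightarrow> card B' \<le> card B"
    using Lattices_Big.ex_has_greatest_nat[of P "{}" card "Suc CARD('n)"] crd by (auto simp: less_Suc_eq_le)
  have fin: "finite B" using ind[OF B] finiteI_independent by blast
  have "card B = CARD('n)"
  proof (rule ccontr)
    assume "card B \<noteq> CARD('n)"
    then have "dim (span B) < DIM(real^'n)" using crd[OF B] ind[OF B] by (simp add: dim_eq_card_independent)
    then obtain x where x: "x \<noteq> 0" "\<And>y. y \<in> span B \<Longrightarrow> orthogonal x y"
      by (metis orthogonal_to_subspace_exists dim_span)
    define V where "V = {x. \<forall>b\<in>B. x \<bullet> b = 0}"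
    have "subspace V" by (auto simp: V_def subspace_def inner_add_left)
    moreover have "x \<in> V" using x(2) by (auto simp: V_def orthogonal_def span_base)
    moreover have "A *v y \<in> V" if "y \<in> V" for y
      using that B symmetric_inner_commute[OF A, symmetric] by (fastforce simp: V_def P_def)
    ultimately obtain e where e: "e \<in> V" "norm e = 1" "\<exists>\<mu>. A *v e = \<mu> *\<^sub>R e"
      using ex_eigenvector_in_subspace[OF A, of V] x(1) by blast
    have "e \<notin> B" using e by (auto simp: V_def dot_square_norm)
    moreover have "P (insert e B)"
      using e B by (auto simp: P_def V_def pairwise_insert orthogonal_def inner_commute)
    ultimately show False using max[of "insert e B"] fin by simp
  qed
  then obtain e where e: "bij_betw e (UNIV::'n set) B"
    using finite_same_card_bij[of "UNIV::'n set" B] fin by auto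
  have eB: "e i \<in> B" for i using e by (auto simp: bij_betw_def)
  have "orthonormal e"
    unfolding orthonormal_def
  proof (intro allI)
    fix i j
    show "e i \<bullet> e j = (if i = j then 1 else 0)"
    proof (cases "i = j")
      case True then show ?thesis using B eB[of j] by (auto simp: P_def dot_square_norm)
    next
      case False
      then have "e i \<noteq> e j" using e by (auto simp: bij_betw_def inj_def)
      then show ?thesis using B eB False by (auto simp: P_def pairwise_def orthogonal_def)
    qed
  qed
  moreover have "\<exists>\<mu>. \<forall>i. A *v e i = \<mu> i *\<^sub>R e i"
    using B eB by (intro choice) (auto simp: P_def)
  ultimately show ?thesis by blast
qed

lemma orthonormal_matrix:
  fixes e :: "'n \<Rightarrow> real^'n"
  assumes "orthonormal e"
  shows "(\<chi> i. e i) ** transpose (\<chi> i. e i) = mat 1" "transpose (\<chi> i. e i) ** (\<chi> i. e i) = mat 1"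
proof -
  show "(\<chi> i. e i) ** transpose (\<chi> i. e i) = mat 1"
    using assms by (simp add: vec_eq_iff matrix_matrix_mult_def transpose_def mat_def orthonormal_def inner_vec_def)
  then show "transpose (\<chi> i. e i) ** (\<chi> i. e i) = mat 1"
    using matrix_left_right_inverse by blast
qed

lemma orthonormal_expansion:
  fixes e :: "'n \<Rightarrow> real^'n"
  assumes "orthonormal e"
  shows "x = (\<Sum>i\<in>UNIV. (x \<bullet> e i) *\<^sub>R e i)"
proof -
  let ?Q = "\<chi> i. e i"
  have "x = transpose ?Q *v (?Q *v x)"
    by (simp add: matrix_vector_mul_assoc orthonormal_matrix[OF assms] del: transpose_matrix_vector)
  also have "\<dots> = (\<Sum>i\<in>UNIV. (x \<bullet> e i) *\<^sub>R e i)"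
    by (simp add: vec_eq_iff matrix_vector_mult_def transpose_def inner_vec_def mult_ac del: transpose_matrix_vector)
  finally show ?thesis .
qed

lemma orthonormal_parseval:
  fixes e :: "'n \<Rightarrow> real^'n"
  assumes "orthonormal e"
  shows "x \<bullet> y = (\<Sum>i\<in>UNIV. (x \<bullet> e i) * (y \<bullet> e i))"
proof -
  have "x \<bullet> y = x \<bullet> (\<Sum>i\<in>UNIV. (y \<bullet> e i) *\<^sub>R e i)"
    using orthonormal_expansion[OF assms, of y] by simp
  then show ?thesis by (simp add: inner_sum_right mult_ac)
qed

lemma is_eigenvalues_eigenbasis:
  fixes A :: "real^'n^'n"
  assumes e: "orthonormal e" and A: "\<And>i. A *v e i = \<mu> i *\<^sub>R e i"
  shows "is_eigenvalues A (\<chi> i. \<mu> i)"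
  unfolding is_eigenvalues_def
proof
  fix t
  let ?Q = "\<chi> i. e i"
  have "(mat t - A) *v e j = (t - \<mu> j) *\<^sub>R e j" for j
    by (simp add: matrix_vector_mult_diff_rdistrib A scaleR_diff_left)
      (simp add: vec_eq_iff matrix_vector_mult_def mat_def if_distrib[of "\<lambda>x. x * _"] cong: if_cong)
  then have c: "e i \<bullet> ((mat t - A) *v e j) = (if i = j then t - \<mu> i else 0)" for i j
    using e by (simp add: orthonormal_def)
  have "(?Q ** (mat t - A) ** transpose ?Q) $ i $ j = e i \<bullet> ((mat t - A) *v e j)" for i j
    unfolding matrix_mul_assoc[symmetric]
    by (simp add: matrix_matrix_mult_def[of ?Q] inner_vec_def)
      (simp add: matrix_matrix_mult_def matrix_vector_mult_def transpose_def)
  then have D: "?Q ** (mat t - A) ** transpose ?Q = (\<chi> i j. if i = j then t - \<mu> i else 0)"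
    by (simp add: vec_eq_iff c)
  have "det ?Q * det (transpose ?Q) = 1"
    using arg_cong[OF orthonormal_matrix(1)[OF e], of det] by (simp add: det_mul)
  then have "det (mat t - A) = det (?Q ** (mat t - A) ** transpose ?Q)"
    by (simp add: det_mul)
  also have "\<dots> = (\<Prod>i\<in>UNIV. t - \<mu> i)" unfolding D by (subst det_diagonal) auto
  finally show "det (mat t - A) = (\<Prod>i\<in>UNIV. t - (\<chi> i. \<mu> i) $ i)" by simp
qed

text \<open>Equal characteristic polynomials have the same multiset of roots. This makes the
  arbitrary ordering chosen in \<open>eigenvalues\<close> manageable.\<close>

lemma is_eigenvalues_permutes:
  fixes A :: "real^'n^'n"
  assumes "is_eigenvalues A v" "is_eigenvalues A w"
  shows "\<exists>\<pi>. \<pi> permutes UNIV \<and> (\<forall>i. v $ i = w $ \<pi> i)"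
proof -
  have "poly (\<Prod>i\<in>UNIV. [:- v $ i, 1:]) t = poly (\<Prod>i\<in>UNIV. [:- w $ i, 1:]) t" for t
    using assms by (simp add: poly_prod is_eigenvalues_def)
  then have "(\<Prod>i\<in>UNIV. [:- v $ i, 1:]) = (\<Prod>i\<in>UNIV. [:- w $ i, 1:])"
    by (intro poly_eq_poly_eq_iff[THEN iffD1] ext)
  then have "proots (\<Prod>i\<in>UNIV. [:- v $ i, 1:]) = proots (\<Prod>i\<in>UNIV. [:- w $ i, 1:])" by simp
  then have "image_mset (($) v) (mset_set UNIV) = image_mset (($) w) (mset_set UNIV)"
    by (simp add: proots_prod sum_unfold_sum_mset)
  from image_mset_eq_implies_permutes[OF _ this] show ?thesis by (metis UNIV_I finite)
qed

lemma is_eigenvalues_eigenvalues: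
  fixes A :: "real^'n^'n"
  assumes "transpose A = A"
  shows "is_eigenvalues A (eigenvalues A)"
  using ex_eigenbasis[OF assms] is_eigenvalues_eigenbasis unfolding eigenvalues_def by (metis someI_ex)

text \<open>The eigenbasis is reindexed by the permutation just obtained, so that slope a_i,
  eigenvalue and eigenvector share an index.\<close>

lemma ex_eigenbasis_eigenvalues:
  fixes A :: "real^'n^'n"
  assumes A: "transpose A = A"
  shows "\<exists>e. orthonormal e \<and> (\<forall>i. A *v e i = (eigenvalues A $ i) *\<^sub>R e i)"
proof -
  obtain e \<mu> where e: "orthonormal e" "\<And>i. A *v e i = \<mu> i *\<^sub>R e i"
    using ex_eigenbasis[OF A] by blast
  obtain \<pi> where \<pi>: "\<pi> permutes UNIV" "\<And>i. eigenvalues A $ i = \<mu> (\<pi> i)"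
    using is_eigenvalues_permutes[OF is_eigenvalues_eigenvalues[OF A] is_eigenvalues_eigenbasis[OF e]] by auto
  have "orthonormal (\<lambda>i. e (\<pi> i))"
    using e(1) permutes_inj[OF \<pi>(1)] by (auto simp: orthonormal_def inj_eq)
  then show ?thesis using e(2) \<pi>(2) by (intro exI[of _ "\<lambda>i. e (\<pi> i)"]) simp
qed

text \<open>The minimum of a linear functional over doubly stochastic matrices is attained at a permutation.
  Induction: the mass of the row of the smallest \<open>a\<close> and of the column of the largest \<open>b\<close>
  is moved to their common entry.\<close>

lemma doubly_stochastic_rearrangement:
  fixes a :: "'i \<Rightarrow> real" and b :: "'j \<Rightarrow> real" and S :: "'i \<Rightarrow> 'j \<Rightarrow> real"
  assumes "finite I" "finite J" "card I = card J"
    and "\<And>i j. i \<in> I \<Longrightarrow> j \<in> J \<Longrightarrow> 0 \<le> S i j"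
    and "\<And>i. i \<in> I \<Longrightarrow> (\<Sum>j\<in>J. S i j) = 1" and "\<And>j. j \<in> J \<Longrightarrow> (\<Sum>i\<in>I. S i j) = 1"
  shows "\<exists>\<pi>. bij_betw \<pi> I J \<and> (\<Sum>i\<in>I. a i * b (\<pi> i)) \<le> (\<Sum>i\<in>I. \<Sum>j\<in>J. a i * S i j * b j)"
  using assms
proof (induction "card I" arbitrary: I J S)
  case 0
  then have "I = {}" "J = {}" by auto
  then show ?case by (intro exI[of _ undefined]) (simp add: bij_betw_def)
next
  case (Suc n)
  have ne: "I \<noteq> {}" "J \<noteq> {}" using Suc.hyps(2) Suc.prems(3) by auto
  obtain i0 where i0: "i0 \<in> I" "\<And>i. i \<in> I \<Longrightarrow> a i0 \<le> a i"
    using arg_min_if_finite[OF Suc.prems(1) ne(1), of a] by (metis not_le_imp_less)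
  obtain j0 where j0: "j0 \<in> J" "\<And>j. j \<in> J \<Longrightarrow> b j \<le> b j0"
    using arg_min_if_finite[OF Suc.prems(2) ne(2), of "\<lambda>j. - b j"] by (metis neg_less_iff_less not_le_imp_less)
  let ?I = "I - {i0}" and ?J = "J - {j0}"
  define d where "d = 1 - S i0 j0"
  define r where "r i = S i j0" for i
  define s where "s j = S i0 j" for j
  have r0: "r i \<ge> 0" if "i \<in> I" for i using Suc.prems(4) that j0 by (simp add: r_def)
  have s0: "s j \<ge> 0" if "j \<in> J" for j using Suc.prems(4) that i0 by (simp add: s_def)
  have r_sum: "(\<Sum>i\<in>?I. r i) = d"
    using Suc.prems(6)[OF j0(1)] i0 Suc.prems(1) by (simp add: r_def d_def sum_diff1)
  have s_sum: "(\<Sum>j\<in>?J. s j) = d"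
    using Suc.prems(5)[OF i0(1)] j0 Suc.prems(2) by (simp add: s_def d_def sum_diff1)
  have d0: "d \<ge> 0" unfolding r_sum[symmetric] using r0 by (intro sum_nonneg) auto
  have r_z: "r i = 0" if "d = 0" "i \<in> ?I" for i
    using r_sum that r0 sum_nonneg_eq_0_iff[of ?I r] Suc.prems(1) by auto
  have s_z: "s j = 0" if "d = 0" "j \<in> ?J" for j
    using s_sum that s0 sum_nonneg_eq_0_iff[of ?J s] Suc.prems(2) by auto
  \<comment> \<open>Deleting row i0 and column j0 takes the mass r_i from row i and s_j from column
    j, both of total d. The rank-one matrix r_i s_j / d restores all sums to 1. If d = 0, all r_i
    and s_j vanish and so does the added term.\<close>
  define S' where "S' i j = S i j + r i * s j / d" for i j
  have "\<exists>\<pi>. bij_betw \<pi> ?I ?J \<and> (\<Sum>i\<in>?I. a i * b (\<pi> i)) \<le> (\<Sum>i\<in>?I. \<Sum>j\<in>?J. a i * S' i j * b j)"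
  proof (rule Suc.hyps(1))
    show "n = card ?I" "finite ?I" "finite ?J" "card ?I = card ?J"
      using Suc.hyps(2) Suc.prems(1-3) i0 j0 by auto
    show "0 \<le> S' i j" if "i \<in> ?I" "j \<in> ?J" for i j
      using that Suc.prems(4) r0 s0 d0 by (auto simp: S'_def intro!: add_nonneg_nonneg divide_nonneg_nonneg)
    show "(\<Sum>j\<in>?J. S' i j) = 1" if "i \<in> ?I" for i
    proof -
      have "(\<Sum>j\<in>?J. S' i j) = (\<Sum>j\<in>?J. S i j) + r i * d / d"
        by (simp add: S'_def sum.distrib s_sum flip: sum_divide_distrib sum_distrib_left)
      also have "(\<Sum>j\<in>?J. S i j) = 1 - r i"
        using Suc.prems(5)[of i] that j0 Suc.prems(2) by (simp add: r_def sum_diff1)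
      finally show ?thesis using r_z[OF _ that] by auto
    qed
    show "(\<Sum>i\<in>?I. S' i j) = 1" if "j \<in> ?J" for j
    proof -
      have "(\<Sum>i\<in>?I. S' i j) = (\<Sum>i\<in>?I. S i j) + d * s j / d"
        by (simp add: S'_def sum.distrib r_sum flip: sum_divide_distrib sum_distrib_right)
      also have "(\<Sum>i\<in>?I. S i j) = 1 - s j"
        using Suc.prems(6)[of j] that i0 Suc.prems(1) by (simp add: s_def sum_diff1)
      finally show ?thesis using s_z[OF _ that] by auto
    qed
  qed
  then obtain \<pi> where \<pi>: "bij_betw \<pi> ?I ?J"
    "(\<Sum>i\<in>?I. a i * b (\<pi> i)) \<le> (\<Sum>i\<in>?I. \<Sum>j\<in>?J. a i * S' i j * b j)" by blast
  define R where "R = (\<Sum>i\<in>?I. a i * r i)"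
  define T where "T = (\<Sum>j\<in>?J. s j * b j)"
  define U where "U = (\<Sum>i\<in>?I. \<Sum>j\<in>?J. a i * S i j * b j)"
  have S'_sum: "(\<Sum>i\<in>?I. \<Sum>j\<in>?J. a i * S' i j * b j) = U + R * T / d"
  proof -
    have "R * T / d = (\<Sum>i\<in>?I. \<Sum>j\<in>?J. a i * (r i * s j / d) * b j)"
      unfolding R_def T_def sum_product sum_divide_distrib by (simp add: mult_ac)
    then show ?thesis
      by (simp add: U_def S'_def distrib_left distrib_right sum.distrib)
  qed
  have S_sum: "(\<Sum>i\<in>I. \<Sum>j\<in>J. a i * S i j * b j) = a i0 * (1 - d) * b j0 + R * b j0 + a i0 * T + U"
  proof -
    have "(\<Sum>j\<in>J. a i * S i j * b j) = a i * r i * b j0 + (\<Sum>j\<in>?J. a i * S i j * b j)" for i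
      using j0 Suc.prems(2) by (subst sum.remove[of _ j0]) (auto simp: r_def)
    then have "(\<Sum>i\<in>I. \<Sum>j\<in>J. a i * S i j * b j)
        = (\<Sum>i\<in>I. a i * r i * b j0) + (\<Sum>i\<in>I. \<Sum>j\<in>?J. a i * S i j * b j)" by (simp add: sum.distrib)
    also have "(\<Sum>i\<in>I. a i * r i * b j0) = a i0 * (1 - d) * b j0 + R * b j0"
      using i0 Suc.prems(1) by (subst sum.remove[of _ i0]) (auto simp: R_def sum_distrib_right d_def r_def)
    also have "(\<Sum>i\<in>I. \<Sum>j\<in>?J. a i * S i j * b j) = a i0 * T + U"
      using i0 Suc.prems(1) by (subst sum.remove[of _ i0]) (auto simp: T_def U_def sum_distrib_left s_def mult_ac)
    finally show ?thesis by simp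
  qed
  have R: "R \<ge> a i0 * d" unfolding R_def r_sum[symmetric] sum_distrib_left
    using i0 r0 by (intro sum_mono mult_right_mono) auto
  have T: "T \<le> d * b j0" unfolding T_def s_sum[symmetric] sum_distrib_right
    using j0 s0 by (intro sum_mono mult_left_mono) auto
  have "a i0 * b j0 + (U + R * T / d) \<le> a i0 * (1 - d) * b j0 + R * b j0 + a i0 * T + U"
  proof (cases "d = 0")
    case True
    then have "R = 0" "T = 0" using r_z s_z by (auto simp: R_def T_def)
    then show ?thesis using True by simp
  next
    case False
    \<comment> \<open>The product is exactly the loss of the functional in the exchange; its factors
      are nonnegative because \<open>a i0\<close> is minimal and \<open>b j0\<close>
      maximal.\<close>
    then have "0 \<le> (R - a i0 * d) * (d * b j0 - T) / d"
      using R T d0 by (intro divide_nonneg_nonneg mult_nonneg_nonneg) auto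
    also have "\<dots> = R * b j0 - a i0 * d * b j0 + a i0 * T - R * T / d"
      using False by (simp add: field_simps)
    finally show ?thesis by (simp add: algebra_simps)
  qed
  then have fin: "a i0 * b j0 + (\<Sum>i\<in>?I. a i * b (\<pi> i)) \<le> (\<Sum>i\<in>I. \<Sum>j\<in>J. a i * S i j * b j)"
    unfolding S_sum using \<pi>(2) S'_sum by linarith
  define \<rho> where "\<rho> = \<pi>(i0 := j0)"
  have "bij_betw \<rho> ?I ?J" using \<pi>(1) by (rule bij_betw_cong[THEN iffD1, rotated]) (auto simp: \<rho>_def)
  then have "bij_betw \<rho> (insert i0 ?I) (insert j0 ?J)"
    using bij_betw_combine[of \<rho> ?I ?J "{i0}" "{j0}"] by (simp add: \<rho>_def)
  then have "bij_betw \<rho> I J" using i0 j0 by (simp add: insert_absorb)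
  moreover have "(\<Sum>i\<in>I. a i * b (\<rho> i)) = a i0 * b j0 + (\<Sum>i\<in>?I. a i * b (\<pi> i))"
    using i0 Suc.prems(1) by (subst sum.remove[of _ i0]) (auto simp: \<rho>_def)
  ultimately show ?case using fin by auto
qed

section \<open>Transfer from eigenvalue vectors to symmetric matrices\<close>

lemma es_eq_sum_subsets:
  assumes S: "finite S"
  shows "es j S x = (\<Sum>T | T \<subseteq> S \<and> card T = j. \<Prod>i\<in>T. x i)"
proof -
  have p: "(\<Prod>i\<in>T. [:0, x i:]) = monom (\<Prod>i\<in>T. x i) (card T)" if "finite T" for T
    using that
  proof (induction T rule: finite_induct)
    case (insert a T)
    have "[:0, x a:] = monom (x a) 1" by (simp add: monom_Suc monom_0 One_nat_def)
    then show ?case using insert by (simp add: mult_monom del: mult_pCons_left)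
  qed simp
  have "(\<Prod>i\<in>S. [:1, x i:]) = (\<Prod>i\<in>S. [:0, x i:] + 1)" by (simp add: one_pCons)
  also have "\<dots> = (\<Sum>T\<in>Pow S. (\<Prod>i\<in>T. [:0, x i:]) * (\<Prod>i\<in>S - T. 1))" by (rule prod_add[OF S])
  also have "\<dots> = (\<Sum>T\<in>Pow S. monom (\<Prod>i\<in>T. x i) (card T))"
    using S by (intro sum.cong refl) (simp add: p finite_subset)
  finally have "es j S x = (\<Sum>T\<in>Pow S. if card T = j then \<Prod>i\<in>T. x i else 0)"
    by (simp add: es_def coeff_sum)
  also have "\<dots> = (\<Sum>T | T \<subseteq> S \<and> card T = j. \<Prod>i\<in>T. x i)"
    using S by (intro sum.mono_neutral_cong_right) auto
  finally show ?thesis .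
qed

lemma esym_eq_es: "esym (int j) v = es j UNIV (($) v)"
  by (simp add: esym_def es_eq_sum_subsets)

lemma es_with_alpha:
  fixes v :: "real^'n"
  shows "es j UNIV (with_alpha \<alpha> v) = esym (int j) (eta_of v) + \<alpha> * esym (int j - 1) (eta_of v)"
proof -
  have "es i (range Some) (with_alpha \<alpha> v) = es i UNIV (($) (eta_of v))" for i
    unfolding es_def by (subst prod.reindex) (auto simp: with_alpha_def)
  then have r: "es i (range Some) (with_alpha \<alpha> v) = esym (int i) (eta_of v)" for i
    by (simp add: esym_eq_es)
  have U: "UNIV - {None} = range Some" by (auto simp: UNIV_option_conv)
  show ?thesis
  proof (cases j)
    \<comment> \<open>In order 0 the second term contains \<open>esym (-1)\<close>, which is 0 by
      convention.\<close>
    case 0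
    then show ?thesis by (simp add: esym_eq_es[of 0, simplified]) (simp add: esym_def)
  next
    case (Suc i)
    show ?thesis
      unfolding Suc es_split[OF finite UNIV_I[of None]] U r by (simp add: with_alpha_def)
  qed
qed

lemma es_with_alpha_permutes:
  fixes v :: "real^'n"
  assumes "\<pi> permutes UNIV"
  shows "es j UNIV (with_alpha \<alpha> (\<chi> i. v $ \<pi> i)) = es j UNIV (with_alpha \<alpha> v)"
proof -
  have "eta_of (\<chi> i. v $ \<pi> i) $ i = eta_of v $ \<pi> i" for i
  proof -
    have "(\<Sum>j\<in>UNIV - {i}. v $ \<pi> j) = (\<Sum>j\<in>\<pi> ` (UNIV - {i}). v $ j)"
      using permutes_inj[OF assms] by (subst sum.reindex) (auto simp: inj_on_def inj_def)
    also have "\<pi> ` (UNIV - {i}) = UNIV - {\<pi> i}"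
      using permutes_inj[OF assms] permutes_surj[OF assms] by (simp add: image_set_diff)
    finally show ?thesis by (simp add: eta_of_def)
  qed
  then have "es i UNIV (($) (eta_of (\<chi> i. v $ \<pi> i))) = es i UNIV (($) (eta_of v))" for i
    unfolding es_def using prod.permute[OF assms, of "\<lambda>i. [:1, eta_of v $ i:]"] by (simp add: o_def)
  then have "esym i (eta_of (\<chi> i. v $ \<pi> i)) = esym i (eta_of v)" for i
    by (cases i rule: int_cases3) (simp_all add: esym_eq_es esym_eq_es[of 0, simplified], simp_all add: esym_def)
  then show ?thesis by (simp add: es_with_alpha)
qed

text \<open>In the eigenbasis of A the diagonal entries of B are averages of the eigenvalues of B
  with the doubly stochastic weights (e_i . w_j)^2. By rearrangement, their sum with weights a_i is
  at least the one for some ordering of the eigenvalues of B, and the vector estimate applies to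
  that ordering because the quotient is symmetric.\<close>

lemma matrix_estimate:
  assumes "l < k" "k < CARD('n::finite)"
  shows "\<exists>c>0. \<exists>C>0. \<forall>\<alpha> (A::real^'n^'n) M. transpose A = A \<longrightarrow>
    with_alpha \<alpha> (eigenvalues A) \<in> garding k UNIV \<longrightarrow>
    es_quotient k l UNIV (with_alpha \<alpha> (eigenvalues A)) \<le> M \<longrightarrow>
    (\<exists>e a \<tau>. orthonormal e \<and> (\<forall>i. A *v e i = (eigenvalues A $ i) *\<^sub>R e i) \<and>
      0 < \<tau> \<and> \<tau> \<le> 1 + M \<and> (\<forall>i. c \<le> a i \<and> a i \<le> C) \<and>
      (\<forall>B. transpose B = B \<longrightarrow> with_alpha \<alpha> (eigenvalues B) \<in> garding k UNIV \<longrightarrow>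
        \<tau> * (ln (es_quotient k l UNIV (with_alpha \<alpha> (eigenvalues B))) - ln (es_quotient k l UNIV (with_alpha \<alpha> (eigenvalues A))))
          \<le> (\<Sum>i\<in>UNIV. a i * (e i \<bullet> (B *v e i))) - (\<Sum>i\<in>UNIV. a i * (e i \<bullet> (A *v e i)))))"
proof -
  obtain c C where cC: "c > 0" "C > 0" and est: "\<And>\<alpha> (v::real^'n) M. with_alpha \<alpha> v \<in> garding k UNIV \<Longrightarrow>
    es_quotient k l UNIV (with_alpha \<alpha> v) \<le> M \<Longrightarrow>
    (\<exists>a \<tau>. 0 < \<tau> \<and> \<tau> \<le> 1 + M \<and> (\<forall>i. c \<le> a i \<and> a i \<le> C) \<and>
      (\<forall>w. with_alpha \<alpha> w \<in> garding k UNIV \<longrightarrow>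
        \<tau> * (ln (es_quotient k l UNIV (with_alpha \<alpha> w)) - ln (es_quotient k l UNIV (with_alpha \<alpha> v)))
          \<le> (\<Sum>i\<in>UNIV. a i * (w $ i - v $ i))))"
    using vector_estimate[OF assms] by blast
  show ?thesis
  proof (rule exI[of _ c], rule conjI, rule cC, rule exI[of _ C], intro conjI allI impI cC)
    fix \<alpha> M and A :: "real^'n^'n"
    let ?y = "\<lambda>A::real^'n^'n. with_alpha \<alpha> (eigenvalues A)"
    assume A: "transpose A = A" "?y A \<in> garding k UNIV" "es_quotient k l UNIV (?y A) \<le> M"
    obtain e where e: "orthonormal e" "\<And>i. A *v e i = (eigenvalues A $ i) *\<^sub>R e i"
      using ex_eigenbasis_eigenvalues[OF A(1)] by blast
    obtain a \<tau> where a: "0 < \<tau>" "\<tau> \<le> 1 + M" "\<And>i. c \<le> a i" "\<And>i. a i \<le> C"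
      and sup: "\<And>w. with_alpha \<alpha> w \<in> garding k UNIV \<Longrightarrow>
        \<tau> * (ln (es_quotient k l UNIV (with_alpha \<alpha> w)) - ln (es_quotient k l UNIV (?y A)))
          \<le> (\<Sum>i\<in>UNIV. a i * (w $ i - eigenvalues A $ i))"
      using est[OF A(2,3)] by blast
    have "\<tau> * (ln (es_quotient k l UNIV (?y B)) - ln (es_quotient k l UNIV (?y A)))
          \<le> (\<Sum>i\<in>UNIV. a i * (e i \<bullet> (B *v e i))) - (\<Sum>i\<in>UNIV. a i * (e i \<bullet> (A *v e i)))"
      if B: "transpose B = B" "?y B \<in> garding k UNIV" for B :: "real^'n^'n"
    proof -
      obtain w where w: "orthonormal w" "\<And>i. B *v w i = (eigenvalues B $ i) *\<^sub>R w i"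
        using ex_eigenbasis_eigenvalues[OF B(1)] by blast
      define S where "S i j = (e i \<bullet> w j)\<^sup>2" for i j
      have "(\<Sum>j\<in>UNIV. S i j) = 1" for i
        using orthonormal_parseval[OF w(1), of "e i" "e i"] e(1) by (simp add: S_def orthonormal_def power2_eq_square)
      moreover have "(\<Sum>i\<in>UNIV. S i j) = 1" for j
        using orthonormal_parseval[OF e(1), of "w j" "w j"] w(1)
        by (simp add: S_def orthonormal_def power2_eq_square inner_commute)
      ultimately obtain \<pi> where \<pi>: "bij \<pi>"
        "(\<Sum>i\<in>UNIV. a i * eigenvalues B $ \<pi> i) \<le> (\<Sum>i\<in>UNIV. \<Sum>j\<in>UNIV. a i * S i j * eigenvalues B $ j)"
        using doubly_stochastic_rearrangement[of UNIV UNIV S a "($) (eigenvalues B)"] by (auto simp: S_def)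
      have perm: "\<pi> permutes UNIV" using \<pi>(1) by (intro bij_imp_permutes) auto
      have "e i \<bullet> (B *v e i) = (\<Sum>j\<in>UNIV. S i j * eigenvalues B $ j)" for i
      proof -
        have "(B *v e i) \<bullet> w j = eigenvalues B $ j * (e i \<bullet> w j)" for j
          unfolding symmetric_inner_commute[OF B(1), symmetric] w(2) by simp
        then show ?thesis
          using orthonormal_parseval[OF w(1), of "e i" "B *v e i"] by (simp add: S_def power2_eq_square mult_ac)
      qed
      then have eB: "(\<Sum>i\<in>UNIV. a i * (e i \<bullet> (B *v e i))) = (\<Sum>i\<in>UNIV. \<Sum>j\<in>UNIV. a i * S i j * eigenvalues B $ j)"
        by (simp add: sum_distrib_left mult_ac)
      have eA: "e i \<bullet> (A *v e i) = eigenvalues A $ i" for i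
        using e by (simp add: orthonormal_def)
      have p: "es j UNIV (with_alpha \<alpha> (\<chi> i. eigenvalues B $ \<pi> i)) = es j UNIV (?y B)" for j
        by (rule es_with_alpha_permutes[OF perm])
      have "with_alpha \<alpha> (\<chi> i. eigenvalues B $ \<pi> i) \<in> garding k UNIV"
        using B(2) by (simp add: garding_def p)
      from sup[OF this] have "\<tau> * (ln (es_quotient k l UNIV (?y B)) - ln (es_quotient k l UNIV (?y A)))
          \<le> (\<Sum>i\<in>UNIV. a i * (eigenvalues B $ \<pi> i - eigenvalues A $ i))"
        by (simp add: es_quotient_def p)
      also have "\<dots> = (\<Sum>i\<in>UNIV. a i * eigenvalues B $ \<pi> i) - (\<Sum>i\<in>UNIV. a i * eigenvalues A $ i)"
        by (simp add: right_diff_distrib sum_subtractf)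
      finally show ?thesis using \<pi>(2) unfolding eB eA by linarith
    qed
    then show "\<exists>e a \<tau>. orthonormal e \<and> (\<forall>i. A *v e i = (eigenvalues A $ i) *\<^sub>R e i) \<and>
      0 < \<tau> \<and> \<tau> \<le> 1 + M \<and> (\<forall>i. c \<le> a i \<and> a i \<le> C) \<and>
      (\<forall>B. transpose B = B \<longrightarrow> ?y B \<in> garding k UNIV \<longrightarrow>
        \<tau> * (ln (es_quotient k l UNIV (?y B)) - ln (es_quotient k l UNIV (?y A)))
          \<le> (\<Sum>i\<in>UNIV. a i * (e i \<bullet> (B *v e i))) - (\<Sum>i\<in>UNIV. a i * (e i \<bullet> (A *v e i))))"
      using e a by (intro exI[of _ e] exI[of _ a] exI[of _ \<tau>]) blast
  qed
qed

text \<open>Admissibility controls orders up to k - 1. As \<alpha> >= 0, these stay positive after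
  \<alpha> is appended, in particular the denominator of order l < k; the equation with F > 0 then
  yields order k.\<close>

lemma garding_of_equation:
  fixes v :: "real^'n"
  assumes l: "0 \<le> l" "l < k" and \<alpha>: "\<alpha> \<ge> 0" and adm: "\<And>i. i \<in> {1..k-1} \<Longrightarrow> esym i (eta_of v) > 0"
    and eqn: "(esym k (eta_of v) + \<alpha> * esym (k - 1) (eta_of v)) / (esym l (eta_of v) + \<alpha> * esym (l - 1) (eta_of v)) = F"
    and F: "F > 0"
  shows "with_alpha \<alpha> v \<in> garding (nat k) UNIV" "es_quotient (nat k) (nat l) UNIV (with_alpha \<alpha> v) = F"
proof -
  have e0: "esym 0 (eta_of v) = 1" using esym_eq_es[of 0 "eta_of v"] by simp
  have nonneg: "esym i (eta_of v) \<ge> 0" if "i \<le> k - 1" for i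
    using that adm[of i] e0 by (cases "i < 0"; cases "i = 0") (auto simp: esym_def less_imp_le)
  have pos: "es j UNIV (with_alpha \<alpha> v) > 0" if "int j < k" for j
  proof -
    have "esym (int j) (eta_of v) > 0"
      using that adm[of "int j"] e0 by (cases "j = 0") auto
    then show ?thesis using nonneg[of "int j - 1"] \<alpha> that by (simp add: es_with_alpha add_pos_nonneg)
  qed
  have k: "int (nat k) = k" "int (nat l) = l" using l by auto
  have q: "es_quotient (nat k) (nat l) UNIV (with_alpha \<alpha> v) = F"
    unfolding es_quotient_def es_with_alpha k by (rule eqn)
  then show "es_quotient (nat k) (nat l) UNIV (with_alpha \<alpha> v) = F" .
  have "es (nat k) UNIV (with_alpha \<alpha> v) = F * es (nat l) UNIV (with_alpha \<alpha> v)"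
    using q pos[of "nat l"] l by (auto simp: es_quotient_def field_simps)
  then have "es (nat k) UNIV (with_alpha \<alpha> v) > 0"
    using F pos[of "nat l"] l by simp
  then show "with_alpha \<alpha> v \<in> garding (nat k) UNIV"
    using pos by (auto simp: garding_def le_less zless_nat_eq_int_zless)
qed

section \<open>Partial derivatives\<close>

lemma pd_eqI: "(g has_derivative g') (at x) \<Longrightarrow> pd b g x = g' b"
  by (metis frechet_derivative_at pd_def)

lemma has_derivative_pd: "g differentiable (at x) \<Longrightarrow> (g has_derivative (\<lambda>b. pd b g x)) (at x)"
  by (simp add: pd_def[abs_def] frechet_derivative_works[symmetric])

lemma has_derivative_cong_open:
  assumes "open U" "x \<in> U" "\<And>y. y \<in> U \<Longrightarrow> g y = h y"
  shows "(g has_derivative g') (at x) \<longleftrightarrow> (h has_derivative g') (at x)"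
  using has_derivative_transform_within_open[of g g' x UNIV U h] has_derivative_transform_within_open[of h g' x UNIV U g]
    assms by metis

lemma pd_cong:
  assumes "open U" "x \<in> U" "\<And>y. y \<in> U \<Longrightarrow> g y = h y"
  shows "pd b g x = pd b h x"
  by (simp add: pd_def frechet_derivative_def has_derivative_cong_open[OF assms])

lemma C_open_continuous: "C_open k U g \<Longrightarrow> continuous_on U g"
  by (cases k) auto

lemma C_open_differentiable: "open U \<Longrightarrow> C_open (Suc k) U g \<Longrightarrow> x \<in> U \<Longrightarrow> g differentiable (at x)"
  by (simp add: differentiable_on_eq_differentiable_at)

lemma C_open_cong:
  assumes "open U" "\<And>x. x \<in> U \<Longrightarrow> g x = h x"
  shows "C_open k U g \<longleftrightarrow> C_open k U h"
  using assms(2)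
proof (induction k arbitrary: g h)
  case 0
  then show ?case by (simp cong: continuous_on_cong)
next
  case (Suc k)
  have "C_open k U (pd b g) \<longleftrightarrow> C_open k U (pd b h)" for b
    by (rule Suc.IH) (rule pd_cong[OF assms(1)], use Suc.prems in auto)
  moreover have "(g has_derivative D) (at x) \<longleftrightarrow> (h has_derivative D) (at x)" if "x \<in> U" for x D
    by (rule has_derivative_cong_open[OF assms(1) that Suc.prems])
  then have "g differentiable_on U \<longleftrightarrow> h differentiable_on U"
    unfolding differentiable_on_eq_differentiable_at[OF assms(1)] differentiable_def by blast
  ultimately show ?case using Suc.prems by (simp cong: continuous_on_cong)
qed

lemma C_open_Suc_imp: "C_open (Suc k) U g \<Longrightarrow> C_open k U g"
  by (induction k arbitrary: g) auto

lemma C_open_mono: "C_open k U g \<Longrightarrow> j \<le> k \<Longrightarrow> C_open j U g"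
  by (induction k rule: nat.induct) (metis C_open_Suc_imp le_Suc_eq le_zero_eq)+

lemma pd_add:
  assumes "g differentiable (at x)" "h differentiable (at x)"
  shows "pd b (\<lambda>x. g x + h x) x = pd b g x + pd b h x"
  by (rule pd_eqI) (intro has_derivative_add has_derivative_pd assms)

lemma pd_cmult:
  assumes "g differentiable (at x)"
  shows "pd b (\<lambda>x. c * g x) x = c * pd b g x"
  by (rule pd_eqI) (intro has_derivative_mult_right has_derivative_pd assms)

lemma pd_sum:
  assumes "\<And>i. i \<in> I \<Longrightarrow> g i differentiable (at x)"
  shows "pd b (\<lambda>x. \<Sum>i\<in>I. g i x) x = (\<Sum>i\<in>I. pd b (g i) x)"
  by (rule pd_eqI) (intro has_derivative_sum has_derivative_pd assms)

lemma C_open_add: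
  assumes "open U" "C_open k U g" "C_open k U h"
  shows "C_open k U (\<lambda>x. g x + h x)"
  using assms(2,3)
proof (induction k arbitrary: g h)
  case (Suc k)
  have "C_open k U (pd b (\<lambda>x. g x + h x))" if "b \<in> Basis" for b
  proof -
    have "C_open k U (\<lambda>x. pd b g x + pd b h x)" using Suc that by auto
    then show ?thesis
      by (rule C_open_cong[OF assms(1), THEN iffD1, rotated])
        (use Suc.prems C_open_differentiable[OF assms(1)] pd_add in metis)
  qed
  then show ?case using Suc.prems by (auto intro!: continuous_on_add)
qed (auto intro!: continuous_on_add)

lemma C_open_cmult:
  assumes "open U" "C_open k U g"
  shows "C_open k U (\<lambda>x. c * g x)"
  using assms(2)
proof (induction k arbitrary: g)
  case (Suc k)
  have "C_open k U (pd b (\<lambda>x. c * g x))" if "b \<in> Basis" for b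
  proof -
    have "C_open k U (\<lambda>x. c * pd b g x)" using Suc that by auto
    then show ?thesis
      by (rule C_open_cong[OF assms(1), THEN iffD1, rotated])
        (use Suc.prems C_open_differentiable[OF assms(1)] pd_cmult in metis)
  qed
  then show ?case using Suc.prems by (auto intro!: continuous_on_mult differentiable_on_mult)
qed (auto intro!: continuous_on_mult)

lemma C_open_zero:
  fixes U :: "'a::euclidean_space set"
  shows "C_open k U (\<lambda>x. 0)"
proof (induction k)
  case (Suc k)
  moreover have "pd b (\<lambda>x. 0) = (\<lambda>x. 0)" for b :: 'a
    by (rule ext) (rule pd_eqI, rule has_derivative_const)
  ultimately show ?case by simp
qed simp

lemma C_open_sum:
  assumes "open U" "\<And>i. i \<in> I \<Longrightarrow> C_open k U (g i)"
  shows "C_open k U (\<lambda>x. \<Sum>i\<in>I. g i x)"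
  using assms(2)
  by (induction I rule: infinite_finite_induct) (auto intro: C_open_zero C_open_add[OF assms(1)])

lemma pd_expansion:
  assumes "g differentiable (at x)"
  shows "pd e g x = (\<Sum>b\<in>Basis. (e \<bullet> b) * pd b g x)"
proof -
  have lin: "linear (frechet_derivative g (at x))" by (rule linear_frechet_derivative[OF assms])
  have "pd e g x = frechet_derivative g (at x) (\<Sum>b\<in>Basis. (e \<bullet> b) *\<^sub>R b)"
    by (simp add: pd_def euclidean_representation)
  then show ?thesis by (simp add: pd_def linear_sum[OF lin] linear_scale[OF lin])
qed

text \<open>\<open>C_open\<close> speaks of basis directions; derivatives along eigenvectors are
  finite combinations of those.\<close>

lemma C_open_pd:
  assumes "open U" "C_open (Suc k) U g"
  shows "C_open k U (pd e g)"
proof -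
  have "C_open k U (\<lambda>x. \<Sum>b\<in>Basis. (e \<bullet> b) * pd b g x)"
    using assms by (intro C_open_sum C_open_cmult) auto
  then show ?thesis
    by (rule C_open_cong[OF assms(1), THEN iffD1, rotated])
      (use C_open_differentiable[OF assms] pd_expansion in metis)
qed

lemma pd_expansion2:
  assumes U: "open U" "x \<in> U" and g: "C_open 2 U g"
  shows "pd d (pd e g) x = (\<Sum>b\<in>Basis. (e \<bullet> b) * pd d (pd b g) x)"
proof -
  have g': "C_open (Suc 1) U g" using g by (simp add: numeral_2_eq_2)
  have dif: "pd b g differentiable (at x)" for b
    using C_open_differentiable[OF U(1), of 0 "pd b g" x] C_open_pd[OF U(1) g'] U(2) by simp
  have "pd d (pd e g) x = pd d (\<lambda>x. \<Sum>b\<in>Basis. (e \<bullet> b) * pd b g x) x"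
    by (rule pd_cong[OF U]) (use C_open_differentiable[OF U(1) g'] pd_expansion in metis)
  also have "\<dots> = (\<Sum>b\<in>Basis. (e \<bullet> b) * pd d (pd b g) x)"
    using dif by (simp add: pd_sum pd_cmult)
  finally show ?thesis .
qed

lemma DERIV_line:
  assumes "g differentiable (at (x + t *\<^sub>R e))"
  shows "((\<lambda>t. g (x + t *\<^sub>R e)) has_real_derivative pd e g (x + t *\<^sub>R e)) (at t)"
proof -
  have "((\<lambda>t. x + t *\<^sub>R e) has_derivative (\<lambda>h. h *\<^sub>R e)) (at t)"
    by (auto intro!: derivative_eq_intros)
  from has_derivative_compose[OF this has_derivative_pd[OF assms]]
  have "((\<lambda>t. g (x + t *\<^sub>R e)) has_derivative (\<lambda>h. pd (h *\<^sub>R e) g (x + t *\<^sub>R e))) (at t)" .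
  moreover have "pd (h *\<^sub>R e) g (x + t *\<^sub>R e) = pd e g (x + t *\<^sub>R e) * h" for h
    using linear_frechet_derivative[OF assms] by (simp add: pd_def linear_scale)
  ultimately show ?thesis by (simp add: has_field_derivative_def)
qed

text \<open>Both mixed derivatives are limits of the second difference quotient
  \<open>(g (x + h a + h b) - g (x + h a) - g (x + h b) + g x) / h\<^sup>2\<close>.\<close>

lemma second_difference_mean_value:
  assumes U: "open U" and g: "C_open 2 U g" and h: "h > 0"
    and sub: "\<And>s t. 0 \<le> s \<Longrightarrow> s \<le> h \<Longrightarrow> 0 \<le> t \<Longrightarrow> t \<le> h \<Longrightarrow> x + s *\<^sub>R a + t *\<^sub>R b \<in> U"
  shows "\<exists>s t. 0 \<le> s \<and> s \<le> h \<and> 0 \<le> t \<and> t \<le> h \<and>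
    g (x + h *\<^sub>R a + h *\<^sub>R b) - g (x + h *\<^sub>R a) - g (x + h *\<^sub>R b) + g x
      = h\<^sup>2 * pd b (pd a g) (x + s *\<^sub>R a + t *\<^sub>R b)"
proof -
  have g': "C_open (Suc 1) U g" using g by (simp add: numeral_2_eq_2)
  have d1: "((\<lambda>s. g (y + s *\<^sub>R a)) has_real_derivative pd a g (y + s *\<^sub>R a)) (at s)" if "y + s *\<^sub>R a \<in> U" for y s
    by (rule DERIV_line) (rule C_open_differentiable[OF U g' that])
  have d2: "((\<lambda>t. pd a g (y + t *\<^sub>R b)) has_real_derivative pd b (pd a g) (y + t *\<^sub>R b)) (at t)" if "y + t *\<^sub>R b \<in> U" for y t
    by (rule DERIV_line) (rule C_open_differentiable[OF U C_open_pd[OF U, of "Suc 0"] that], use g' in simp)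
  \<comment> \<open>The first difference in direction b, as a function along a. The mean value
    theorem is applied to it in s, then in t to the resulting difference of first
    derivatives.\<close>
  define \<phi> where "\<phi> s = g ((x + h *\<^sub>R b) + s *\<^sub>R a) - g (x + s *\<^sub>R a)" for s
  have "\<exists>s. 0 < s \<and> s < h \<and> \<phi> h - \<phi> 0 = (h - 0) * (pd a g ((x + h *\<^sub>R b) + s *\<^sub>R a) - pd a g (x + s *\<^sub>R a))"
  proof (rule MVT2[OF h])
    fix s assume s: "0 \<le> s" "s \<le> h"
    have "(x + h *\<^sub>R b) + s *\<^sub>R a \<in> U" "x + s *\<^sub>R a \<in> U"
      using sub[OF s, of h] sub[OF s, of 0] h by (simp_all add: add_ac)
    then show "(\<phi> has_real_derivative pd a g ((x + h *\<^sub>R b) + s *\<^sub>R a) - pd a g (x + s *\<^sub>R a)) (at s)"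
      unfolding \<phi>_def by (intro DERIV_diff d1)
  qed
  then obtain s where s: "0 < s" "s < h"
    "\<phi> h - \<phi> 0 = h * (pd a g ((x + h *\<^sub>R b) + s *\<^sub>R a) - pd a g (x + s *\<^sub>R a))" by auto
  have "\<exists>t. 0 < t \<and> t < h \<and> pd a g ((x + s *\<^sub>R a) + h *\<^sub>R b) - pd a g ((x + s *\<^sub>R a) + 0 *\<^sub>R b)
      = (h - 0) * pd b (pd a g) ((x + s *\<^sub>R a) + t *\<^sub>R b)"
    by (rule MVT2[OF h]) (use sub s in \<open>auto intro!: d2\<close>)
  then obtain t where t: "0 < t" "t < h" "pd a g ((x + s *\<^sub>R a) + h *\<^sub>R b) - pd a g (x + s *\<^sub>R a)
      = h * pd b (pd a g) ((x + s *\<^sub>R a) + t *\<^sub>R b)" by auto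
  have "g (x + h *\<^sub>R a + h *\<^sub>R b) - g (x + h *\<^sub>R a) - g (x + h *\<^sub>R b) + g x = \<phi> h - \<phi> 0"
    by (simp add: \<phi>_def add_ac)
  also have "\<dots> = h\<^sup>2 * pd b (pd a g) (x + s *\<^sub>R a + t *\<^sub>R b)"
    unfolding s(3) using t(3) by (simp add: add_ac power2_eq_square)
  finally show ?thesis using s t by (intro exI[of _ s] exI[of _ t]) auto
qed

text \<open>If the two values at x differed, continuity would keep the mixed derivatives apart on a
  small parallelogram, yet the second difference, symmetric in a and b, forces them to agree at some
  pair of points there.\<close>

lemma pd_commute:
  assumes U: "open U" "x \<in> U" and g: "C_open 2 U g"
  shows "pd a (pd b g) x = pd b (pd a g) x"
proof (rule ccontr)
  let ?P = "pd b (pd a g)" and ?Q = "pd a (pd b g)"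
  assume ne: "?Q x \<noteq> ?P x"
  define \<epsilon> where "\<epsilon> = \<bar>?Q x - ?P x\<bar> / 2"
  have \<epsilon>: "\<epsilon> > 0" using ne by (simp add: \<epsilon>_def)
  have g': "C_open (Suc 1) U g" using g by (simp add: numeral_2_eq_2)
  have "C_open 0 U ?P" "C_open 0 U ?Q"
    using g' by (auto intro!: C_open_pd U simp del: C_open.simps simp: One_nat_def)
  then have cont: "isCont ?P x" "isCont ?Q x" using U by (auto simp: continuous_on_eq_continuous_at)
  obtain d where d: "d > 0" "\<And>y. dist y x < d \<Longrightarrow> \<bar>?P y - ?P x\<bar> < \<epsilon>" "\<And>y. dist y x < d \<Longrightarrow> \<bar>?Q y - ?Q x\<bar> < \<epsilon>"
    "\<And>y. dist y x < d \<Longrightarrow> y \<in> U"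
  proof -
    obtain d1 where "d1 > 0" "\<And>y. dist y x < d1 \<Longrightarrow> \<bar>?P y - ?P x\<bar> < \<epsilon>"
      using cont(1) \<epsilon> unfolding continuous_at_eps_delta dist_real_def by blast
    moreover obtain d2 where "d2 > 0" "\<And>y. dist y x < d2 \<Longrightarrow> \<bar>?Q y - ?Q x\<bar> < \<epsilon>"
      using cont(2) \<epsilon> unfolding continuous_at_eps_delta dist_real_def by blast
    moreover obtain d3 where "d3 > 0" "\<And>y. dist y x < d3 \<Longrightarrow> y \<in> U"
      using U by (auto simp: open_dist)
    ultimately show ?thesis using that[of "min d1 (min d2 d3)"] by auto
  qed
  \<comment> \<open>Small enough for the parallelogram spanned by h a and h b to lie in the ball of
    radius d; the added 1 keeps the denominator positive.\<close>
  define h where "h = d / 2 / (norm a + norm b + 1)"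
  have np: "norm a + norm b + 1 > 0" by (simp add: add_nonneg_pos)
  have h: "h > 0" using d np by (simp add: h_def)
  have near: "dist (x + s *\<^sub>R a + t *\<^sub>R b) x < d" if "0 \<le> s" "s \<le> h" "0 \<le> t" "t \<le> h" for s t
  proof -
    have "norm (s *\<^sub>R a + t *\<^sub>R b) \<le> s * norm a + t * norm b"
      using that norm_triangle_ineq[of "s *\<^sub>R a" "t *\<^sub>R b"] by simp
    also have "\<dots> \<le> h * norm a + h * norm b" using that by (intro add_mono mult_right_mono) auto
    also have "\<dots> \<le> h * (norm a + norm b + 1)" using h by (simp add: algebra_simps)
    also have "\<dots> = d / 2" unfolding h_def by (rule nonzero_eq_divide_eq[THEN iffD1]) (use np in auto)
    also have "\<dots> < d" using d by simp
    finally show ?thesis by (simp add: dist_norm add.assoc)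
  qed
  obtain s t where st: "0 \<le> s" "s \<le> h" "0 \<le> t" "t \<le> h"
    "g (x + h *\<^sub>R a + h *\<^sub>R b) - g (x + h *\<^sub>R a) - g (x + h *\<^sub>R b) + g x = h\<^sup>2 * ?P (x + s *\<^sub>R a + t *\<^sub>R b)"
    using second_difference_mean_value[OF U(1) g h, of x a b] d(4) near by blast
  obtain s' t' where st': "0 \<le> s'" "s' \<le> h" "0 \<le> t'" "t' \<le> h"
    "g (x + h *\<^sub>R b + h *\<^sub>R a) - g (x + h *\<^sub>R b) - g (x + h *\<^sub>R a) + g x = h\<^sup>2 * ?Q (x + s' *\<^sub>R b + t' *\<^sub>R a)"
  proof -
    have "x + s *\<^sub>R b + t *\<^sub>R a \<in> U" if "0 \<le> s" "s \<le> h" "0 \<le> t" "t \<le> h" for s t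
      using d(4)[OF near[of t s]] that by (simp add: add_ac)
    then show ?thesis using second_difference_mean_value[OF U(1) g h, of x b a] that by blast
  qed
  have "h\<^sup>2 * ?P (x + s *\<^sub>R a + t *\<^sub>R b) = h\<^sup>2 * ?Q (x + t' *\<^sub>R a + s' *\<^sub>R b)"
    unfolding st(5)[symmetric] using st'(5) by (simp add: add_ac algebra_simps)
  then have "?P (x + s *\<^sub>R a + t *\<^sub>R b) = ?Q (x + t' *\<^sub>R a + s' *\<^sub>R b)" using h by simp
  moreover have "\<bar>?P (x + s *\<^sub>R a + t *\<^sub>R b) - ?P x\<bar> < \<epsilon>" "\<bar>?Q (x + t' *\<^sub>R a + s' *\<^sub>R b) - ?Q x\<bar> < \<epsilon>"
    using d(2,3) near st st' by auto
  ultimately have "\<bar>?Q x - ?P x\<bar> < 2 * \<epsilon>" by (simp add: abs_if split: if_splits)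
  then show False by (simp add: \<epsilon>_def)
qed

lemma pd_commute3:
  assumes U: "open U" "x \<in> U" and g: "C_open 3 U g"
  shows "pd d (pd e (pd e g)) x = pd e (pd e (pd d g)) x"
proof -
  have g2: "C_open 2 U g" by (rule C_open_mono[OF g]) simp
  have g1: "C_open 2 U (pd e g)"
    by (rule C_open_pd[OF U(1)]) (rule C_open_mono[OF g], simp)
  have "pd d (pd e (pd e g)) x = pd e (pd d (pd e g)) x" by (rule pd_commute[OF U g1])
  also have "\<dots> = pd e (pd e (pd d g)) x"
    by (rule pd_cong[OF U]) (rule pd_commute[OF U(1) _ g2])
  finally show ?thesis .
qed

lemma pd_commute4:
  assumes U: "open U" "x \<in> U" and g: "C_open 4 U g"
  shows "pd d (pd d (pd e (pd e g))) x = pd e (pd e (pd d (pd d g))) x"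
proof -
  have g3: "C_open 3 U g" by (rule C_open_mono[OF g]) simp
  have g1: "C_open 3 U (pd d g)"
    by (rule C_open_pd[OF U(1)]) (rule C_open_mono[OF g], simp)
  have "pd d (pd d (pd e (pd e g))) x = pd d (pd e (pd e (pd d g))) x"
    by (rule pd_cong[OF U]) (rule pd_commute3[OF U(1) _ g3])
  also have "\<dots> = pd e (pd e (pd d (pd d g))) x" by (rule pd_commute3[OF U g1])
  finally show ?thesis .
qed

section \<open>Extremum conditions and the chain rule along curves\<close>

text \<open>The second derivative is taken at 0 only: if c were negative, \<open>\<phi>'\<close>
  would be negative just to the right of 0, and the mean value theorem would produce a smaller value
  there.\<close>

lemma second_derivative_test_min:
  fixes \<phi> \<phi>' :: "real \<Rightarrow> real"
  assumes \<delta>: "\<delta> > 0" and d1: "\<And>t. \<bar>t\<bar> < \<delta> \<Longrightarrow> (\<phi> has_real_derivative \<phi>' t) (at t)"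
    and d2: "(\<phi>' has_real_derivative c) (at 0)"
    and min: "\<And>t. \<bar>t\<bar> < \<delta> \<Longrightarrow> \<phi> 0 \<le> \<phi> t"
  shows "\<phi>' 0 = 0" "c \<ge> 0"
proof -
  show z: "\<phi>' 0 = 0"
    using DERIV_local_min[OF d1[of 0] \<delta>] \<delta> min by simp
  show "c \<ge> 0"
  proof (rule ccontr)
    assume "\<not> c \<ge> 0"
    then obtain d where d: "d > 0" "\<And>h. 0 < h \<Longrightarrow> h < d \<Longrightarrow> \<phi>' h < 0"
      using DERIV_neg_dec_right[OF d2] z by auto
    define h where "h = min d \<delta> / 2"
    have h: "0 < h" "h < d" "h < \<delta>" using d(1) \<delta> by (auto simp: h_def)
    have "\<exists>t. 0 < t \<and> t < h \<and> \<phi> h - \<phi> 0 = (h - 0) * \<phi>' t"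
      using h by (intro MVT2) (auto intro!: d1)
    then obtain t where "0 < t" "t < h" "\<phi> h - \<phi> 0 = h * \<phi>' t" by auto
    then have "\<phi> h < \<phi> 0" using mult_pos_neg[of h "\<phi>' t"] d(2)[of t] h by simp
    then show False using min[of h] h by simp
  qed
qed

lemma second_derivative_test_max:
  fixes \<phi> \<phi>' :: "real \<Rightarrow> real"
  assumes "\<delta> > 0" "\<And>t. \<bar>t\<bar> < \<delta> \<Longrightarrow> (\<phi> has_real_derivative \<phi>' t) (at t)"
    "(\<phi>' has_real_derivative c) (at 0)" "\<And>t. \<bar>t\<bar> < \<delta> \<Longrightarrow> \<phi> t \<le> \<phi> 0"
  shows "\<phi>' 0 = 0" "c \<le> 0"
  using second_derivative_test_min[of \<delta> "\<lambda>t. - \<phi> t" "\<lambda>t. - \<phi>' t" "- c"] assms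
  by (auto intro: DERIV_minus)

lemma open_contains_line:
  fixes x :: "'a::real_normed_vector"
  assumes "open U" "x \<in> U"
  obtains \<delta> where "\<delta> > 0" "\<And>t. \<bar>t\<bar> < \<delta> \<Longrightarrow> x + t *\<^sub>R e \<in> U"
proof -
  obtain r where r: "r > 0" "\<And>y. dist y x < r \<Longrightarrow> y \<in> U" using assms by (auto simp: open_dist)
  show ?thesis
  proof (rule that[of "r / (norm e + 1)"])
    show "r / (norm e + 1) > 0" using r(1) by (simp add: add_nonneg_pos)
    fix t assume "\<bar>t\<bar> < r / (norm e + 1)"
    then have "\<bar>t\<bar> * (norm e + 1) < r" by (simp add: pos_less_divide_eq add_nonneg_pos)
    then have "norm (t *\<^sub>R e) < r" by (simp add: distrib_left)
    then show "x + t *\<^sub>R e \<in> U" by (intro r(2)) (simp add: dist_norm)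
  qed
qed

lemma DERIV_curve:
  fixes c :: "real \<Rightarrow> 'v::euclidean_space"
  assumes "F differentiable (at (c t))" "(c has_vector_derivative c') (at t)"
  shows "((\<lambda>t. F (c t)) has_real_derivative pd c' F (c t)) (at t)"
proof -
  have "((\<lambda>t. F (c t)) has_derivative (\<lambda>h. pd (h *\<^sub>R c') F (c t))) (at t)"
    using has_derivative_compose[OF assms(2)[unfolded has_vector_derivative_def] has_derivative_pd[OF assms(1)]] .
  moreover have "pd (h *\<^sub>R c') F (c t) = pd c' F (c t) * h" for h
    using linear_frechet_derivative[OF assms(1)] by (simp add: pd_def linear_scale)
  ultimately show ?thesis by (simp add: has_field_derivative_def)
qed

lemma pd_abs_le:
  assumes "g differentiable (at x)"
  shows "\<bar>pd v g x\<bar> \<le> norm v * (\<Sum>b\<in>Basis. \<bar>pd b g x\<bar>)"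
proof -
  have "\<bar>pd v g x\<bar> \<le> (\<Sum>b\<in>Basis. \<bar>(v \<bullet> b) * pd b g x\<bar>)"
    by (subst pd_expansion[OF assms]) (rule sum_abs)
  also have "\<dots> \<le> (\<Sum>b\<in>Basis. norm v * \<bar>pd b g x\<bar>)"
    unfolding abs_mult by (intro sum_mono mult_right_mono Basis_le_norm) auto
  finally show ?thesis by (simp add: sum_distrib_left)
qed

text \<open>The second derivative of F(c(t)) is DF(c'') + D^2F(c', c'). The bounds use sums of
  absolute partial derivatives, since these are what the C^2 norm dominates.\<close>

lemma DERIV2_curve:
  fixes c c' :: "real \<Rightarrow> 'v::euclidean_space"
  assumes U: "open U" and F: "C_open 2 U F" and c0: "c 0 \<in> U"
    and d1: "(c has_vector_derivative c' 0) (at 0)"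
    and d2: "(c' has_vector_derivative c'') (at 0)"
    and b1: "(\<Sum>b\<in>Basis. \<bar>pd b F (c 0)\<bar>) \<le> M"
    and b2: "(\<Sum>b\<in>Basis. \<Sum>b'\<in>Basis. \<bar>pd b' (pd b F) (c 0)\<bar>) \<le> M"
  shows "\<exists>H. ((\<lambda>t. \<Sum>b\<in>Basis. (c' t \<bullet> b) * pd b F (c t)) has_real_derivative H) (at 0) \<and>
    \<bar>H\<bar> \<le> M * norm c'' + M * (norm (c' 0))\<^sup>2"
proof -
  have F': "C_open (Suc 1) U F" using F by (simp add: numeral_2_eq_2)
  have dif: "F differentiable (at (c 0))" by (rule C_open_differentiable[OF U F' c0])
  have dif2: "pd b F differentiable (at (c 0))" for b
    using C_open_differentiable[OF U _ c0, of 0 "pd b F"] C_open_pd[OF U F'] by simp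
  define H where "H = (\<Sum>b\<in>Basis. (c'' \<bullet> b) * pd b F (c 0) + (c' 0 \<bullet> b) * pd (c' 0) (pd b F) (c 0))"
  have "((\<lambda>t. c' t \<bullet> b) has_real_derivative c'' \<bullet> b) (at 0)" for b
    using bounded_linear.has_vector_derivative[OF bounded_linear_inner_left d2, of b]
    by (simp add: has_real_derivative_iff_has_vector_derivative)
  moreover have "((\<lambda>t. pd b F (c t)) has_real_derivative pd (c' 0) (pd b F) (c 0)) (at 0)" for b
    by (rule DERIV_curve[OF dif2 d1])
  ultimately have "((\<lambda>t. \<Sum>b\<in>Basis. (c' t \<bullet> b) * pd b F (c t)) has_real_derivative H) (at 0)"
    unfolding H_def by (intro DERIV_sum DERIV_mult'[THEN DERIV_cong]) (assumption, assumption, simp)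
  moreover have "\<bar>H\<bar> \<le> M * norm c'' + M * (norm (c' 0))\<^sup>2"
  proof -
    have "H = pd c'' F (c 0) + (\<Sum>b\<in>Basis. (c' 0 \<bullet> b) * pd (c' 0) (pd b F) (c 0))"
      by (simp add: H_def sum.distrib pd_expansion[OF dif, of c''])
    moreover have "\<bar>pd c'' F (c 0)\<bar> \<le> norm c'' * M"
      using pd_abs_le[OF dif, of c''] mult_left_mono[OF b1, of "norm c''"] by simp
    moreover have "\<bar>\<Sum>b\<in>Basis. (c' 0 \<bullet> b) * pd (c' 0) (pd b F) (c 0)\<bar> \<le> (norm (c' 0))\<^sup>2 * M"
    proof -
      have "\<bar>\<Sum>b\<in>Basis. (c' 0 \<bullet> b) * pd (c' 0) (pd b F) (c 0)\<bar> \<le> (\<Sum>b\<in>Basis. \<bar>(c' 0 \<bullet> b) * pd (c' 0) (pd b F) (c 0)\<bar>)"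
        by (rule sum_abs)
      also have "\<dots> \<le> (\<Sum>b\<in>Basis. norm (c' 0) * (norm (c' 0) * (\<Sum>b'\<in>Basis. \<bar>pd b' (pd b F) (c 0)\<bar>)))"
        unfolding abs_mult by (intro sum_mono mult_mono Basis_le_norm pd_abs_le dif2) auto
      also have "\<dots> = (norm (c' 0))\<^sup>2 * (\<Sum>b\<in>Basis. \<Sum>b'\<in>Basis. \<bar>pd b' (pd b F) (c 0)\<bar>)"
        by (simp add: sum_distrib_left power2_eq_square mult_ac)
      also have "\<dots> \<le> (norm (c' 0))\<^sup>2 * M" using b2 by (intro mult_left_mono) auto
      finally show ?thesis .
    qed
    ultimately show ?thesis by (simp add: mult.commute) 
  qed
  ultimately show ?thesis by blast
qed

section \<open>The estimate at an interior maximum\<close>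

text \<open>The algebra of the maximum principle, separated from the equation. The letters stand for
  \<zeta> = -u, p_i = u_i, \<open>lam\<close> the eigenvalues of the Hessian and R its norm, v =
  u_\<xi>\<xi> with derivatives \<open>vi\<close> and \<open>vii\<close>, and w i j = u_jii. The
  inequalities \<open>max\<close> are added with weights a_i; \<open>G\<close> and \<open>Q\<close>
  remove the other third and the fourth derivatives, and \<open>crit\<close> removes the gradient of
  v once a factor \<zeta> is available.\<close>

lemma pogorelov_core:
  fixes lam p a vi vii :: "'n::finite \<Rightarrow> real" and w :: "'n \<Rightarrow> 'n \<Rightarrow> real"
  assumes c: "0 < c" and a: "\<And>i. c \<le> a i" "\<And>i. a i \<le> C" and \<zeta>: "0 < \<zeta>" "\<zeta> \<le> K"
    and p: "\<And>i. \<bar>p i\<bar> \<le> K" and v: "\<bar>v\<bar> \<le> 4 * R" and R: "0 \<le> R" "R\<^sup>2 = (\<Sum>i\<in>UNIV. (lam i)\<^sup>2)"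
    and lam: "\<And>i. \<bar>lam i\<bar> \<le> R"
    and crit: "\<And>i. \<zeta> * vi i = p i * v - A * (p i * lam i)"
    and max: "\<And>i. - lam i * v - 2 * p i * vi i + \<zeta> * vii i + A * ((lam i)\<^sup>2 + (\<Sum>j\<in>UNIV. p j * w i j)) \<le> 0"
    and G: "\<And>j. \<bar>\<Sum>i\<in>UNIV. a i * w i j\<bar> \<le> C1 * (1 + R)"
    and Q: "(\<Sum>i\<in>UNIV. a i * vii i) \<ge> - (C2 * (1 + R\<^sup>2)) - C3 * (\<Sum>i\<in>UNIV. \<bar>vi i\<bar>)"
    and C: "0 \<le> C1" "0 \<le> C2" "0 \<le> C3" and A: "0 \<le> A" "A * c = 4 * n * C + K * C2 + c"
    and n: "n = real CARD('n)"
  shows "\<zeta> * R \<le> 1 + ((2 * C * K * (n * (4 + A) * K) + K * (C3 * (n * (4 + A) * K) + A * n * K * C1))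
     + K\<^sup>2 * (K * C2 + A * n * K * C1)) / c"
proof -
  define V where "V = (\<Sum>i\<in>UNIV. \<bar>vi i\<bar>)"
  define D where "D = n * (4 + A) * K"
  define B where "B = A * n * K * C1"
  define E1 where "E1 = 2 * C * K * D + K * (C3 * D + B)"
  define E0 where "E0 = K\<^sup>2 * (K * C2 + B)"
  have K: "0 < K" using \<zeta> by linarith
  have C_pos: "0 < C" using a[of undefined] c by linarith
  have n0: "0 \<le> n" using n by simp
  have D0: "0 \<le> D" and B0: "0 \<le> B" using n0 A K C by (auto simp: D_def B_def)
  have V: "0 \<le> V" unfolding V_def by (intro sum_nonneg) auto
  have "\<zeta> * \<bar>vi i\<bar> \<le> (4 + A) * K * R" for i
  proof -
    have "\<zeta> * \<bar>vi i\<bar> = \<bar>p i * v - A * (p i * lam i)\<bar>" using \<zeta> by (simp flip: crit add: abs_mult)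
    also have "\<dots> \<le> \<bar>p i\<bar> * \<bar>v\<bar> + A * (\<bar>p i\<bar> * \<bar>lam i\<bar>)"
      using abs_triangle_ineq4[of "p i * v" "A * (p i * lam i)"] A(1) by (simp add: abs_mult)
    also have "\<dots> \<le> K * (4 * R) + A * (K * R)"
      using p v lam A K R by (intro add_mono mult_mono mult_left_mono) auto
    finally show ?thesis by (simp add: algebra_simps)
  qed
  then have "(\<Sum>i\<in>UNIV. \<zeta> * \<bar>vi i\<bar>) \<le> n * ((4 + A) * K * R)"
    unfolding n using sum_bounded_above[of "UNIV :: 'n set" "\<lambda>i. \<zeta> * \<bar>vi i\<bar>"] by simp
  \<comment> \<open>\<open>crit\<close> controls the gradient of v only together with the factor
    \<zeta>, which may be small.\<close>
  then have VD: "\<zeta> * V \<le> D * R" by (simp add: V_def D_def sum_distrib_left mult_ac)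
  have "(\<Sum>i\<in>UNIV. a i * (- lam i * v - 2 * p i * vi i + \<zeta> * vii i + A * ((lam i)\<^sup>2 + (\<Sum>j\<in>UNIV. p j * w i j)))) \<le> 0"
    using max a c by (intro sum_nonpos mult_nonneg_nonpos) (auto intro: order_trans[of 0 c] less_imp_le)
  moreover have "(\<Sum>i\<in>UNIV. a i * (- lam i * v - 2 * p i * vi i + \<zeta> * vii i + A * ((lam i)\<^sup>2 + (\<Sum>j\<in>UNIV. p j * w i j))))
    = - v * (\<Sum>i\<in>UNIV. a i * lam i) - 2 * (\<Sum>i\<in>UNIV. a i * (p i * vi i)) + \<zeta> * (\<Sum>i\<in>UNIV. a i * vii i)
      + A * (\<Sum>i\<in>UNIV. a i * (lam i)\<^sup>2) + A * (\<Sum>j\<in>UNIV. p j * (\<Sum>i\<in>UNIV. a i * w i j))"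
  proof -
    have "(\<Sum>j\<in>UNIV. p j * (\<Sum>i\<in>UNIV. a i * w i j)) = (\<Sum>i\<in>UNIV. a i * (\<Sum>j\<in>UNIV. p j * w i j))"
      unfolding sum_distrib_left by (subst sum.swap) (simp add: mult_ac)
    then show ?thesis
      by (simp add: sum.distrib sum_subtractf sum_distrib_left algebra_simps sum_negf)
  qed
  moreover have "\<bar>v * (\<Sum>i\<in>UNIV. a i * lam i)\<bar> \<le> 4 * R * (n * (C * R))"
  proof -
    have "\<bar>\<Sum>i\<in>UNIV. a i * lam i\<bar> \<le> (\<Sum>i\<in>UNIV. \<bar>a i * lam i\<bar>)" by (rule sum_abs)
    also have "\<dots> \<le> n * (C * R)" unfolding n
      using a c lam R C_pos by (intro sum_bounded_above[THEN order_trans[OF _ eq_refl]])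
        (auto simp: abs_mult intro!: mult_mono intro: order_trans[of "\<bar>a _\<bar>" "a _"] simp: abs_of_nonneg[OF order_trans[OF less_imp_le[OF c] a(1)]])
    finally show ?thesis unfolding abs_mult using v R by (intro mult_mono) auto
  qed
  moreover have "\<bar>\<Sum>i\<in>UNIV. a i * (p i * vi i)\<bar> \<le> C * K * V"
  proof -
    have "\<bar>\<Sum>i\<in>UNIV. a i * (p i * vi i)\<bar> \<le> (\<Sum>i\<in>UNIV. \<bar>a i * (p i * vi i)\<bar>)" by (rule sum_abs)
    also have "\<dots> \<le> (\<Sum>i\<in>UNIV. C * (K * \<bar>vi i\<bar>))"
      unfolding abs_mult abs_of_nonneg[OF order_trans[OF less_imp_le[OF c] a(1)]]
      using a p C_pos K by (intro sum_mono mult_mono) auto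
    finally show ?thesis by (simp add: V_def sum_distrib_left mult_ac)
  qed
  moreover have "\<zeta> * (\<Sum>i\<in>UNIV. a i * vii i) \<ge> - (K * C2 * (1 + R\<^sup>2)) - C3 * (D * R)"
  proof -
    have "\<zeta> * (\<Sum>i\<in>UNIV. a i * vii i) \<ge> \<zeta> * (- (C2 * (1 + R\<^sup>2)) - C3 * V)"
      using Q \<zeta> by (intro mult_left_mono) (auto simp: V_def)
    moreover have "\<zeta> * (C2 * (1 + R\<^sup>2)) \<le> K * (C2 * (1 + R\<^sup>2))"
      using \<zeta> C by (intro mult_right_mono) auto
    moreover have "C3 * (\<zeta> * V) \<le> C3 * (D * R)" using VD C by (intro mult_left_mono)
    ultimately show ?thesis by (simp add: algebra_simps)
  qed
  moreover have "A * (\<Sum>i\<in>UNIV. a i * (lam i)\<^sup>2) \<ge> A * (c * R\<^sup>2)"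
    unfolding R(2) sum_distrib_left[of c] using a A by (intro mult_left_mono sum_mono mult_right_mono) auto
  moreover have "A * (\<Sum>j\<in>UNIV. p j * (\<Sum>i\<in>UNIV. a i * w i j)) \<ge> - (B * (1 + R))"
  proof -
    have "\<bar>\<Sum>j\<in>UNIV. p j * (\<Sum>i\<in>UNIV. a i * w i j)\<bar> \<le> (\<Sum>j\<in>UNIV. \<bar>p j * (\<Sum>i\<in>UNIV. a i * w i j)\<bar>)" by (rule sum_abs)
    also have "\<dots> \<le> n * (K * (C1 * (1 + R)))"
      unfolding n using p G K by (intro sum_bounded_above[THEN order_trans[OF _ eq_refl]])
        (auto simp: abs_mult intro!: mult_mono)
    finally have "A * \<bar>\<Sum>j\<in>UNIV. p j * (\<Sum>i\<in>UNIV. a i * w i j)\<bar> \<le> A * (n * (K * (C1 * (1 + R))))"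
      using A(1) by (rule mult_left_mono)
    moreover have "- (A * \<bar>\<Sum>j\<in>UNIV. p j * (\<Sum>i\<in>UNIV. a i * w i j)\<bar>) \<le> A * (\<Sum>j\<in>UNIV. p j * (\<Sum>i\<in>UNIV. a i * w i j))"
      using A(1) mult_left_mono[OF abs_ge_minus_self[of "\<Sum>j\<in>UNIV. p j * (\<Sum>i\<in>UNIV. a i * w i j)"] A(1)] by simp
    ultimately show ?thesis by (simp add: B_def mult_ac)
  qed
  ultimately have "A * (c * R\<^sup>2) \<le> 4 * R * (n * (C * R)) + 2 * (C * K * V) + K * C2 * (1 + R\<^sup>2) + C3 * (D * R) + B * (1 + R)"
    by (simp add: abs_le_iff)
  \<comment> \<open>The origin of A: 4 n C absorbs the product of v with the weighted sum of the
    eigenvalues, K C2 absorbs the quadratic part of \<open>Q\<close>, and c is what remains in front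
    of R^2.\<close>
  moreover have "A * (c * R\<^sup>2) = 4 * R * (n * (C * R)) + K * C2 * R\<^sup>2 + c * R\<^sup>2"
    using arg_cong[OF A(2), of "\<lambda>x. x * R\<^sup>2"] by (simp add: algebra_simps power2_eq_square)
  ultimately have main: "c * R\<^sup>2 \<le> 2 * C * K * V + K * C2 + C3 * D * R + B + B * R"
    by (simp add: algebra_simps)
  define Y where "Y = \<zeta> * R"
  have Y0: "0 \<le> Y" using \<zeta> R by (simp add: Y_def)
  \<comment> \<open>Multiplication by \<zeta>^2 gives V the factor that \<open>VD\<close> requires,
    with one \<zeta> left for R, and produces a quadratic inequality for Y.\<close>
  have "c * Y\<^sup>2 \<le> E1 * Y + E0"
  proof -
    have "c * Y\<^sup>2 = \<zeta>\<^sup>2 * (c * R\<^sup>2)" by (simp add: Y_def power_mult_distrib mult_ac)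
    also have "\<dots> \<le> \<zeta>\<^sup>2 * (2 * C * K * V + K * C2 + C3 * D * R + B + B * R)"
      by (intro mult_left_mono main) simp
    also have "\<dots> = 2 * C * K * (\<zeta> * (\<zeta> * V)) + \<zeta>\<^sup>2 * (K * C2 + B) + \<zeta> * ((C3 * D + B) * Y)"
      by (simp add: Y_def power2_eq_square algebra_simps)
    also have "\<dots> \<le> 2 * C * K * (\<zeta> * (D * R)) + K\<^sup>2 * (K * C2 + B) + K * ((C3 * D + B) * Y)"
      using VD \<zeta> C_pos K C B0 D0 Y0 by (intro add_mono mult_left_mono mult_right_mono power_mono) auto
    also have "\<dots> = E1 * Y + E0" by (simp add: E1_def E0_def Y_def algebra_simps)
    finally show ?thesis .
  qed
  moreover have E: "0 \<le> E1" "0 \<le> E0" using K C_pos C D0 B0 by (auto simp: E1_def E0_def)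
  ultimately have "Y \<le> 1 + (E1 + E0) / c"
  proof (cases "Y \<le> 1")
    case True
    moreover have "0 \<le> (E1 + E0) / c" using E c by simp
    ultimately show ?thesis by linarith
  next
    case False
    then have "E0 * 1 \<le> E0 * Y" using E by (intro mult_left_mono) auto
    then have "c * Y * Y \<le> (E1 + E0) * Y" using \<open>c * Y\<^sup>2 \<le> E1 * Y + E0\<close> by (simp add: power2_eq_square algebra_simps)
    then have "c * Y \<le> E1 + E0" using False by simp
    then have "Y \<le> (E1 + E0) / c" using c by (simp add: field_simps)
    then show ?thesis by linarith
  qed
  then show ?thesis by (simp add: Y_def E1_def E0_def D_def B_def)
qed

section \<open>Jets of the solution and their derivatives along lines\<close>

definition grad :: "(real^'n \<Rightarrow> real) \<Rightarrow> real^'n \<Rightarrow> real^'n" where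
  "grad u x = (\<chi> i. pd (axis i 1) u x)"

definition jet :: "(real^'n \<Rightarrow> real) \<Rightarrow> real^'n \<Rightarrow> (real^'n) \<times> real \<times> (real^'n)" where
  "jet u x = (x, u x, grad u x)"

lemma sum_Basis_axis:
  fixes h :: "real^'n \<Rightarrow> 'b::comm_monoid_add"
  shows "(\<Sum>b\<in>Basis. h b) = (\<Sum>i\<in>UNIV. h (axis i 1))"
proof -
  have "(Basis :: (real^'n) set) = range (\<lambda>i. axis i 1)" by (auto simp: Basis_vec_def)
  moreover have "inj (\<lambda>i::'n. axis i (1::real))" by (auto simp: inj_def axis_eq_axis)
  ultimately show ?thesis by (metis sum.reindex_cong)
qed

lemma pd_eq_inner_grad:
  assumes "u differentiable (at x)"
  shows "pd e u x = grad u x \<bullet> e"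
  by (subst pd_expansion[OF assms]) (simp add: sum_Basis_axis inner_axis, simp add: inner_vec_def grad_def mult.commute)

lemma inner_hess:
  assumes "open \<Omega>" "x \<in> \<Omega>" "C_open 2 \<Omega> u"
  shows "e \<bullet> (hess u x *v d) = pd d (pd e u) x"
proof -
  have "pd b u differentiable (at x)" for b
    using C_open_differentiable[OF assms(1) _ assms(2), of 0 "pd b u"] C_open_pd[OF assms(1), of "Suc 0" u b] assms(3)
    by (simp only: numeral_2_eq_2)
  then have "pd d (pd b u) x = (\<Sum>j\<in>UNIV. d $ j * pd (axis j 1) (pd b u) x)" for b
    by (subst pd_expansion) (simp_all add: sum_Basis_axis inner_axis)
  then show ?thesis
    by (subst pd_expansion2[OF assms])
      (simp add: sum_Basis_axis inner_axis, simp add: inner_vec_def matrix_vector_mult_def hess_def mult_ac)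
qed

lemma transpose_hess:
  assumes "open \<Omega>" "x \<in> \<Omega>" "C_open 2 \<Omega> u"
  shows "transpose (hess u x) = hess u x"
  using pd_commute[OF assms] by (simp add: transpose_def hess_def vec_eq_iff)

lemma has_vector_derivative_vec:
  fixes h :: "real \<Rightarrow> real^'n"
  assumes "\<And>i. ((\<lambda>t. h t $ i) has_real_derivative D $ i) (at t)"
  shows "(h has_vector_derivative D) (at t)"
  unfolding has_vector_derivative_def
proof (subst has_derivative_componentwise_within, intro ballI)
  fix b :: "real^'n" assume "b \<in> Basis"
  then obtain i where b: "b = axis i 1" by (auto simp: Basis_vec_def)
  show "((\<lambda>x. h x \<bullet> b) has_derivative (\<lambda>x. x *\<^sub>R D \<bullet> b)) (at t)"
    using assms[of i] by (simp add: b inner_axis has_field_derivative_def mult.commute[of _ "D $ i"])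
qed

lemma has_vector_derivative_Pair:
  assumes "(g has_vector_derivative g') (at t)" "(h has_vector_derivative h') (at t)"
  shows "((\<lambda>t. (g t, h t)) has_vector_derivative (g', h')) (at t)"
  using has_derivative_Pair[OF assms[unfolded has_vector_derivative_def]]
  by (simp add: has_vector_derivative_def)

lemma DERIV_line_C_open:
  assumes "open \<Omega>" "C_open (Suc k) \<Omega> g" "x + t *\<^sub>R d \<in> \<Omega>"
  shows "((\<lambda>t. g (x + t *\<^sub>R d)) has_real_derivative pd d g (x + t *\<^sub>R d)) (at t)"
  by (rule DERIV_line) (rule C_open_differentiable[OF assms])

lemma C_open_pds:
  assumes "open \<Omega>" "C_open 4 \<Omega> u"
  shows "C_open (Suc 3) \<Omega> u" "C_open (Suc 2) \<Omega> (pd d u)" "C_open (Suc 1) \<Omega> (pd d (pd d' u))"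
    "C_open (Suc 0) \<Omega> (pd d (pd d' (pd d'' u)))"
proof -
  show 1: "C_open (Suc 3) \<Omega> u" by (rule C_open_mono[OF assms(2)]) simp
  have 2: "C_open 3 \<Omega> (pd d u)" for d by (rule C_open_pd[OF assms(1) 1])
  then have 22: "C_open (Suc 2) \<Omega> (pd d u)" for d by (rule C_open_mono) simp
  then show "C_open (Suc 2) \<Omega> (pd d u)" .
  have "C_open 2 \<Omega> (pd d (pd d' u))" for d d' by (rule C_open_pd[OF assms(1) 22])
  then have 3: "C_open (Suc 1) \<Omega> (pd d (pd d' u))" for d d' by (rule C_open_mono) simp
  then show "C_open (Suc 1) \<Omega> (pd d (pd d' u))" .
  have "C_open 1 \<Omega> (pd d (pd d' (pd d'' u)))" by (rule C_open_pd[OF assms(1) 3])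
  then show "C_open (Suc 0) \<Omega> (pd d (pd d' (pd d'' u)))" by (rule C_open_mono) simp
qed

definition djet :: "real^'n \<Rightarrow> (real^'n \<Rightarrow> real) \<Rightarrow> real^'n \<Rightarrow> (real^'n) \<times> real \<times> (real^'n)" where
  "djet d u x = (d, pd d u x, \<chi> i. pd d (pd (axis i 1) u) x)"

lemma jet_line:
  assumes \<Omega>: "open \<Omega>" "C_open 4 \<Omega> u" "x + t *\<^sub>R d \<in> \<Omega>"
  shows "((\<lambda>t. jet u (x + t *\<^sub>R d)) has_vector_derivative djet d u (x + t *\<^sub>R d)) (at t)"
    and "((\<lambda>t. djet d u (x + t *\<^sub>R d)) has_vector_derivative
      (0, pd d (pd d u) (x + t *\<^sub>R d), \<chi> i. pd d (pd d (pd (axis i 1) u)) (x + t *\<^sub>R d))) (at t)"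
proof -
  have 0: "((\<lambda>t. x + t *\<^sub>R d) has_vector_derivative d) (at t)"
    by (auto intro!: derivative_eq_intros)
  note D = DERIV_line_C_open[OF \<Omega>(1) _ \<Omega>(3)]
  note C = C_open_pds[OF \<Omega>(1,2)]
  show "((\<lambda>t. jet u (x + t *\<^sub>R d)) has_vector_derivative djet d u (x + t *\<^sub>R d)) (at t)"
    unfolding jet_def djet_def grad_def
    by (intro has_vector_derivative_Pair 0 has_vector_derivative_vec)
      (simp_all add: D[OF C(1)] D[OF C(2)] flip: has_real_derivative_iff_has_vector_derivative)
  show "((\<lambda>t. djet d u (x + t *\<^sub>R d)) has_vector_derivative
      (0, pd d (pd d u) (x + t *\<^sub>R d), \<chi> i. pd d (pd d (pd (axis i 1) u)) (x + t *\<^sub>R d))) (at t)"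
    unfolding djet_def
    by (intro has_vector_derivative_Pair has_vector_derivative_const has_vector_derivative_vec)
      (simp_all add: D[OF C(2)] D[OF C(3)] flip: has_real_derivative_iff_has_vector_derivative)
qed

lemma orthonormal_norm: "orthonormal e \<Longrightarrow> norm (e i) = 1"
  by (simp add: orthonormal_def norm_eq_sqrt_inner)

lemma orthonormal_norm_le_sum:
  fixes e :: "'n \<Rightarrow> real^'n"
  assumes "orthonormal e"
  shows "norm x \<le> (\<Sum>i\<in>UNIV. \<bar>x \<bullet> e i\<bar>)"
proof -
  have "norm x = norm (\<Sum>i\<in>UNIV. (x \<bullet> e i) *\<^sub>R e i)" using orthonormal_expansion[OF assms, of x] by simp
  also have "\<dots> \<le> (\<Sum>i\<in>UNIV. norm ((x \<bullet> e i) *\<^sub>R e i))" by (rule norm_sum)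
  finally show ?thesis using orthonormal_norm[OF assms] by simp
qed

text \<open>Here T bounds \<tau>, M / m bounds Df / f, and 2 (1 + K) (1 + R) bounds the velocity of
  the jet. This constant and the next two belong to the weighted third derivatives relative to 1 +
  R, to the lower-order part of the weighted fourth derivatives relative to 1 + R^2, and to the
  gradient of u_\<xi>\<xi>.\<close>

definition grad_const :: "real \<Rightarrow> real \<Rightarrow> real \<Rightarrow> real \<Rightarrow> real" where
  "grad_const T K M m = T * (M * (2 * (1 + K)) / m)"

definition hess_const :: "real \<Rightarrow> real \<Rightarrow> real \<Rightarrow> real \<Rightarrow> real" where
  "hess_const T K M m = T * ((4 * M + 8 * M * (1 + K)\<^sup>2) / m + 8 * M\<^sup>2 * (1 + K)\<^sup>2 / m\<^sup>2)"

definition third_const :: "real \<Rightarrow> real \<Rightarrow> real \<Rightarrow> real" where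
  "third_const T M m = T * M / m"

locale interior_maximum =
  fixes \<Omega> :: "(real^'n) set" and u :: "real^'n \<Rightarrow> real" and f :: "(real^'n) \<times> real \<times> (real^'n) \<Rightarrow> real"
    and x0 :: "real^'n" and e :: "'n \<Rightarrow> real^'n" and lam a :: "'n \<Rightarrow> real"
    and \<tau> c C T K M m A :: real and \<xi> :: "real^'n"
  assumes open_\<Omega>: "open \<Omega>" and u: "C_open 4 \<Omega> u" and f: "C_open 2 (\<Omega> \<times> UNIV \<times> UNIV) f"
    and f_pos: "\<And>x. x \<in> \<Omega> \<Longrightarrow> 0 < f (jet u x)"
    and x0: "x0 \<in> \<Omega>" "u x0 < 0"
    and e: "orthonormal e" and lam: "\<And>i. hess u x0 *v e i = lam i *\<^sub>R e i"
    and c: "0 < c" and a: "\<And>i. c \<le> a i" "\<And>i. a i \<le> C" and \<tau>: "0 < \<tau>" "\<tau> \<le> T"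
    and min: "\<And>x. x \<in> \<Omega> \<Longrightarrow> \<tau> * (ln (f (jet u x)) - ln (f (jet u x0)))
      \<le> (\<Sum>i\<in>UNIV. a i * (e i \<bullet> (hess u x *v e i))) - (\<Sum>i\<in>UNIV. a i * (e i \<bullet> (hess u x0 *v e i)))"
    and max: "\<And>x. x \<in> \<Omega> \<Longrightarrow> u x < 0 \<Longrightarrow>
      - u x * pd \<xi> (pd \<xi> u) x + A / 2 * (norm (grad u x))\<^sup>2
      \<le> - u x0 * pd \<xi> (pd \<xi> u) x0 + A / 2 * (norm (grad u x0))\<^sup>2"
    and K: "- u x0 \<le> K" "norm (grad u x0) \<le> K" and m: "0 < m" "m \<le> f (jet u x0)"
    and M: "(\<Sum>b\<in>Basis. \<bar>pd b f (jet u x0)\<bar>) \<le> M"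
      "(\<Sum>b\<in>Basis. \<Sum>b'\<in>Basis. \<bar>pd b' (pd b f) (jet u x0)\<bar>) \<le> M"
    and \<xi>: "norm \<xi> \<le> 2"
begin

definition R :: real where "R = sqrt (\<Sum>i\<in>UNIV. (lam i)\<^sup>2)"
definition V :: real where "V = (\<Sum>i\<in>UNIV. \<bar>pd (e i) (pd \<xi> (pd \<xi> u)) x0\<bar>)"

lemmas C = C_open_pds[OF open_\<Omega> u]

lemma u2: "C_open 2 \<Omega> u" by (rule C_open_mono[OF u]) simp

lemma u_differentiable: "x \<in> \<Omega> \<Longrightarrow> u differentiable (at x)"
  by (rule C_open_differentiable[OF open_\<Omega> C(1)])

lemma R: "0 \<le> R" "R\<^sup>2 = (\<Sum>i\<in>UNIV. (lam i)\<^sup>2)"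
  by (auto simp: R_def intro!: sum_nonneg)

lemma lam_sq_le: "(lam i)\<^sup>2 \<le> R\<^sup>2"
  unfolding R(2) by (rule member_le_sum) auto

lemma lam_le: "\<bar>lam i\<bar> \<le> R"
  using lam_sq_le[of i] R(1) by (simp add: abs_le_square_iff[symmetric])

text \<open>\<open>R\<close> is the Frobenius norm of the Hessian, written with its eigenvalues, and
  dominates the operator norm.\<close>

lemma norm_hess_mult: "norm (hess u x0 *v d) \<le> R * norm d"
proof (rule power2_le_imp_le)
  let ?H = "hess u x0"
  have t: "transpose ?H = ?H" by (rule transpose_hess[OF open_\<Omega> x0(1) u2])
  have "(?H *v d) \<bullet> e i = lam i * (d \<bullet> e i)" for i
    using symmetric_inner_commute[OF t, of d "e i"] by (simp add: lam)
  then have "(norm (?H *v d))\<^sup>2 = (\<Sum>i\<in>UNIV. (lam i)\<^sup>2 * (d \<bullet> e i)\<^sup>2)"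
    unfolding power2_norm_eq_inner orthonormal_parseval[OF e, of "?H *v d" "?H *v d"] by (simp add: power2_eq_square mult_ac)
  also have "\<dots> \<le> (\<Sum>i\<in>UNIV. R\<^sup>2 * (d \<bullet> e i)\<^sup>2)" by (intro sum_mono mult_right_mono lam_sq_le) auto
  also have "\<dots> = (R * norm d)\<^sup>2"
    unfolding power_mult_distrib power2_norm_eq_inner orthonormal_parseval[OF e, of d d]
    by (simp add: sum_distrib_left power2_eq_square)
  finally show "(norm (?H *v d))\<^sup>2 \<le> (R * norm d)\<^sup>2" .
qed (simp add: R(1))

lemma pd2_le: "\<bar>pd d (pd d u) x0\<bar> \<le> R * (norm d)\<^sup>2"
proof -
  have "\<bar>pd d (pd d u) x0\<bar> \<le> norm d * norm (hess u x0 *v d)"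
    unfolding inner_hess[OF open_\<Omega> x0(1) u2, symmetric] by (rule Cauchy_Schwarz_ineq2)
  also have "\<dots> \<le> norm d * (R * norm d)" by (intro mult_left_mono norm_hess_mult) auto
  finally show ?thesis by (simp add: power2_eq_square mult_ac)
qed

lemma v_le: "\<bar>pd \<xi> (pd \<xi> u) x0\<bar> \<le> 4 * R"
proof -
  have "(norm \<xi>)\<^sup>2 \<le> 2\<^sup>2" using \<xi> by (intro power_mono) auto
  then have "R * (norm \<xi>)\<^sup>2 \<le> R * 4" using R(1) by (intro mult_left_mono) auto
  then show ?thesis using pd2_le[of \<xi>] by simp
qed

lemma K_nonneg: "0 < K" using K(1) x0(2) by linarith

lemma M_nonneg: "0 \<le> M" using M(1) by (rule order_trans[rotated]) (auto intro: sum_nonneg)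

lemma pd_le: "\<bar>pd d u x0\<bar> \<le> K * norm d"
proof -
  have "\<bar>pd d u x0\<bar> \<le> norm (grad u x0) * norm d"
    unfolding pd_eq_inner_grad[OF u_differentiable[OF x0(1)]] by (rule Cauchy_Schwarz_ineq2)
  also have "\<dots> \<le> K * norm d" using K(2) by (intro mult_right_mono) auto
  finally show ?thesis .
qed

lemma norm_djet_le:
  assumes "norm d \<le> 2"
  shows "norm (djet d u x0) \<le> 2 * (1 + K) * (1 + R)"
proof -
  have "(\<chi> i. pd d (pd (axis i 1) u) x0) = hess u x0 *v d"
  proof -
    have "pd d (pd (axis i 1) u) x0 = (hess u x0 *v d) $ i" for i
      using inner_hess[OF open_\<Omega> x0(1) u2, of "axis i 1" d] by (simp add: inner_axis' )
    then show ?thesis by (simp add: vec_eq_iff)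
  qed
  then have "norm (djet d u x0) \<le> norm d + (\<bar>pd d u x0\<bar> + norm (hess u x0 *v d))"
    using norm_Pair_le[of d "(pd d u x0, hess u x0 *v d)"] norm_Pair_le[of "pd d u x0" "hess u x0 *v d"]
    by (simp add: djet_def)
  also have "\<dots> \<le> norm d * (1 + K + R)"
    using pd_le[of d] norm_hess_mult[of d] by (simp add: algebra_simps)
  also have "\<dots> \<le> 2 * (1 + K + R)" using assms R(1) K_nonneg by (intro mult_right_mono) auto
  also have "\<dots> \<le> 2 * (1 + K) * (1 + R)" using R(1) K_nonneg by (simp add: algebra_simps)
  finally show ?thesis .
qed

text \<open>By commutation, the third derivatives produced by ln f form the gradient of
  u_\<xi>\<xi>; they are measured by V and so fall under the critical point equation.\<close>

lemma norm_ddjet_le: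
  "norm (0 :: real^'n, pd \<xi> (pd \<xi> u) x0, \<chi> i. pd \<xi> (pd \<xi> (pd (axis i 1) u)) x0) \<le> 4 * R + V"
proof -
  let ?v = "pd \<xi> (pd \<xi> u)"
  have g: "(\<chi> i. pd \<xi> (pd \<xi> (pd (axis i 1) u)) x0) = grad ?v x0"
    using pd_commute3[OF open_\<Omega> x0(1), of u _ \<xi>] C_open_mono[OF u, of 3] by (simp add: grad_def vec_eq_iff)
  have d: "?v differentiable (at x0)" by (rule C_open_differentiable[OF open_\<Omega> C(3) x0(1)])
  have "norm (grad ?v x0) \<le> (\<Sum>i\<in>UNIV. \<bar>grad ?v x0 \<bullet> e i\<bar>)" by (rule orthonormal_norm_le_sum[OF e])
  also have "\<dots> = V" by (simp add: V_def pd_eq_inner_grad[OF d])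
  finally have "norm (grad ?v x0) \<le> V" .
  then show ?thesis
    using norm_Pair_le[of "0 :: real^'n" "(?v x0, grad ?v x0)"] norm_Pair_le[of "?v x0" "grad ?v x0"] v_le
    by (simp add: g)
qed

text \<open>Here \<open>\<gamma>\<close> is the logarithmic derivative of f(x, u, Du) along the line
  and H its second derivative before taking logarithms. The former is at most linear in R, the
  latter at most quadratic in R and linear in third derivatives of u.\<close>

lemma ln_f_line:
  assumes d: "norm d \<le> 2"
  shows "\<exists>\<delta>>0. \<exists>\<gamma> H. (\<forall>t. \<bar>t\<bar> < \<delta> \<longrightarrow> x0 + t *\<^sub>R d \<in> \<Omega> \<and>
      ((\<lambda>t. ln (f (jet u (x0 + t *\<^sub>R d)))) has_real_derivative \<gamma> t) (at t)) \<and>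
    \<bar>\<gamma> 0\<bar> \<le> M * (2 * (1 + K) * (1 + R)) / m \<and>
    (\<gamma> has_real_derivative (H / f (jet u x0) - (\<gamma> 0)\<^sup>2)) (at 0) \<and>
    \<bar>H\<bar> \<le> M * norm (0 :: real^'n, pd d (pd d u) x0, \<chi> i. pd d (pd d (pd (axis i 1) u)) x0) + M * (2 * (1 + K) * (1 + R))\<^sup>2"
proof -
  obtain \<delta> where \<delta>: "\<delta> > 0" "\<And>t. \<bar>t\<bar> < \<delta> \<Longrightarrow> x0 + t *\<^sub>R d \<in> \<Omega>"
    using open_contains_line[OF open_\<Omega> x0(1), of d] by blast
  let ?U = "\<Omega> \<times> UNIV \<times> UNIV"
  have oU: "open ?U" using open_\<Omega> by (intro open_Times) auto
  have f': "C_open (Suc 1) ?U f" by (rule C_open_mono[OF f]) simp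
  have jU: "jet u x \<in> ?U" if "x \<in> \<Omega>" for x using that by (simp add: jet_def)
  have fd: "f differentiable (at (jet u x))" if "x \<in> \<Omega>" for x
    by (rule C_open_differentiable[OF oU f' jU[OF that]])
  define J where "J t = jet u (x0 + t *\<^sub>R d)" for t
  define J' where "J' t = djet d u (x0 + t *\<^sub>R d)" for t
  define \<gamma>1 where "\<gamma>1 t = (\<Sum>b\<in>Basis. (J' t \<bullet> b) * pd b f (J t))" for t
  define \<gamma> where "\<gamma> t = \<gamma>1 t / f (J t)" for t
  have D1: "((\<lambda>t. f (J t)) has_real_derivative \<gamma>1 t) (at t)" if t: "\<bar>t\<bar> < \<delta>" for t
  proof -
    have "((\<lambda>t. f (J t)) has_real_derivative pd (J' t) f (J t)) (at t)"
      by (rule DERIV_curve) (use fd[OF \<delta>(2)[OF t]] jet_line(1)[OF open_\<Omega> u \<delta>(2)[OF t]] in \<open>auto simp: J_def J'_def\<close>)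
    then show ?thesis using fd[OF \<delta>(2)[OF t]] by (subst (asm) pd_expansion) (simp_all add: J_def \<gamma>1_def)
  qed
  have pos: "f (J t) > 0" if "\<bar>t\<bar> < \<delta>" for t using f_pos[OF \<delta>(2)[OF that]] by (simp add: J_def)
  have ln: "((\<lambda>t. ln (f (J t))) has_real_derivative \<gamma> t) (at t)" if t: "\<bar>t\<bar> < \<delta>" for t
    using DERIV_chain2[OF DERIV_ln_divide[OF pos[OF t]] D1[OF t]] by (simp add: \<gamma>_def)
  have J0: "J 0 = jet u x0" "J' 0 = djet d u x0" by (simp_all add: J_def J'_def)
  have x0': "x0 + 0 *\<^sub>R d \<in> \<Omega>" using x0 by simp
  obtain H where H: "(\<gamma>1 has_real_derivative H) (at 0)"
    "\<bar>H\<bar> \<le> M * norm (0 :: real^'n, pd d (pd d u) x0, \<chi> i. pd d (pd d (pd (axis i 1) u)) x0) + M * (norm (J' 0))\<^sup>2"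
  proof -
    have 1: "(J has_vector_derivative J' 0) (at 0)"
      "(J' has_vector_derivative (0, pd d (pd d u) x0, \<chi> i. pd d (pd d (pd (axis i 1) u)) x0)) (at 0)"
      using jet_line[OF open_\<Omega> u x0'] by (simp_all add: J_def[abs_def] J'_def[abs_def])
    have "J 0 \<in> ?U" using jU[OF x0(1)] by (simp add: J0)
    from DERIV2_curve[OF oU f this 1] M that show ?thesis
      unfolding \<gamma>1_def[abs_def] J0 by blast
  qed
  have f0: "f (J 0) > 0" using pos[of 0] \<delta>(1) by simp
  have D\<gamma>: "(\<gamma> has_real_derivative (H / f (jet u x0) - (\<gamma> 0)\<^sup>2)) (at 0)"
  proof -
    have "((\<lambda>t. \<gamma>1 t / f (J t)) has_real_derivative (H * f (J 0) - \<gamma>1 0 * \<gamma>1 0) / (f (J 0) * f (J 0))) (at 0)"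
      by (rule DERIV_divide[OF H(1) D1]) (use \<delta>(1) f0 in auto)
    moreover have "(H * f (J 0) - \<gamma>1 0 * \<gamma>1 0) / (f (J 0) * f (J 0)) = H / f (J 0) - (\<gamma> 0)\<^sup>2"
      using f0 by (simp add: \<gamma>_def field_simps power2_eq_square)
    ultimately show ?thesis unfolding \<gamma>_def[abs_def] by (simp add: J0)
  qed
  have "\<bar>\<gamma>1 0\<bar> \<le> norm (djet d u x0) * (\<Sum>b\<in>Basis. \<bar>pd b f (jet u x0)\<bar>)"
  proof -
    have "\<gamma>1 0 = pd (djet d u x0) f (jet u x0)"
      by (subst pd_expansion[OF fd[OF x0(1)]]) (simp add: \<gamma>1_def J0)
    then show ?thesis using pd_abs_le[OF fd[OF x0(1)]] by simp
  qed
  also have "\<dots> \<le> (2 * (1 + K) * (1 + R)) * M"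
    using norm_djet_le[OF d] M(1) K_nonneg R(1) by (intro mult_mono sum_nonneg) auto
  finally have "\<bar>\<gamma>1 0\<bar> \<le> M * (2 * (1 + K) * (1 + R))" by (simp add: mult_ac)
  then have "\<bar>\<gamma>1 0\<bar> / f (jet u x0) \<le> M * (2 * (1 + K) * (1 + R)) / m"
    using m M_nonneg K_nonneg R(1) by (intro frac_le) auto
  then have "\<bar>\<gamma> 0\<bar> \<le> M * (2 * (1 + K) * (1 + R)) / m"
    using f0 by (simp add: \<gamma>_def J0)
  moreover have "\<bar>H\<bar> \<le> M * norm (0 :: real^'n, pd d (pd d u) x0, \<chi> i. pd d (pd d (pd (axis i 1) u)) x0) + M * (2 * (1 + K) * (1 + R))\<^sup>2"
  proof -
    have "M * (norm (J' 0))\<^sup>2 \<le> M * (2 * (1 + K) * (1 + R))\<^sup>2"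
      unfolding J0 using norm_djet_le[OF d] M_nonneg by (intro mult_left_mono power_mono) auto
    then show ?thesis using H(2) by linarith
  qed
  ultimately show ?thesis
    using \<delta> ln D\<gamma> by (intro exI[of _ \<delta>] conjI exI[of _ \<gamma>] exI[of _ H]) (auto simp: J_def)
qed

text \<open>\<open>x0\<close> minimises \<open>\<Sum>\<^sub>i a\<^sub>i u\<^sub>i\<^sub>i - \<tau> ln f(x, u, Du)\<close>; this replaces differentiating the equation.\<close>

lemma min_line:
  assumes d: "norm d \<le> 2"
  shows "\<bar>\<Sum>i\<in>UNIV. a i * pd d (pd (e i) (pd (e i) u)) x0\<bar> \<le> T * (M * (2 * (1 + K) * (1 + R)) / m)"
    and "\<exists>H. (\<Sum>i\<in>UNIV. a i * pd d (pd d (pd (e i) (pd (e i) u))) x0)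
        \<ge> \<tau> * (H / f (jet u x0) - (M * (2 * (1 + K) * (1 + R)) / m)\<^sup>2) \<and>
      \<bar>H\<bar> \<le> M * norm (0 :: real^'n, pd d (pd d u) x0, \<chi> i. pd d (pd d (pd (axis i 1) u)) x0) + M * (2 * (1 + K) * (1 + R))\<^sup>2"
proof -
  obtain \<delta> \<gamma> H where \<delta>: "\<delta> > 0" "\<And>t. \<bar>t\<bar> < \<delta> \<Longrightarrow> x0 + t *\<^sub>R d \<in> \<Omega>"
    and ln: "\<And>t. \<bar>t\<bar> < \<delta> \<Longrightarrow> ((\<lambda>t. ln (f (jet u (x0 + t *\<^sub>R d)))) has_real_derivative \<gamma> t) (at t)"
    and \<gamma>0: "\<bar>\<gamma> 0\<bar> \<le> M * (2 * (1 + K) * (1 + R)) / m"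
    and D\<gamma>: "(\<gamma> has_real_derivative (H / f (jet u x0) - (\<gamma> 0)\<^sup>2)) (at 0)"
    and H: "\<bar>H\<bar> \<le> M * norm (0 :: real^'n, pd d (pd d u) x0, \<chi> i. pd d (pd d (pd (axis i 1) u)) x0) + M * (2 * (1 + K) * (1 + R))\<^sup>2"
    using ln_f_line[OF d] by blast
  define \<phi> where "\<phi> t = (\<Sum>i\<in>UNIV. a i * pd (e i) (pd (e i) u) (x0 + t *\<^sub>R d)) - \<tau> * ln (f (jet u (x0 + t *\<^sub>R d)))" for t
  define \<phi>' where "\<phi>' t = (\<Sum>i\<in>UNIV. a i * pd d (pd (e i) (pd (e i) u)) (x0 + t *\<^sub>R d)) - \<tau> * \<gamma> t" for t
  define \<phi>'' where "\<phi>'' = (\<Sum>i\<in>UNIV. a i * pd d (pd d (pd (e i) (pd (e i) u))) (x0 + 0 *\<^sub>R d)) - \<tau> * (H / f (jet u x0) - (\<gamma> 0)\<^sup>2)"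
  have z: "x0 + 0 *\<^sub>R d \<in> \<Omega>" using x0 by simp
  have D1: "(\<phi> has_real_derivative \<phi>' t) (at t)" if t: "\<bar>t\<bar> < \<delta>" for t
    unfolding \<phi>_def[abs_def] \<phi>'_def
    by (intro DERIV_diff DERIV_sum DERIV_cmult ln[OF t] DERIV_line_C_open[OF open_\<Omega> C(3) \<delta>(2)[OF t]])
  have D2: "(\<phi>' has_real_derivative \<phi>'') (at 0)"
    unfolding \<phi>'_def[abs_def] \<phi>''_def
    by (intro DERIV_diff DERIV_sum DERIV_cmult D\<gamma> DERIV_line_C_open[OF open_\<Omega> C(4) z])
  have mn: "\<phi> 0 \<le> \<phi> t" if t: "\<bar>t\<bar> < \<delta>" for t
    using min[OF \<delta>(2)[OF t]] unfolding inner_hess[OF open_\<Omega> \<delta>(2)[OF t] u2] inner_hess[OF open_\<Omega> x0(1) u2]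
    by (simp add: \<phi>_def right_diff_distrib)
  have "\<phi>' 0 = 0" "\<phi>'' \<ge> 0" using second_derivative_test_min[OF \<delta>(1) D1 D2 mn] by auto
  then have 1: "(\<Sum>i\<in>UNIV. a i * pd d (pd (e i) (pd (e i) u)) x0) = \<tau> * \<gamma> 0"
    and 2: "(\<Sum>i\<in>UNIV. a i * pd d (pd d (pd (e i) (pd (e i) u))) x0) \<ge> \<tau> * (H / f (jet u x0) - (\<gamma> 0)\<^sup>2)"
    by (simp_all add: \<phi>'_def \<phi>''_def)
  show "\<bar>\<Sum>i\<in>UNIV. a i * pd d (pd (e i) (pd (e i) u)) x0\<bar> \<le> T * (M * (2 * (1 + K) * (1 + R)) / m)"
    unfolding 1 abs_mult using \<tau> \<gamma>0 by (intro mult_mono) auto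
  have "(\<gamma> 0)\<^sup>2 \<le> (M * (2 * (1 + K) * (1 + R)) / m)\<^sup>2"
    using power_mono[OF \<gamma>0, of 2] by simp
  then have "\<tau> * (H / f (jet u x0) - (M * (2 * (1 + K) * (1 + R)) / m)\<^sup>2) \<le> \<tau> * (H / f (jet u x0) - (\<gamma> 0)\<^sup>2)"
    using \<tau> by (intro mult_left_mono) auto
  then show "\<exists>H. (\<Sum>i\<in>UNIV. a i * pd d (pd d (pd (e i) (pd (e i) u))) x0)
        \<ge> \<tau> * (H / f (jet u x0) - (M * (2 * (1 + K) * (1 + R)) / m)\<^sup>2) \<and>
      \<bar>H\<bar> \<le> M * norm (0 :: real^'n, pd d (pd d u) x0, \<chi> i. pd d (pd d (pd (axis i 1) u)) x0) + M * (2 * (1 + K) * (1 + R))\<^sup>2"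
    using 2 H by (intro exI[of _ H]) auto
qed

abbreviation "C1 \<equiv> grad_const T K M m"
abbreviation "C2 \<equiv> hess_const T K M m"
abbreviation "C3 \<equiv> third_const T M m"

lemma T_pos: "0 < T" using \<tau> by linarith

lemma C123_nonneg: "0 \<le> C1" "0 \<le> C2" "0 \<le> C3"
  using T_pos M_nonneg K_nonneg m(1) by (simp_all add: grad_const_def hess_const_def third_const_def)

text \<open>The first-order condition along an eigenvector, commuted so that e_j is innermost: the
  form in which |Du|^2 produces third derivatives.\<close>

lemma first_order: "\<bar>\<Sum>i\<in>UNIV. a i * pd (e i) (pd (e i) (pd (e j) u)) x0\<bar> \<le> C1 * (1 + R)"
proof -
  have "pd (e j) (pd (e i) (pd (e i) u)) x0 = pd (e i) (pd (e i) (pd (e j) u)) x0" for i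
    by (rule pd_commute3[OF open_\<Omega> x0(1) C_open_mono[OF u]]) simp
  then show ?thesis
    using min_line(1)[of "e j"] orthonormal_norm[OF e] by (simp add: grad_const_def mult_ac)
qed

text \<open>The second-order condition along \<xi>, commuted so that the weighted operator acts on
  u_\<xi>\<xi>. Terms linear in R are absorbed in 1 + R^2, and V is the only third-order quantity
  left.\<close>

lemma second_order:
  "(\<Sum>i\<in>UNIV. a i * pd (e i) (pd (e i) (pd \<xi> (pd \<xi> u))) x0) \<ge> - (C2 * (1 + R\<^sup>2)) - C3 * V"
proof -
  have comm: "pd \<xi> (pd \<xi> (pd (e i) (pd (e i) u))) x0 = pd (e i) (pd (e i) (pd \<xi> (pd \<xi> u))) x0" for i
    by (rule pd_commute4[OF open_\<Omega> x0(1) u])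
  let ?B = "2 * (1 + K) * (1 + R)"
  obtain H where H: "(\<Sum>i\<in>UNIV. a i * pd (e i) (pd (e i) (pd \<xi> (pd \<xi> u))) x0) \<ge> \<tau> * (H / f (jet u x0) - (M * ?B / m)\<^sup>2)"
    "\<bar>H\<bar> \<le> M * norm (0 :: real^'n, pd \<xi> (pd \<xi> u) x0, \<chi> i. pd \<xi> (pd \<xi> (pd (axis i 1) u)) x0) + M * ?B\<^sup>2"
    using min_line(2)[OF \<xi>] unfolding comm by blast
  have V0: "0 \<le> V" unfolding V_def by (intro sum_nonneg) auto
  have "0 \<le> (1 - R)\<^sup>2" by simp
  then have R2: "(1 + R)\<^sup>2 \<le> 2 * (1 + R\<^sup>2)" and R1: "R \<le> 1 + R\<^sup>2"
    using R(1) zero_le_power2[of "R - 1/2"] by (simp_all add: power2_eq_square algebra_simps)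
  have B2: "?B\<^sup>2 \<le> 8 * (1 + K)\<^sup>2 * (1 + R\<^sup>2)"
  proof -
    have "?B\<^sup>2 = 4 * (1 + K)\<^sup>2 * (1 + R)\<^sup>2" by (simp only: power_mult_distrib) simp
    also have "\<dots> \<le> 4 * (1 + K)\<^sup>2 * (2 * (1 + R\<^sup>2))" by (intro mult_left_mono R2) simp
    also have "\<dots> = 8 * (1 + K)\<^sup>2 * (1 + R\<^sup>2)" by (simp add: algebra_simps)
    finally show ?thesis .
  qed
  have "\<bar>H\<bar> \<le> M * (4 * R + V) + M * ?B\<^sup>2"
    using H(2) mult_left_mono[OF norm_ddjet_le M_nonneg] by linarith
  also have "\<dots> \<le> M * (4 * (1 + R\<^sup>2) + V) + M * (8 * (1 + K)\<^sup>2 * (1 + R\<^sup>2))"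
    using R1 B2 M_nonneg by (intro add_mono mult_left_mono) auto
  finally have H': "\<bar>H\<bar> \<le> (4 * M + 8 * M * (1 + K)\<^sup>2) * (1 + R\<^sup>2) + M * V"
    by (simp add: algebra_simps)
  then have "\<bar>H\<bar> / f (jet u x0) \<le> ((4 * M + 8 * M * (1 + K)\<^sup>2) * (1 + R\<^sup>2) + M * V) / m"
    using m by (intro frac_le) (auto intro: order_trans[OF abs_ge_zero])
  moreover have "- (\<bar>H\<bar> / f (jet u x0)) \<le> H / f (jet u x0)"
    using m by (simp add: field_simps)
  moreover have "(M * ?B / m)\<^sup>2 \<le> 8 * M\<^sup>2 * (1 + K)\<^sup>2 / m\<^sup>2 * (1 + R\<^sup>2)"
  proof -
    have "(M * ?B / m)\<^sup>2 = M\<^sup>2 / m\<^sup>2 * ?B\<^sup>2" by (simp only: power_mult_distrib power_divide) simp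
    also have "\<dots> \<le> M\<^sup>2 / m\<^sup>2 * (8 * (1 + K)\<^sup>2 * (1 + R\<^sup>2))" using B2 by (intro mult_left_mono) auto
    finally show ?thesis by (simp add: mult_ac)
  qed
  moreover define X where "X = ((4 * M + 8 * M * (1 + K)\<^sup>2) / m + 8 * M\<^sup>2 * (1 + K)\<^sup>2 / m\<^sup>2) * (1 + R\<^sup>2) + M / m * V"
  ultimately have "- X \<le> H / f (jet u x0) - (M * ?B / m)\<^sup>2"
    by (simp add: add_divide_distrib distrib_right)
  then have "\<tau> * (- X) \<le> \<tau> * (H / f (jet u x0) - (M * ?B / m)\<^sup>2)" using \<tau> by (intro mult_left_mono) auto
  moreover have "\<tau> * X \<le> T * X"
    using \<tau> M_nonneg K_nonneg m(1) V0 R(1) by (intro mult_right_mono) (auto simp: X_def)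
  moreover have "T * X = C2 * (1 + R\<^sup>2) + C3 * V"
    by (simp add: X_def hess_const_def third_const_def algebra_simps)
  ultimately show ?thesis using H(1) by linarith
qed

text \<open>Restriction to lines inside the open set where u < 0. With |Du|^2 expanded in the
  eigenbasis, the Hessian is diagonal at x0, so the derivative along e_i meets a single
  eigenvalue.\<close>

lemma max_line:
  fixes i :: 'n
  defines "v \<equiv> pd \<xi> (pd \<xi> u)"
  shows "- u x0 * pd (e i) v x0 = pd (e i) u x0 * v x0 - A * (pd (e i) u x0 * lam i)" (is ?crit)
    and "- lam i * v x0 - 2 * pd (e i) u x0 * pd (e i) v x0 + - u x0 * pd (e i) (pd (e i) v) x0
      + A * ((lam i)\<^sup>2 + (\<Sum>j\<in>UNIV. pd (e j) u x0 * pd (e i) (pd (e i) (pd (e j) u)) x0)) \<le> 0" (is ?sec)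
proof -
  let ?d = "e i"
  let ?L = "\<lambda>t. x0 + t *\<^sub>R ?d"
  have o: "open (\<Omega> \<inter> u -` {..<0})"
    using C_open_continuous[OF u] open_\<Omega> by (intro continuous_open_preimage) auto
  have "x0 \<in> \<Omega> \<inter> u -` {..<0}" using x0 by simp
  then obtain \<delta> where \<delta>: "\<delta> > 0" "\<And>t. \<bar>t\<bar> < \<delta> \<Longrightarrow> ?L t \<in> \<Omega> \<inter> u -` {..<0}"
    using open_contains_line[OF o, of x0 ?d] by blast
  then have L: "?L t \<in> \<Omega>" "u (?L t) < 0" if "\<bar>t\<bar> < \<delta>" for t using that by auto
  define p where "p j = pd (e j) u" for j
  define \<phi> where "\<phi> t = - u (?L t) * v (?L t) + A / 2 * (\<Sum>j\<in>UNIV. (p j (?L t))\<^sup>2)" for t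
  define \<phi>' where "\<phi>' t = - (pd ?d u (?L t) * v (?L t) + u (?L t) * pd ?d v (?L t))
    + A * (\<Sum>j\<in>UNIV. p j (?L t) * pd ?d (p j) (?L t))" for t
  define \<phi>'' where "\<phi>'' = - (pd ?d (pd ?d u) (?L 0) * v (?L 0) + 2 * (pd ?d u (?L 0) * pd ?d v (?L 0)) + u (?L 0) * pd ?d (pd ?d v) (?L 0))
    + A * (\<Sum>j\<in>UNIV. (pd ?d (p j) (?L 0))\<^sup>2 + p j (?L 0) * pd ?d (pd ?d (p j)) (?L 0))"
  note D = DERIV_line_C_open[OF open_\<Omega> _ L(1)]
  have D1: "(\<phi> has_real_derivative \<phi>' t) (at t)" if t: "\<bar>t\<bar> < \<delta>" for t
    unfolding \<phi>_def[abs_def] \<phi>'_def v_def p_def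
    by (rule derivative_eq_intros D[OF C(1) t] D[OF C(2) t] D[OF C(3) t] refl)+
      (simp add: sum_distrib_left algebra_simps)
  have z: "\<bar>0 :: real\<bar> < \<delta>" using \<delta>(1) by simp
  have D2: "(\<phi>' has_real_derivative \<phi>'') (at 0)"
    unfolding \<phi>'_def[abs_def] \<phi>''_def v_def p_def
    by (rule derivative_eq_intros D[OF C(1) z] D[OF C(2) z] D[OF C(3) z] D[OF C(4) z] refl)+
      (simp add: sum_distrib_left algebra_simps power2_eq_square)
  have g: "(norm (grad u x))\<^sup>2 = (\<Sum>j\<in>UNIV. (p j x)\<^sup>2)" if "x \<in> \<Omega>" for x
    unfolding power2_norm_eq_inner orthonormal_parseval[OF e, of "grad u x" "grad u x"] p_def
    by (simp add: pd_eq_inner_grad[OF u_differentiable[OF that]] power2_eq_square)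
  have mx: "\<phi> t \<le> \<phi> 0" if t: "\<bar>t\<bar> < \<delta>" for t
    using max[OF L[OF t]] g[OF L(1)[OF t]] g[OF x0(1)] by (simp add: \<phi>_def v_def)
  have r: "\<phi>' 0 = 0" "\<phi>'' \<le> 0" using second_derivative_test_max[OF \<delta>(1) D1 D2 mx] by auto
  have pp: "pd ?d (p j) x0 = (if j = i then lam i else 0)" for j
    unfolding p_def inner_hess[OF open_\<Omega> x0(1) u2, symmetric] lam using e by (simp add: orthonormal_def)
  then have "pd ?d (pd ?d u) x0 = lam i" using pp[of i] by (simp add: p_def)
  moreover have "(\<Sum>j\<in>UNIV. p j x0 * pd ?d (p j) x0) = p i x0 * lam i"
    by (simp add: pp if_distrib cong: if_cong)
  moreover have "(\<Sum>j\<in>UNIV. (pd ?d (p j) x0)\<^sup>2 + p j x0 * pd ?d (pd ?d (p j)) x0)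
      = (lam i)\<^sup>2 + (\<Sum>j\<in>UNIV. p j x0 * pd ?d (pd ?d (p j)) x0)"
    by (simp add: sum.distrib pp if_distrib[of "\<lambda>x. x\<^sup>2"] cong: if_cong)
  ultimately show ?crit ?sec using r by (simp_all add: \<phi>'_def \<phi>''_def p_def algebra_simps)
qed

lemma estimate:
  assumes A: "0 \<le> A" "A * c = 4 * n * C + K * C2 + c" and n: "n = real CARD('n)"
  shows "- u x0 * R \<le> 1 + ((2 * C * K * (n * (4 + A) * K) + K * (C3 * (n * (4 + A) * K) + A * n * K * C1))
     + K\<^sup>2 * (K * C2 + A * n * K * C1)) / c"
proof (rule pogorelov_core[where lam = lam and a = a and p = "\<lambda>i. pd (e i) u x0" and v = "pd \<xi> (pd \<xi> u) x0"
      and vi = "\<lambda>i. pd (e i) (pd \<xi> (pd \<xi> u)) x0" and vii = "\<lambda>i. pd (e i) (pd (e i) (pd \<xi> (pd \<xi> u))) x0"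
      and w = "\<lambda>i j. pd (e i) (pd (e i) (pd (e j) u)) x0"])
  show "\<bar>pd (e i) u x0\<bar> \<le> K" for i using pd_le[of "e i"] orthonormal_norm[OF e] by simp
  show "- (C2 * (1 + R\<^sup>2)) - C3 * (\<Sum>i\<in>UNIV. \<bar>pd (e i) (pd \<xi> (pd \<xi> u)) x0\<bar>)
      \<le> (\<Sum>i\<in>UNIV. a i * pd (e i) (pd (e i) (pd \<xi> (pd \<xi> u))) x0)"
    using second_order by (simp add: V_def)
qed (use c a x0 K v_le R lam_le max_line first_order C123_nonneg A n in auto)

end

section \<open>The Dirichlet problem\<close>

lemma pd_cl_eq: "x \<in> U \<Longrightarrow> pd_cl U b g x = pd b g x"
  by (simp add: pd_cl_def)

lemma pd_pd_cl_eq: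
  assumes "open U" "x \<in> U"
  shows "pd_cl U d (pd_cl U b g) x = pd d (pd b g) x"
  unfolding pd_cl_eq[OF assms(2)] by (rule pd_cong[OF assms]) (rule pd_cl_eq)

lemma C_closed_imp_C_open:
  assumes "open U" "C_closed k U g"
  shows "C_open k U g"
  using assms(2)
proof (induction k arbitrary: g)
  case 0
  then show ?case using closure_subset by (auto intro: continuous_on_subset)
next
  case (Suc k)
  have "C_open k U (pd b g)" if "b \<in> Basis" for b
  proof -
    have "C_open k U (pd_cl U b g)" using Suc that by auto
    then show ?thesis by (rule C_open_cong[OF assms(1), THEN iffD1, rotated]) (rule pd_cl_eq)
  qed
  then show ?case using Suc.prems closure_subset by (auto intro: continuous_on_subset)
qed

lemma C_closed_2D:
  assumes "C_closed 2 U g"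
  shows "continuous_on (closure U) g"
    and "b \<in> Basis \<Longrightarrow> continuous_on (closure U) (pd_cl U b g)"
    and "b \<in> Basis \<Longrightarrow> b' \<in> Basis \<Longrightarrow> continuous_on (closure U) (pd_cl U b' (pd_cl U b g))"
  using assms by (simp_all add: numeral_2_eq_2)

lemma abs_le_SUP_abs:
  fixes g :: "'a::topological_space \<Rightarrow> real"
  assumes "compact K" "continuous_on K g" "y \<in> K"
  shows "\<bar>g y\<bar> \<le> (SUP x\<in>K. \<bar>g x\<bar>)"
proof (rule cSUP_upper[OF assms(3)])
  have "compact ((\<lambda>x. \<bar>g x\<bar>) ` K)" using assms by (intro compact_continuous_image continuous_intros)
  then show "bdd_above ((\<lambda>x. \<bar>g x\<bar>) ` K)" by (intro bounded_imp_bdd_above compact_imp_bounded)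
qed

text \<open>The suprema in \<open>C_norm\<close> are genuine upper bounds because K is compact and
  the derivatives extend continuously to the closure of U.\<close>

lemma C_norm_1_bounds:
  assumes K: "compact K" "K \<subseteq> closure U" "y \<in> K" and g: "C_closed 2 U g"
  shows "\<bar>g y\<bar> \<le> C_norm 1 U K g" "(\<Sum>b\<in>Basis. \<bar>pd_cl U b g y\<bar>) \<le> C_norm 1 U K g"
proof -
  have b0: "\<bar>g y\<bar> \<le> (SUP x\<in>K. \<bar>g x\<bar>)"
    by (rule abs_le_SUP_abs[OF K(1) continuous_on_subset[OF C_closed_2D(1)[OF g] K(2)] K(3)])
  have b1: "\<bar>pd_cl U b g y\<bar> \<le> (SUP x\<in>K. \<bar>pd_cl U b g x\<bar>)" if "b \<in> Basis" for b
    by (rule abs_le_SUP_abs[OF K(1) continuous_on_subset[OF C_closed_2D(2)[OF g that] K(2)] K(3)])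
  have N: "C_norm 1 U K g = (SUP x\<in>K. \<bar>g x\<bar>) + (\<Sum>b\<in>Basis. (SUP x\<in>K. \<bar>pd_cl U b g x\<bar>))"
    by simp
  have s: "(\<Sum>b\<in>Basis. \<bar>pd_cl U b g y\<bar>) \<le> (\<Sum>b\<in>Basis. (SUP x\<in>K. \<bar>pd_cl U b g x\<bar>))"
    by (intro sum_mono b1)
  have "0 \<le> (\<Sum>b\<in>Basis. \<bar>pd_cl U b g y\<bar>)" by (intro sum_nonneg) simp
  then show "\<bar>g y\<bar> \<le> C_norm 1 U K g" "(\<Sum>b\<in>Basis. \<bar>pd_cl U b g y\<bar>) \<le> C_norm 1 U K g"
    using b0 s unfolding N by linarith+
qed

lemma C_norm_2_bounds:
  assumes K: "compact K" "K \<subseteq> closure U" "y \<in> K" and g: "C_closed 2 U g" and U: "open U" "y \<in> U"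
  shows "\<bar>g y\<bar> \<le> C_norm 2 U K g" "(\<Sum>b\<in>Basis. \<bar>pd b g y\<bar>) \<le> C_norm 2 U K g"
    "(\<Sum>b\<in>Basis. \<Sum>b'\<in>Basis. \<bar>pd b' (pd b g) y\<bar>) \<le> C_norm 2 U K g"
proof -
  let ?s = "\<lambda>h. SUP x\<in>K. \<bar>h x\<bar>"
  have b0: "\<bar>g y\<bar> \<le> ?s g"
    by (rule abs_le_SUP_abs[OF K(1) continuous_on_subset[OF C_closed_2D(1)[OF g] K(2)] K(3)])
  have b1: "\<bar>pd_cl U b g y\<bar> \<le> ?s (pd_cl U b g)" if "b \<in> Basis" for b
    by (rule abs_le_SUP_abs[OF K(1) continuous_on_subset[OF C_closed_2D(2)[OF g that] K(2)] K(3)])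
  have b2: "\<bar>pd_cl U b' (pd_cl U b g) y\<bar> \<le> ?s (pd_cl U b' (pd_cl U b g))" if "b \<in> Basis" "b' \<in> Basis" for b b'
    by (rule abs_le_SUP_abs[OF K(1) continuous_on_subset[OF C_closed_2D(3)[OF g that] K(2)] K(3)])
  have N: "C_norm 2 U K g = ?s g + ((\<Sum>b\<in>Basis. ?s (pd_cl U b g)) + (\<Sum>b\<in>Basis. \<Sum>b'\<in>Basis. ?s (pd_cl U b' (pd_cl U b g))))"
    by (simp add: numeral_2_eq_2 sum.distrib)
  have s1: "(\<Sum>b\<in>Basis. \<bar>pd b g y\<bar>) \<le> (\<Sum>b\<in>Basis. ?s (pd_cl U b g))"
    using b1 by (intro sum_mono) (simp add: pd_cl_eq U)
  have s2: "(\<Sum>b\<in>Basis. \<Sum>b'\<in>Basis. \<bar>pd b' (pd b g) y\<bar>) \<le> (\<Sum>b\<in>Basis. \<Sum>b'\<in>Basis. ?s (pd_cl U b' (pd_cl U b g)))"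
    using b2 by (intro sum_mono) (simp add: pd_pd_cl_eq U)
  have "0 \<le> (\<Sum>b\<in>Basis. \<bar>pd b g y\<bar>)" "0 \<le> (\<Sum>b\<in>Basis. \<Sum>b'\<in>Basis. \<bar>pd b' (pd b g) y\<bar>)"
    by (intro sum_nonneg; simp)+
  then show "\<bar>g y\<bar> \<le> C_norm 2 U K g" "(\<Sum>b\<in>Basis. \<bar>pd b g y\<bar>) \<le> C_norm 2 U K g"
    "(\<Sum>b\<in>Basis. \<Sum>b'\<in>Basis. \<bar>pd b' (pd b g) y\<bar>) \<le> C_norm 2 U K g"
    using b0 s1 s2 unfolding N by linarith+
qed

text \<open>Each lambda_i occurs in n - 1 of the entries of eta.\<close>

lemma esym_1_eta_of:
  fixes v :: "real^'n"
  shows "esym 1 (eta_of v) = (real CARD('n) - 1) * (\<Sum>i\<in>UNIV. v $ i)"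
proof -
  have "esym 1 (eta_of v) = (\<Sum>i\<in>UNIV. 1 * eta_of v $ i)"
    using esym_eq_es[of 1 "eta_of v"] sum_mult_es[of UNIV "($) (eta_of v)" 0] by simp
  also have "\<dots> = (\<Sum>i\<in>UNIV. (\<Sum>j\<in>UNIV - {i}. 1) * v $ i)" by (rule sum_eta_of)
  finally show ?thesis by (simp add: sum_distrib_left of_nat_diff)
qed

lemma norm_matrix_le:
  fixes H :: "real^'n^'n"
  assumes "\<And>i j. \<bar>H $ i $ j\<bar> \<le> B"
  shows "norm H \<le> (real CARD('n))\<^sup>2 * B"
proof -
  have "norm H \<le> (\<Sum>i\<in>UNIV. norm (H $ i))" by (simp add: norm_vec_def L2_set_le_sum)
  also have "\<dots> \<le> (\<Sum>i\<in>(UNIV::'n set). \<Sum>j\<in>(UNIV::'n set). \<bar>H $ i $ j\<bar>)" by (intro sum_mono norm_le_l1_cart)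
  also have "\<dots> \<le> (\<Sum>i\<in>(UNIV::'n set). \<Sum>j\<in>(UNIV::'n set). B)" by (intro sum_mono assms)
  finally show ?thesis by (simp add: power2_eq_square)
qed

locale hessian_quotient_problem =
  fixes k l :: int and \<alpha> :: real and \<Omega> :: "(real^'n) set"
    and f :: "(real^'n) \<times> real \<times> (real^'n) \<Rightarrow> real" and u :: "real^'n \<Rightarrow> real" and m :: real
  assumes kl: "0 \<le> l" "l < k" "k < int CARD('n)" and \<alpha>: "0 \<le> \<alpha>" and \<Omega>: "bounded_domain \<Omega>"
    and f: "C_closed 2 (\<Omega> \<times> UNIV \<times> UNIV) f" and f_pos: "\<forall>x\<in>closure \<Omega>. \<forall>z p. f (x, z, p) > 0"
    and u4: "C_open 4 \<Omega> u" and u2: "C_closed 2 \<Omega> u" and adm: "admissible (k - 1) \<Omega> u"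
    and eqn: "\<forall>x\<in>\<Omega>. (esym k (eta u x) + \<alpha> * esym (k - 1) (eta u x)) /
               (esym l (eta u x) + \<alpha> * esym (l - 1) (eta u x)) = f (x, u x, grad_cl \<Omega> u x)"
    and bdry: "\<forall>x\<in>frontier \<Omega>. u x = 0"
    and m: "m > 0" "\<forall>x\<in>closure \<Omega>. m \<le> f (x, u x, grad_cl \<Omega> u x)"
begin

abbreviation "K \<equiv> norm_u \<Omega> u"
abbreviation "M \<equiv> norm_f \<Omega> u f"

lemma open_\<Omega>: "open \<Omega>" and compact_\<Omega>: "compact (closure \<Omega>)"
  using \<Omega> by (auto simp: bounded_domain_def compact_closure)

lemma u_C_open_2: "C_open 2 \<Omega> u" by (rule C_open_mono[OF u4]) simp

lemma grad_cl_eq: "x \<in> \<Omega> \<Longrightarrow> grad_cl \<Omega> u x = grad u x"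
  by (simp add: grad_cl_def grad_def pd_cl_eq)

lemma u_le: "x \<in> closure \<Omega> \<Longrightarrow> \<bar>u x\<bar> \<le> K"
  unfolding norm_u_def by (rule C_norm_1_bounds(1)[OF compact_\<Omega> order_refl _ u2])

lemma grad_cl_le: "x \<in> closure \<Omega> \<Longrightarrow> norm (grad_cl \<Omega> u x) \<le> K"
  using norm_le_l1_cart[of "grad_cl \<Omega> u x"] C_norm_1_bounds(2)[OF compact_\<Omega> order_refl _ u2, of x]
  by (simp add: norm_u_def sum_Basis_axis grad_cl_def)

lemma f_bounds:
  assumes "x \<in> \<Omega>"
  shows "f (jet u x) \<le> M" "(\<Sum>b\<in>Basis. \<bar>pd b f (jet u x)\<bar>) \<le> M"
    "(\<Sum>b\<in>Basis. \<Sum>b'\<in>Basis. \<bar>pd b' (pd b f) (jet u x)\<bar>) \<le> M"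
proof -
  let ?K = "{(x, z, p :: real^'n). x \<in> closure \<Omega> \<and> \<bar>z\<bar> \<le> K \<and> norm p \<le> K}"
  let ?U = "\<Omega> \<times> (UNIV :: real set) \<times> (UNIV :: (real^'n) set)"
  have x: "x \<in> closure \<Omega>" using assms closure_subset by blast
  have eq: "?K = closure \<Omega> \<times> cball 0 K \<times> cball 0 K" by auto
  have 1: "compact ?K" unfolding eq by (intro compact_Times compact_\<Omega> compact_cball)
  have 2: "?K \<subseteq> closure ?U" by (auto simp: closure_Times)
  have 3: "jet u x \<in> ?K" using u_le[OF x] grad_cl_le[OF x] x by (simp add: jet_def grad_cl_eq assms)
  have 4: "open ?U" "jet u x \<in> ?U" using open_\<Omega> assms by (auto intro!: open_Times simp: jet_def)
  note b = C_norm_2_bounds[OF 1 2 3 f 4]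
  show "f (jet u x) \<le> M" using b(1) by (simp add: norm_f_def)
  show "(\<Sum>b\<in>Basis. \<bar>pd b f (jet u x)\<bar>) \<le> M" using b(2) by (simp add: norm_f_def)
  show "(\<Sum>b\<in>Basis. \<Sum>b'\<in>Basis. \<bar>pd b' (pd b f) (jet u x)\<bar>) \<le> M" using b(3) by (simp add: norm_f_def)
qed

lemma f_jet:
  assumes "x \<in> \<Omega>"
  shows "0 < f (jet u x)" "m \<le> f (jet u x)"
proof -
  have x: "x \<in> closure \<Omega>" using assms closure_subset by blast
  then show "m \<le> f (jet u x)" using m(2) by (simp add: jet_def flip: grad_cl_eq[OF assms])
  then show "0 < f (jet u x)" using m(1) by linarith
qed

lemma garding_jet:
  assumes "x \<in> \<Omega>"
  shows "with_alpha \<alpha> (eigenvalues (hess u x)) \<in> garding (nat k) UNIV"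
    "es_quotient (nat k) (nat l) UNIV (with_alpha \<alpha> (eigenvalues (hess u x))) = f (jet u x)"
proof -
  have a: "esym i (eta_of (eigenvalues (hess u x))) > 0" if "i \<in> {1..k - 1}" for i
    using adm that assms by (simp add: admissible_def eta_def)
  have e: "(esym k (eta_of (eigenvalues (hess u x))) + \<alpha> * esym (k - 1) (eta_of (eigenvalues (hess u x)))) /
      (esym l (eta_of (eigenvalues (hess u x))) + \<alpha> * esym (l - 1) (eta_of (eigenvalues (hess u x)))) = f (jet u x)"
    using eqn assms by (simp add: eta_def jet_def grad_cl_eq)
  show "with_alpha \<alpha> (eigenvalues (hess u x)) \<in> garding (nat k) UNIV"
    "es_quotient (nat k) (nat l) UNIV (with_alpha \<alpha> (eigenvalues (hess u x))) = f (jet u x)"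
    by (rule garding_of_equation[OF kl(1,2) \<alpha> a e f_jet(1)[OF assms]]; assumption)+
qed

lemma trace_hess:
  assumes "x \<in> \<Omega>"
  shows "esym 1 (eta u x) = (real CARD('n) - 1) * (\<Sum>i\<in>UNIV. pd (axis i 1) (pd (axis i 1) u) x)"
  using trace_eq_sum_eigenvalues[OF is_eigenvalues_eigenvalues[OF transpose_hess[OF open_\<Omega> assms u_C_open_2]]]
  unfolding eta_def esym_1_eta_of by (simp add: trace_def hess_def)

text \<open>For \<open>k = 1\<close> the equation reads \<open>(n - 1) \<Delta>u + \<alpha> = f\<close>, and \<open>\<Delta>u \<ge> 0\<close> at a minimum of \<open>u\<close> bounds \<open>\<alpha>\<close>.\<close>

lemma laplacian_ge:
  assumes x: "x \<in> \<Omega>" "u x < 0"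
  shows "- M \<le> (\<Sum>i\<in>UNIV. pd (axis i 1) (pd (axis i 1) u) x)"
proof -
  let ?L = "\<lambda>x. \<Sum>i\<in>UNIV. pd (axis i 1) (pd (axis i 1) u) x"
  have n: "1 \<le> real CARD('n) - 1" using kl by linarith
  have M0: "0 \<le> M" using f_bounds(1)[OF x(1)] f_jet(1)[OF x(1)] by linarith
  have "- M \<le> (real CARD('n) - 1) * ?L x"
  proof (cases "k = 1")
    case False
    \<comment> \<open>For k >= 2 admissibility already makes the Laplacian positive.\<close>
    then have "esym 1 (eta u x) > 0" using adm kl x(1) by (simp add: admissible_def)
    then show ?thesis using trace_hess[OF x(1)] M0 by linarith
  next
    case True
    have E: "(real CARD('n) - 1) * ?L y + \<alpha> = f (jet u y)" if "y \<in> \<Omega>" for y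
    proof -
      have l: "l = 0" using True kl by simp
      have "esym 0 (eta u y) = 1" using esym_eq_es[of 0 "eta u y"] by simp
      moreover have "esym (- 1) (eta u y) = 0" by (simp add: esym_def)
      ultimately show ?thesis
        using eqn[rule_format, OF that] trace_hess[OF that] unfolding True l by (simp add: jet_def grad_cl_eq[OF that])
    qed
    obtain y where y: "y \<in> closure \<Omega>" "\<And>z. z \<in> closure \<Omega> \<Longrightarrow> u y \<le> u z"
      using continuous_attains_inf[OF compact_\<Omega> _ C_closed_2D(1)[OF u2]] x(1) closure_subset by blast
    \<comment> \<open>The zero boundary values force the minimum point into the interior, where the
      equation and the sign of the Laplacian give \<alpha> <= f <= M.\<close>
    have "u y < 0" using y(2)[of x] x closure_subset by force
    then have y\<Omega>: "y \<in> \<Omega>" using bdry y(1) open_\<Omega> by (force simp: frontier_def interior_open)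
    have "0 \<le> pd d (pd d u) y" for d
    proof -
      obtain \<delta> where \<delta>: "\<delta> > 0" "\<And>t. \<bar>t\<bar> < \<delta> \<Longrightarrow> y + t *\<^sub>R d \<in> \<Omega>"
        using open_contains_line[OF open_\<Omega> y\<Omega>] by blast
      have z: "y + 0 *\<^sub>R d \<in> \<Omega>" using y\<Omega> by simp
      have "0 \<le> pd d (pd d u) (y + 0 *\<^sub>R d)"
        by (rule second_derivative_test_min(2)[OF \<delta>(1) DERIV_line_C_open[OF open_\<Omega> C_open_pds(1)[OF open_\<Omega> u4] \<delta>(2)]
            DERIV_line_C_open[OF open_\<Omega> C_open_pds(2)[OF open_\<Omega> u4] z]])
          (use y(2) \<delta>(2) closure_subset in auto)
      then show ?thesis by simp
    qed
    then have "0 \<le> (real CARD('n) - 1) * ?L y" using n by (intro mult_nonneg_nonneg sum_nonneg) auto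
    then have "\<alpha> \<le> M" using E[OF y\<Omega>] f_bounds(1)[OF y\<Omega>] by linarith
    then show ?thesis using E[OF x(1)] f_jet(1)[OF x(1)] by linarith
  qed
  \<comment> \<open>As n - 1 >= 1, a negative Laplacian is at least its multiple by n - 1, so the
    lower bound survives the division.\<close>
  moreover have "(real CARD('n) - 1) * ?L x \<le> ?L x" if "?L x < 0"
    using mult_right_mono_neg[OF n, of "?L x"] that by simp
  moreover have "- M \<le> ?L x" if "\<not> ?L x < 0" using that M0 by linarith
  ultimately show ?thesis by (meson order_trans)
qed

text \<open>The test function is continuous on the compact part of the closure where u <= 0, because
  second derivatives extend to the boundary. If u vanishes at the maximum point, wherever that lies,
  the second derivatives drop out there and |Du| <= K suffices.\<close>

lemma boundary_or_interior_max:
  assumes x: "x \<in> \<Omega>" "u x < 0" and A: "0 \<le> A"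
  shows "\<exists>y. (u y = 0 \<and> - u x * pd \<xi> (pd \<xi> u) x \<le> A / 2 * K\<^sup>2) \<or>
    (y \<in> \<Omega> \<and> u y < 0 \<and> (\<forall>z\<in>\<Omega>. u z < 0 \<longrightarrow>
      - u z * pd \<xi> (pd \<xi> u) z + A / 2 * (norm (grad u z))\<^sup>2 \<le> - u y * pd \<xi> (pd \<xi> u) y + A / 2 * (norm (grad u y))\<^sup>2))"
proof -
  \<comment> \<open>The quadratic form u_\<xi>\<xi> written with extended derivatives, so that it
    has values on the boundary.\<close>
  define H where "H x = (\<Sum>i\<in>UNIV. \<xi> $ i * (\<Sum>j\<in>UNIV. pd_cl \<Omega> (axis j 1) (pd_cl \<Omega> (axis i 1) u) x * \<xi> $ j))" for x
  define W where "W x = - u x * H x + A / 2 * (norm (grad_cl \<Omega> u x))\<^sup>2" for x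
  let ?S = "{x \<in> closure \<Omega>. u x \<le> 0}"
  have ax: "axis i (1::real) \<in> Basis" for i :: 'n by (simp add: axis_in_Basis_iff)
  note cont = C_closed_2D[OF u2]
  have HW: "H x = pd \<xi> (pd \<xi> u) x" if "x \<in> \<Omega>" for x
    unfolding inner_hess[OF open_\<Omega> that u_C_open_2, symmetric]
    by (simp add: H_def inner_vec_def matrix_vector_mult_def hess_def pd_pd_cl_eq[OF open_\<Omega> that])
  have "continuous_on (closure \<Omega>) (grad_cl \<Omega> u)"
    unfolding grad_cl_def[abs_def] by (intro continuous_on_vec_lambda cont(2) ax)
  then have Wc: "continuous_on (closure \<Omega>) W"
    unfolding W_def H_def by (intro continuous_intros cont ax)
  have S: "compact ?S"
  proof -
    have "closed (closure \<Omega> \<inter> u -` {..0})" by (intro continuous_closed_preimage cont) auto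
    moreover have "?S = closure \<Omega> \<inter> (closure \<Omega> \<inter> u -` {..0})" by auto
    ultimately show ?thesis using compact_\<Omega> by (metis compact_Int_closed)
  qed
  have xS: "z \<in> ?S" if "z \<in> \<Omega>" "u z < 0" for z using that closure_subset by force
  obtain y where y: "y \<in> ?S" "\<And>z. z \<in> ?S \<Longrightarrow> W z \<le> W y"
    using continuous_attains_sup[OF S _ continuous_on_subset[OF Wc]] xS[OF x] by blast
  show ?thesis
  proof (cases "u y = 0")
    case True
    have "(norm (grad_cl \<Omega> u y))\<^sup>2 \<le> K\<^sup>2" using grad_cl_le y(1) by (intro power_mono) auto
    then have "W y \<le> A / 2 * K\<^sup>2" using A True by (simp add: W_def mult_left_mono)
    moreover have "- u x * H x \<le> W x" using A by (simp add: W_def)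
    ultimately show ?thesis using y(2)[OF xS[OF x]] True by (intro exI[of _ y] disjI1) (simp add: HW[OF x(1)])
  next
    case False
    then have uy: "u y < 0" using y(1) by simp
    have y\<Omega>: "y \<in> \<Omega>" using bdry y(1) open_\<Omega> uy by (force simp: frontier_def interior_open)
    have W: "W z = - u z * pd \<xi> (pd \<xi> u) z + A / 2 * (norm (grad u z))\<^sup>2" if "z \<in> \<Omega>" for z
      by (simp add: W_def HW[OF that] grad_cl_eq[OF that])
    show ?thesis
    proof (intro exI[of _ y] disjI2 conjI ballI impI y\<Omega> uy)
      fix z assume z: "z \<in> \<Omega>" "u z < 0"
      show "- u z * pd \<xi> (pd \<xi> u) z + A / 2 * (norm (grad u z))\<^sup>2 \<le> - u y * pd \<xi> (pd \<xi> u) y + A / 2 * (norm (grad u y))\<^sup>2"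
        using y(2)[OF xS[OF z]] unfolding W[OF z(1)] W[OF y\<Omega>] .
    qed
  qed
qed

text \<open>The diagonal entries are bounded above and their sum, the Laplacian, is bounded below,
  hence each of them is bounded below. Off-diagonal entries follow by polarisation with the sum and
  the difference of two axes, of norm at most 2.\<close>

lemma hess_le_of_upper_bound:
  assumes x: "x \<in> \<Omega>" "u x < 0" and B0: "0 \<le> B"
    and B: "\<And>\<xi>. norm \<xi> \<le> 2 \<Longrightarrow> - u x * pd \<xi> (pd \<xi> u) x \<le> B"
  shows "- u x * norm (hess u x) \<le> (real CARD('n))\<^sup>2 * (B + 2 * (K * M + real CARD('n) * B + B))"
proof -
  define h where "h i j = - u x * hess u x $ i $ j" for i j
  define B1 where "B1 = K * M + real CARD('n) * B + B"
  have q: "- u x * (\<xi> \<bullet> (hess u x *v \<xi>)) \<le> B" if "norm \<xi> \<le> 2" for \<xi>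
    using B[OF that] by (simp add: inner_hess[OF open_\<Omega> x(1) u_C_open_2])
  have t: "transpose (hess u x) = hess u x" by (rule transpose_hess[OF open_\<Omega> x(1) u_C_open_2])
  have sym: "h i j = h j i" for i j
    using arg_cong[OF t, of "\<lambda>A. A $ i $ j"] by (simp add: h_def transpose_def)
  have ax: "axis i 1 \<bullet> (hess u x *v axis j 1) = hess u x $ i $ j" for i j
    by (simp add: inner_axis' matrix_vector_mult_basis column_def)
  have M0: "0 \<le> M" using f_bounds(1)[OF x(1)] f_jet(1)[OF x(1)] by linarith
  have xc: "x \<in> closure \<Omega>" using x(1) closure_subset by blast
  have K: "- u x \<le> K" using u_le[OF xc] by linarith
  have KM: "0 \<le> K * M" using K M0 x(2) by simp
  have up: "h i i \<le> B" for i using q[of "axis i 1"] by (simp add: ax h_def)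
  have low: "- (K * M) - real CARD('n) * B \<le> h i i" for i
  proof -
    have "- u x * M \<le> K * M" using K M0 by (intro mult_right_mono)
    moreover have "- u x * (- M) \<le> - u x * (\<Sum>i\<in>UNIV. hess u x $ i $ i)"
      using laplacian_ge[OF x] x(2) by (intro mult_left_mono) (auto simp: hess_def)
    ultimately have "- (K * M) \<le> (\<Sum>i\<in>UNIV. h i i)" by (simp add: h_def sum_distrib_left)
    also have "\<dots> = h i i + (\<Sum>j\<in>UNIV - {i}. h j j)" by (simp add: sum.remove)
    also have "(\<Sum>j\<in>UNIV - {i}. h j j) \<le> (\<Sum>j\<in>UNIV - {i}. B)" by (intro sum_mono up)
    also have "\<dots> \<le> (\<Sum>j\<in>(UNIV::'n set). B)" using B0 by (intro sum_mono2) auto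
    finally show ?thesis by simp
  qed
  have diag: "\<bar>h i i\<bar> \<le> B1" for i
  proof -
    have "0 \<le> real CARD('n) * B" using B0 by simp
    then show ?thesis using up[of i] low[of i] KM B0 unfolding B1_def by linarith
  qed
  have "\<bar>h i j\<bar> \<le> B + 2 * B1" for i j
  proof -
    have nm: "norm (axis i (1::real) + axis j 1) \<le> 2" "norm (axis i (1::real) - axis j 1) \<le> 2"
      using norm_triangle_ineq[of "axis i (1::real)" "axis j 1"] norm_triangle_ineq4[of "axis i (1::real)" "axis j 1"]
      by simp_all
    have "h i i + h i j + h j i + h j j \<le> B" "h i i - h i j - h j i + h j j \<le> B"
      using q[OF nm(1)] q[OF nm(2)]
      by (simp_all add: matrix_vector_right_distrib matrix_vector_mult_diff_distrib inner_add_left inner_add_right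
          inner_diff_left inner_diff_right ax h_def algebra_simps)
    then show ?thesis using sym[of i j] diag[of i] diag[of j] B0 by linarith
  qed
  then have "norm ((- u x) *\<^sub>R hess u x) \<le> (real CARD('n))\<^sup>2 * (B + 2 * B1)"
    by (intro norm_matrix_le) (simp add: h_def)
  then show ?thesis using x(2) by (simp add: B1_def)
qed

end

section \<open>The constant and the final estimate\<close>

text \<open>\<open>m\<close>, \<open>M\<close> and \<open>K\<close> are fixed before
  \<open>D\<close>, and \<alpha>, the domain, f and u come after it: this order of quantifiers is
  the asserted dependence of the constant.\<close>

lemma pogorelov_estimate:
  fixes k l :: int
  assumes "0 \<le> l" "l < k" "k < int CARD('n::finite)"
  shows "\<exists>D. \<forall>\<alpha> (\<Omega>::(real^'n) set) f u x. hessian_quotient_problem k l \<alpha> \<Omega> f u m \<longrightarrow>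
    norm_f \<Omega> u f = M \<longrightarrow> norm_u \<Omega> u = K \<longrightarrow> x \<in> \<Omega> \<longrightarrow> - u x * norm (hess u x) \<le> D"
proof -
  have nkl: "nat l < nat k" "nat k < CARD('n)" using assms by auto
  obtain c C where cC: "c > 0" "C > 0" and me: "\<And>\<alpha> (A::real^'n^'n) M. transpose A = A \<Longrightarrow>
    with_alpha \<alpha> (eigenvalues A) \<in> garding (nat k) UNIV \<Longrightarrow>
    es_quotient (nat k) (nat l) UNIV (with_alpha \<alpha> (eigenvalues A)) \<le> M \<Longrightarrow>
    (\<exists>e a \<tau>. orthonormal e \<and> (\<forall>i. A *v e i = (eigenvalues A $ i) *\<^sub>R e i) \<and>
      0 < \<tau> \<and> \<tau> \<le> 1 + M \<and> (\<forall>i. c \<le> a i \<and> a i \<le> C) \<and>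
      (\<forall>B. transpose B = B \<longrightarrow> with_alpha \<alpha> (eigenvalues B) \<in> garding (nat k) UNIV \<longrightarrow>
        \<tau> * (ln (es_quotient (nat k) (nat l) UNIV (with_alpha \<alpha> (eigenvalues B))) - ln (es_quotient (nat k) (nat l) UNIV (with_alpha \<alpha> (eigenvalues A))))
          \<le> (\<Sum>i\<in>UNIV. a i * (e i \<bullet> (B *v e i))) - (\<Sum>i\<in>UNIV. a i * (e i \<bullet> (A *v e i)))))"
    using matrix_estimate[OF nkl] by blast
  define n where "n = real CARD('n)"
  \<comment> \<open>The bound on \<tau> from the matrix estimate, since the quotient equals f, which
    is at most M.\<close>
  define T where "T = 1 + M"
  define C1 where "C1 = grad_const T K M m"
  define C2 where "C2 = hess_const T K M m"
  define C3 where "C3 = third_const T M m"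
  define A where "A = (4 * n * C + K * C2 + c) / c"
  define Y where "Y = 1 + ((2 * C * K * (n * (4 + A) * K) + K * (C3 * (n * (4 + A) * K) + A * n * K * C1))
     + K\<^sup>2 * (K * C2 + A * n * K * C1)) / c"
  \<comment> \<open>At an interior maximum the Hessian term is at most 4 (-u) R, hence 4 Y, and the
    gradient term at most A/2 K^2. The absolute values give a nonnegative B while M and K are still
    arbitrary reals, without a solution behind them.\<close>
  define B where "B = 4 * \<bar>Y\<bar> + \<bar>A\<bar> / 2 * K\<^sup>2"
  define D where "D = n\<^sup>2 * (B + 2 * (K * M + n * B + B))"
  \<comment> \<open>The 0 covers the points where u >= 0.\<close>
  have "- u x * norm (hess u x) \<le> max 0 D"
    if "hessian_quotient_problem k l \<alpha> \<Omega> f u m" and M: "norm_f \<Omega> u f = M" and K: "norm_u \<Omega> u = K"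
      and x: "x \<in> \<Omega>" for \<alpha> and \<Omega> :: "(real^'n) set" and f u x
  proof (cases "u x < 0")
    case False
    then have "- u x * norm (hess u x) \<le> 0" by (simp add: mult_nonpos_nonneg)
    then show ?thesis by linarith
  next
    case True
    interpret P: hessian_quotient_problem k l \<alpha> \<Omega> f u m by fact
    have M0: "0 \<le> M" using P.f_bounds(1)[OF x] P.f_jet(1)[OF x] M by linarith
    have xc: "y \<in> closure \<Omega>" if "y \<in> \<Omega>" for y using that closure_subset by blast
    have K0: "0 \<le> K" using P.u_le[OF xc[OF x]] K by linarith
    have fo: "C_open 2 (\<Omega> \<times> UNIV \<times> UNIV) f"
      using P.open_\<Omega> by (intro C_closed_imp_C_open P.f open_Times) auto
    have int: "interior_maximum \<Omega> u f y e lam a \<tau> c C T K M m A' \<xi>"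
      if y: "y \<in> \<Omega>" "u y < 0" and e: "orthonormal e" "\<And>i. hess u y *v e i = lam i *\<^sub>R e i"
        and a: "\<And>i. c \<le> a i" "\<And>i. a i \<le> C" and \<tau>: "0 < \<tau>" "\<tau> \<le> T"
        and mn: "\<And>z. z \<in> \<Omega> \<Longrightarrow> \<tau> * (ln (f (jet u z)) - ln (f (jet u y)))
          \<le> (\<Sum>i\<in>UNIV. a i * (e i \<bullet> (hess u z *v e i))) - (\<Sum>i\<in>UNIV. a i * (e i \<bullet> (hess u y *v e i)))"
        and mx: "\<And>z. z \<in> \<Omega> \<Longrightarrow> u z < 0 \<Longrightarrow>
          - u z * pd \<xi> (pd \<xi> u) z + A' / 2 * (norm (grad u z))\<^sup>2 \<le> - u y * pd \<xi> (pd \<xi> u) y + A' / 2 * (norm (grad u y))\<^sup>2"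
        and \<xi>: "norm \<xi> \<le> 2" for y e lam a \<tau> A' \<xi>
      using P.u_le[OF xc[OF y(1)]] P.grad_cl_le[OF xc[OF y(1)]] K P.f_bounds[OF y(1)] M
      by unfold_locales
        (use P.open_\<Omega> P.u4 fo P.f_jet y e cC a \<tau> mn mx \<xi> P.m(1) P.grad_cl_eq in auto)
    have me': "\<exists>e a \<tau>. orthonormal e \<and> (\<forall>i. hess u y *v e i = (eigenvalues (hess u y) $ i) *\<^sub>R e i) \<and>
        0 < \<tau> \<and> \<tau> \<le> T \<and> (\<forall>i. c \<le> a i \<and> a i \<le> C) \<and> (\<forall>z\<in>\<Omega>. \<tau> * (ln (f (jet u z)) - ln (f (jet u y)))
          \<le> (\<Sum>i\<in>UNIV. a i * (e i \<bullet> (hess u z *v e i))) - (\<Sum>i\<in>UNIV. a i * (e i \<bullet> (hess u y *v e i))))"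
      if y: "y \<in> \<Omega>" for y
    proof -
      have t: "transpose (hess u z) = hess u z" if "z \<in> \<Omega>" for z
        by (rule transpose_hess[OF P.open_\<Omega> that P.u_C_open_2])
      have le: "es_quotient (nat k) (nat l) UNIV (with_alpha \<alpha> (eigenvalues (hess u y))) \<le> M"
        using P.garding_jet(2)[OF y] P.f_bounds(1)[OF y] M by simp
      obtain e a \<tau> where "orthonormal e" "\<forall>i. hess u y *v e i = (eigenvalues (hess u y) $ i) *\<^sub>R e i"
        "0 < \<tau>" "\<tau> \<le> 1 + M" "\<forall>i. c \<le> a i \<and> a i \<le> C" and
        "\<And>B. transpose B = B \<Longrightarrow> with_alpha \<alpha> (eigenvalues B) \<in> garding (nat k) UNIV \<Longrightarrow>
        \<tau> * (ln (es_quotient (nat k) (nat l) UNIV (with_alpha \<alpha> (eigenvalues B))) - ln (es_quotient (nat k) (nat l) UNIV (with_alpha \<alpha> (eigenvalues (hess u y)))))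
          \<le> (\<Sum>i\<in>UNIV. a i * (e i \<bullet> (B *v e i))) - (\<Sum>i\<in>UNIV. a i * (e i \<bullet> (hess u y *v e i)))"
        using me[OF t[OF y] P.garding_jet(1)[OF y] le] by blast
      moreover from this(6)[OF t P.garding_jet(1)] have "\<forall>z\<in>\<Omega>. \<tau> * (ln (f (jet u z)) - ln (f (jet u y)))
          \<le> (\<Sum>i\<in>UNIV. a i * (e i \<bullet> (hess u z *v e i))) - (\<Sum>i\<in>UNIV. a i * (e i \<bullet> (hess u y *v e i)))"
        by (simp add: P.garding_jet(2) y)
      ultimately show ?thesis unfolding T_def by blast
    qed
    have "0 \<le> C2" using M0 K0 P.m(1) by (simp add: C2_def T_def hess_const_def)
    then have A0: "0 \<le> A" using K0 cC by (simp add: A_def n_def)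
    have Ac: "A * c = 4 * n * C + K * C2 + c" using cC by (simp add: A_def)
    have B0: "0 \<le> B" by (simp add: B_def)
    have "- u x * pd \<xi> (pd \<xi> u) x \<le> B" if \<xi>: "norm \<xi> \<le> 2" for \<xi>
    proof -
      let ?W = "\<lambda>z. - u z * pd \<xi> (pd \<xi> u) z + A / 2 * (norm (grad u z))\<^sup>2"
      obtain y where "- u x * pd \<xi> (pd \<xi> u) x \<le> A / 2 * K\<^sup>2 \<or>
          (y \<in> \<Omega> \<and> u y < 0 \<and> (\<forall>z\<in>\<Omega>. u z < 0 \<longrightarrow> ?W z \<le> ?W y))"
        using P.boundary_or_interior_max[OF x True A0, of \<xi>] unfolding K by blast
      then consider "- u x * pd \<xi> (pd \<xi> u) x \<le> A / 2 * K\<^sup>2" 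
        | "y \<in> \<Omega>" "u y < 0" "\<And>z. z \<in> \<Omega> \<Longrightarrow> u z < 0 \<Longrightarrow> ?W z \<le> ?W y" by blast
      then show ?thesis
      proof cases
        case 1
        then show ?thesis using A0 by (simp add: B_def)
      next
        case 2
        obtain e a \<tau> where e: "orthonormal e" "\<And>i. hess u y *v e i = (eigenvalues (hess u y) $ i) *\<^sub>R e i"
          "0 < \<tau>" "\<tau> \<le> T" "\<And>i. c \<le> a i" "\<And>i. a i \<le> C" "\<And>z. z \<in> \<Omega> \<Longrightarrow> \<tau> * (ln (f (jet u z)) - ln (f (jet u y)))
          \<le> (\<Sum>i\<in>UNIV. a i * (e i \<bullet> (hess u z *v e i))) - (\<Sum>i\<in>UNIV. a i * (e i \<bullet> (hess u y *v e i)))"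
          using me'[OF 2(1)] by blast
        interpret I: interior_maximum \<Omega> u f y e "\<lambda>i. eigenvalues (hess u y) $ i" a \<tau> c C T K M m A \<xi>
          by (rule int[OF 2(1,2) e(1,2,5,6,3,4,7) 2(3) \<xi>])
        have "- u y * I.R \<le> Y"
          using I.estimate[OF A0 Ac[unfolded C2_def] n_def] by (simp add: Y_def C1_def C2_def C3_def)
        moreover have "- u y * pd \<xi> (pd \<xi> u) y \<le> - u y * (4 * I.R)"
          using I.v_le 2(2) by (intro mult_left_mono) auto
        moreover have "A / 2 * (norm (grad u y))\<^sup>2 \<le> A / 2 * K\<^sup>2"
          using I.K(2) A0 by (intro mult_left_mono power_mono) auto
        moreover have "0 \<le> A / 2 * (norm (grad u x))\<^sup>2" using A0 by simp
        moreover have "- u y * (4 * I.R) = 4 * (- u y * I.R)" "\<bar>A\<bar> = A" "Y \<le> \<bar>Y\<bar>" using A0 by simp_all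
        ultimately show ?thesis using 2(3)[OF x True] unfolding B_def by linarith
      qed
    qed
    from P.hess_le_of_upper_bound[OF x True B0 this] show ?thesis
      by (simp add: D_def n_def M K)
  qed
  then show ?thesis by blast
qed

theorem theorem3:
  fixes k l :: int
  assumes "0 \<le> l" and "l < k" and "k < int CARD('n::finite)"
  shows "\<exists>C :: real \<Rightarrow> real \<Rightarrow> real \<Rightarrow> real.
    \<forall>(\<alpha>::real) (\<Omega>::(real^'n) set) (f :: (real^'n) \<times> real \<times> (real^'n) \<Rightarrow> real) (u :: real^'n \<Rightarrow> real) (m::real).
      \<alpha> \<ge> 0 \<longrightarrow>
      bounded_domain \<Omega> \<longrightarrow>
      C_closed 2 (\<Omega> \<times> UNIV \<times> UNIV) f \<longrightarrow>
      (\<forall>x\<in>closure \<Omega>. \<forall>z p. f (x, z, p) > 0) \<longrightarrow>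
      C_open 4 \<Omega> u \<longrightarrow>
      C_closed 2 \<Omega> u \<longrightarrow>
      admissible (k - 1) \<Omega> u \<longrightarrow>
      (\<forall>x\<in>\<Omega>. (esym k (eta u x) + \<alpha> * esym (k - 1) (eta u x)) /
               (esym l (eta u x) + \<alpha> * esym (l - 1) (eta u x)) =
               f (x, u x, grad_cl \<Omega> u x)) \<longrightarrow>
      (\<forall>x\<in>frontier \<Omega>. u x = 0) \<longrightarrow>
      m > 0 \<longrightarrow>
      (\<forall>x\<in>closure \<Omega>. m \<le> f (x, u x, grad_cl \<Omega> u x)) \<longrightarrow>
      (\<forall>x\<in>\<Omega>. - u x * norm (hess u x) \<le> C m (norm_f \<Omega> u f) (norm_u \<Omega> u))"
proof -
  \<comment> \<open>Choice turns the constants found for the individual triples into one function of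
    m, M and K.\<close>
  have "\<exists>C. \<forall>m M K. \<forall>\<alpha> (\<Omega>::(real^'n) set) f u x. hessian_quotient_problem k l \<alpha> \<Omega> f u m \<longrightarrow>
    norm_f \<Omega> u f = M \<longrightarrow> norm_u \<Omega> u = K \<longrightarrow> x \<in> \<Omega> \<longrightarrow> - u x * norm (hess u x) \<le> C m M K"
    using pogorelov_estimate[OF assms] by (intro choice allI)
  then obtain C where C: "\<And>m \<alpha> (\<Omega>::(real^'n) set) f u x. hessian_quotient_problem k l \<alpha> \<Omega> f u m \<Longrightarrow>
    x \<in> \<Omega> \<Longrightarrow> - u x * norm (hess u x) \<le> C m (norm_f \<Omega> u f) (norm_u \<Omega> u)" by blast
  show ?thesis
    using assms by (intro exI[of _ C] allI impI ballI C hessian_quotient_problem.intro) auto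
qed

end
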